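(* Let $(a_{ij})_{i,j\in I}$ be an affine Cartan matrix, with weight lattice $P=L\oplus Q$ and Weyl group $W$. (i) If $|I|>2$, then $H^1\bigl(W,\,R\otimes_{\mathbb Z[e^{\pm\delta}]}\mathbb Z[P]\bigr)=0$. (ii) For any affine Lie algebra $\mathfrak g$ (i.e. any affine Cartan matrix, with no restriction on $|I|$), $$H^1\Bigl(W,\;R\otimes_{\mathbb Z[e^{\pm\delta}]}\Bigl(\bigoplus_{\lambda\in P,\ |\langle c,\lambda\rangle|<\langle c,\rho\rangle}\mathbb Z e^\lambda\Bigr)\Bigr)=0,$$ where $\rho=\sum_{i\in I}\Lambda_i$.
   Context: $(a_{ij})_{i,j\in I}$ is an affine Cartan matrix; $Q=\bigoplus_{i\in I}\mathbb Z\alpha_i$, $L=\bigoplus_{i\in I}\mathbb Z\Lambda_i$, $P=L\oplus Q$, and $h_i\in\mathrm{Hom}(P,\mathbb Z)$ is given by $\langle h_i,\alpha_j\rangle=a_{ij}$, $\langle h_i,\Lambda_j\rangle=\delta_{ij}$. $W\subset\mathrm{Aut}(P)$ is the Weyl group, generated by $s_i(\lambda)=\lambda-\langle h_i,\lambda\rangle\alpha_i$ ($i\in I$). It acts on the group ring $\mathbb Z[P]$ (basis $e^\lambda$, $\lambda\in P$) by $we^\lambda=e^{w\lambda}$. $\delta\in\sum_i\mathbb Z_{\ge0}\alpha_i$ is the element with $\{\alpha\in Q:\langle h_i,\alpha\rangle=0\ \forall i\}=\mathbb Z\delta$, and $c\in\sum_i\mathbb Z_{\ge0}h_i$ is the element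 with $\{h\in\sum_i\mathbb Zh_i:\langle h,\alpha_i\rangle=0\ \forall i\}=\mathbb Zc$. The number $\langle c,\rho\rangle=\kappa^*$ is the dual Coxeter number. $R$ is the subring of $\mathbb Q(e^\delta)$ generated by $e^{\pm\delta}$ and $(e^{n\delta}-1)^{-1}$ ($n\ne0$). Since $\delta$ is $W$-fixed, $W$ acts $R$-linearly on $R\otimes_{\mathbb Z[e^{\pm\delta}]}M$ for every $W$-stable $\mathbb Z[e^{\pm\delta}]$-submodule $M\subset\mathbb Z[P]$ (such as those above, as $\langle c,\cdot\rangle$ is $W$-invariant and $\langle c,\delta\rangle=0$). $H^1(W,-)$ is group cohomology. *)

theory Defs
  imports
    "HOL-Analysis.Analysis"
    "HOL-Algebra.Algebra"
    "HOL-Algebra.Algebraic_Closure_Type"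
    "HOL-Computational_Algebra.Fraction_Field"
begin

unbundle no Formal_Power_Series.fps_syntax

section \<open>Affine Cartan matrices\<close>

definition generalized_cartan_matrix :: "int ^ 'i ^ 'i \<Rightarrow> bool" where
  "generalized_cartan_matrix A \<longleftrightarrow>
     (\<forall>i. A $ i $ i = 2) \<and>
     (\<forall>i j. i \<noteq> j \<longrightarrow> A $ i $ j \<le> 0) \<and>
     (\<forall>i j. A $ i $ j = 0 \<longrightarrow> A $ j $ i = 0)"

definition indecomposable_matrix :: "int ^ 'i ^ 'i \<Rightarrow> bool" where
  "indecomposable_matrix A \<longleftrightarrow>
     \<not> (\<exists>J. J \<noteq> {} \<and> J \<noteq> UNIV \<and> (\<forall>i\<in>J. \<forall>j\<in>-J. A $ i $ j = 0 \<and> A $ j $ i = 0))"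

text \<open>Affine type as in Kac's trichotomy finite / affine / indefinite (``Infinite-dimensional
  Lie algebras'', Theorem 4.3): corank 1, a strictly positive null vector, and
  \<open>A v \<ge> 0\<close> only if \<open>A v = 0\<close>.\<close>

definition affine_cartan_matrix :: "int ^ 'i ^ 'i \<Rightarrow> bool" where
  "affine_cartan_matrix A \<longleftrightarrow>
     generalized_cartan_matrix A \<and> indecomposable_matrix A \<and>
     (let A' = map_matrix real_of_int A in
        rank A' + 1 = CARD('i) \<and>
        (\<exists>u. (\<forall>i. u $ i > 0) \<and> A' *v u = 0) \<and>
        (\<forall>v. (\<forall>i. (A' *v v) $ i \<ge> 0) \<longrightarrow> A' *v v = 0))"


section \<open>Weight lattice and Weyl group\<close>

text \<open>\<open>P = L \<oplus> Q\<close> is the free abelian group on the \<open>\<Lambda>\<^sub>i\<close>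
  (coordinates \<open>Inl i\<close>) and the \<open>\<alpha>\<^sub>i\<close> (coordinates \<open>Inr i\<close>).\<close>

type_synonym 'i weight = "int ^ ('i + 'i)"

definition fund_weight :: "'i::finite \<Rightarrow> 'i weight" where
  "fund_weight i = axis (Inl i) 1"

definition simple_root :: "'i::finite \<Rightarrow> 'i weight" where
  "simple_root i = axis (Inr i) 1"

definition root_lattice :: "('i::finite) weight set" where
  "root_lattice = {\<Sum>i\<in>UNIV. n i *s simple_root i | n. True}"

definition rho :: "('i::finite) weight" where
  "rho = (\<Sum>i\<in>UNIV. fund_weight i)"

definition coroot :: "int ^ 'i ^ 'i \<Rightarrow> 'i \<Rightarrow> 'i weight \<Rightarrow> int" where
  "coroot A i x = x $ Inl i + (\<Sum>j\<in>UNIV. A $ i $ j * x $ Inr j)"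

definition coroot_lattice :: "int ^ 'i ^ 'i \<Rightarrow> ('i weight \<Rightarrow> int) set" where
  "coroot_lattice A = {\<lambda>x. \<Sum>i\<in>UNIV. n i * coroot A i x | n. True}"

text \<open>For affine \<open>A\<close> the two sublattices below are infinite cyclic with a generator having
  nonnegative coefficients, so \<open>\<delta>\<close> and \<open>c \<in> Hom(P, \<int>)\<close> exist and are unique.\<close>

definition null_root :: "int ^ 'i ^ 'i \<Rightarrow> 'i weight" where
  "null_root A = (THE d.
     (\<exists>n :: 'i \<Rightarrow> nat. d = (\<Sum>i\<in>UNIV. int (n i) *s simple_root i)) \<and>
     {x \<in> root_lattice. \<forall>i. coroot A i x = 0} = {k *s d | k. True})"

definition central_element :: "int ^ 'i ^ 'i \<Rightarrow> 'i weight \<Rightarrow> int" where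
  "central_element A = (THE c.
     (\<exists>n :: 'i \<Rightarrow> nat. c = (\<lambda>x. \<Sum>i\<in>UNIV. int (n i) * coroot A i x)) \<and>
     {h \<in> coroot_lattice A. \<forall>i. h (simple_root i) = 0} = {\<lambda>x. k * c x | k. True})"

definition simple_reflection :: "int ^ 'i ^ 'i \<Rightarrow> 'i \<Rightarrow> 'i weight \<Rightarrow> 'i weight" where
  "simple_reflection A i x = x - coroot A i x *s simple_root i"

definition weight_group :: "('i::finite) weight monoid" where
  "weight_group = \<lparr>carrier = UNIV, monoid.mult = (+), one = 0\<rparr>"

definition weyl_group :: "int ^ 'i ^ 'i \<Rightarrow> ('i weight \<Rightarrow> 'i weight) monoid" where
  "weyl_group A = subgroup_generated (AutoGroup weight_group) (range (simple_reflection A))"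


section \<open>Group rings and the ring R\<close>

text \<open>The group ring \<open>\<int>[P]\<close> is the type \<open>'i weight \<Rightarrow>\<^sub>0 int\<close> with its convolution product.
  The ring \<open>\<int>[e\<^sup>\<plusminus>\<^sup>\<delta>]\<close> is the group ring of \<open>\<int>\<delta> \<cong> \<int>\<close>; it is
  represented by \<open>int \<Rightarrow>\<^sub>0 int\<close>, where \<open>Poly_Mapping.single n 1\<close> stands for
  \<open>e\<^sup>n\<^sup>\<delta>\<close>. It embeds in \<open>\<int>[P]\<close> by \<open>laurent_embed \<delta>\<close>, and
  \<open>\<rat>(e\<^sup>\<delta>)\<close> is its field of fractions.\<close>

type_synonym 'i weight_ring = "'i weight \<Rightarrow>\<^sub>0 int"
type_synonym laurent = "int \<Rightarrow>\<^sub>0 int"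

definition laurent_embed :: "('i::finite) weight \<Rightarrow> laurent \<Rightarrow> 'i weight_ring" where
  "laurent_embed d s =
     (\<Sum>k\<in>Poly_Mapping.keys s. Poly_Mapping.single (k *s d) (Poly_Mapping.lookup s k))"

definition weyl_act :: "(('i::finite) weight \<Rightarrow> 'i weight) \<Rightarrow> 'i weight_ring \<Rightarrow> 'i weight_ring" where
  "weyl_act w p =
     (\<Sum>x\<in>Poly_Mapping.keys p. Poly_Mapping.single (w x) (Poly_Mapping.lookup p x))"

definition exp_delta :: "int \<Rightarrow> laurent fract" where
  "exp_delta n = Fract (Poly_Mapping.single n 1) 1"

definition R_set :: "laurent fract set" where
  "R_set = generate_ring ring_of_type_algebra
     ({exp_delta 1, exp_delta (-1)} \<union> {inverse (exp_delta n - 1) | n. n \<noteq> 0})"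

text \<open>The next two are modules over the Laurent ring. As usual for module records, the fields
  \<open>mult\<close> and \<open>one\<close> carry no meaning (in the second one the carrier need not be
  closed under them).\<close>

definition R_module :: "(laurent, laurent fract) module" where
  "R_module = \<lparr>carrier = R_set, monoid.mult = (*), one = 1, ring.zero = 0, add = (+),
     smult = (\<lambda>s r. Fract s 1 * r)\<rparr>"

text \<open>The module \<open>\<Oplus>\<^sub>\<lambda>\<^sub>\<in>\<^sub>Y \<int> e\<^sup>\<lambda>\<close>, for a set \<open>Y\<close>
  of weights stable under translation by \<open>\<delta>\<close>.\<close>

definition weight_module ::
    "int ^ 'i ^ 'i \<Rightarrow> 'i weight set \<Rightarrow> (laurent, 'i weight_ring) module" where
  "weight_module A Y = \<lparr>carrier = {p. Poly_Mapping.keys p \<subseteq> Y}, monoid.mult = (*), one = 1,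
     ring.zero = 0, add = (+), smult = (\<lambda>s p. laurent_embed (null_root A) s * p)\<rparr>"


section \<open>Tensor products over a commutative ring\<close>

definition tensor_free ::
    "('s, 'n, 'a) module_scheme \<Rightarrow> ('s, 'm, 'b) module_scheme \<Rightarrow> ('n \<times> 'm \<Rightarrow>\<^sub>0 int) monoid" where
  "tensor_free N M = free_Abelian_group (carrier N \<times> carrier M)"

definition tensor_relators ::
    "('s, 'c) ring_scheme \<Rightarrow> ('s, 'n, 'a) module_scheme \<Rightarrow> ('s, 'm, 'b) module_scheme
      \<Rightarrow> ('n \<times> 'm \<Rightarrow>\<^sub>0 int) set" where
  "tensor_relators S N M =
     {frag_of (x \<oplus>\<^bsub>N\<^esub> x', y) - frag_of (x, y) - frag_of (x', y) | x x' y.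
        x \<in> carrier N \<and> x' \<in> carrier N \<and> y \<in> carrier M} \<union>
     {frag_of (x, y \<oplus>\<^bsub>M\<^esub> y') - frag_of (x, y) - frag_of (x, y') | x y y'.
        x \<in> carrier N \<and> y \<in> carrier M \<and> y' \<in> carrier M} \<union>
     {frag_of (s \<odot>\<^bsub>N\<^esub> x, y) - frag_of (x, s \<odot>\<^bsub>M\<^esub> y) | s x y.
        s \<in> carrier S \<and> x \<in> carrier N \<and> y \<in> carrier M}"

definition tensor_kernel ::
    "('s, 'c) ring_scheme \<Rightarrow> ('s, 'n, 'a) module_scheme \<Rightarrow> ('s, 'm, 'b) module_scheme
      \<Rightarrow> ('n \<times> 'm \<Rightarrow>\<^sub>0 int) set" where
  "tensor_kernel S N M = generate (tensor_free N M) (tensor_relators S N M)"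

text \<open>The abelian group \<open>N \<otimes>\<^sub>S M\<close>, written multiplicatively as a HOL-Algebra group.\<close>

definition tensor_product ::
    "('s, 'c) ring_scheme \<Rightarrow> ('s, 'n, 'a) module_scheme \<Rightarrow> ('s, 'm, 'b) module_scheme
      \<Rightarrow> ('n \<times> 'm \<Rightarrow>\<^sub>0 int) set monoid" where
  "tensor_product S N M = tensor_free N M Mod tensor_kernel S N M"

text \<open>For an \<open>S\<close>-linear \<open>f : M \<rightarrow> M\<close>, this is \<open>id \<otimes> f\<close> on cosets. All members of the union
  are the same coset.\<close>

definition tensor_map ::
    "('s, 'c) ring_scheme \<Rightarrow> ('s, 'n, 'a) module_scheme \<Rightarrow> ('s, 'm, 'b) module_scheme
      \<Rightarrow> ('m \<Rightarrow> 'm) \<Rightarrow> ('n \<times> 'm \<Rightarrow>\<^sub>0 int) set \<Rightarrow> ('n \<times> 'm \<Rightarrow>\<^sub>0 int) set" where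
  "tensor_map S N M f C =
     (\<Union>z\<in>C. tensor_kernel S N M #>\<^bsub>tensor_free N M\<^esub> frag_extend (\<lambda>(x, y). frag_of (x, f y)) z)"


section \<open>First group cohomology\<close>

text \<open>For a group \<open>G\<close> acting by \<open>act\<close> on an abelian group \<open>B\<close> (in multiplicative notation):
  inhomogeneous 1-cocycles modulo 1-coboundaries. Cochains are extensional functions, so that
  they are determined by their values on \<open>carrier G\<close>.\<close>

definition cocycles1 ::
    "('g, 'x) monoid_scheme \<Rightarrow> ('b, 'y) monoid_scheme \<Rightarrow> ('g \<Rightarrow> 'b \<Rightarrow> 'b) \<Rightarrow> ('g \<Rightarrow> 'b) monoid" where
  "cocycles1 G B act =
     \<lparr>carrier = {f \<in> carrier G \<rightarrow>\<^sub>E carrier B.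
         \<forall>g\<in>carrier G. \<forall>h\<in>carrier G. f (g \<otimes>\<^bsub>G\<^esub> h) = f g \<otimes>\<^bsub>B\<^esub> act g (f h)},
      monoid.mult = (\<lambda>f f'. \<lambda>g\<in>carrier G. f g \<otimes>\<^bsub>B\<^esub> f' g),
      one = (\<lambda>g\<in>carrier G. \<one>\<^bsub>B\<^esub>)\<rparr>"

definition coboundaries1 ::
    "('g, 'x) monoid_scheme \<Rightarrow> ('b, 'y) monoid_scheme \<Rightarrow> ('g \<Rightarrow> 'b \<Rightarrow> 'b) \<Rightarrow> ('g \<Rightarrow> 'b) set" where
  "coboundaries1 G B act = {\<lambda>g\<in>carrier G. act g b \<otimes>\<^bsub>B\<^esub> inv\<^bsub>B\<^esub> b | b. b \<in> carrier B}"

definition cohomology1 ::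
    "('g, 'x) monoid_scheme \<Rightarrow> ('b, 'y) monoid_scheme \<Rightarrow> ('g \<Rightarrow> 'b \<Rightarrow> 'b) \<Rightarrow> ('g \<Rightarrow> 'b) set monoid" where
  "cohomology1 G B act = cocycles1 G B act Mod coboundaries1 G B act"

text \<open>\<open>H\<^sup>1(W, R \<otimes> \<Oplus>\<^sub>\<lambda>\<^sub>\<in>\<^sub>Y \<int> e\<^sup>\<lambda>)\<close>, the tensor product being over
  \<open>\<int>[e\<^sup>\<plusminus>\<^sup>\<delta>]\<close>, for a \<open>W\<close>-stable \<open>Y\<close> stable under translation by \<open>\<delta>\<close>.\<close>

definition weyl_cohomology1 ::
    "int ^ 'i ^ 'i \<Rightarrow> 'i weight set
      \<Rightarrow> (('i weight \<Rightarrow> 'i weight) \<Rightarrow> (laurent fract \<times> 'i weight_ring \<Rightarrow>\<^sub>0 int) set) set monoid" where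
  "weyl_cohomology1 A Y =
     cohomology1 (weyl_group A)
       (tensor_product ring_of_type_algebra R_module (weight_module A Y))
       (\<lambda>w. tensor_map ring_of_type_algebra R_module (weight_module A Y) (weyl_act w))"

end

theory Submission
  imports Defs
begin

text \<open>Extending scalars identifies \<open>R \<otimes> \<Oplus>\<^sub>\<lambda> \<int> e\<^sup>\<lambda>\<close> with the functions \<open>f\<close> on the
  weights such that \<open>f (\<lambda> + \<delta>) = e\<^sup>-\<^sup>\<delta> f \<lambda>\<close>, with values in \<open>R\<close> and support finite modulo
  \<open>\<delta>\<close>; the Weyl group acts by translation of the argument. A cocycle is then treated one orbit at a
  time.

  At nonzero level a cocycle is, on the orbit of a dominant weight, the coboundary of some function
  \<open>g\<close>, because stabilizers are generated by simple reflections and \<open>R\<close> has no torsion. All but finitely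
  many edges of the orbit graph leave \<open>g\<close> unchanged, and the orbit graph has one end: if
  \<open>|I| > 2\<close> since rank two parabolic subgroups are finite, and if \<open>|I| = 2\<close> since at small level the
  dominant weight is singular and the orbit graph is a half line. So \<open>g\<close> is constant outside a finite
  set, and subtracting the constant makes it finitely supported.

  At level zero orbits are finite modulo \<open>\<delta>\<close>, and on every weight that is not fixed by the Weyl group
  some translation acts by \<open>e\<^sup>n\<^sup>\<delta>\<close> with \<open>n \<noteq> 0\<close>; as \<open>e\<^sup>n\<^sup>\<delta> - 1\<close> is invertible in \<open>R\<close> and translations
  commute, the cocycle is a coboundary there.\<close>

section \<open>Null vectors of generalized Cartan matrices\<close>

text \<open>The hinge of all finiteness arguments is symmetrizability: the ratios
  \<open>comark i / mark i\<close> of the left and right null vectors symmetrize the matrix, and the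
  resulting quadratic form on the root lattice is positive semidefinite with kernel spanned by
  \<delta>. Its invariance takes the place of reduced words, the length function and real roots. It
  makes upward chains finite at positive level, makes orbits of level zero finite modulo \<delta>,
  and shows that at nonzero level two points of an orbit never differ by a nonzero multiple of
  \<delta>. Because of the last fact, support that is finite modulo \<delta> is honestly finite on
  such an orbit.

  Two methods are unavoidable. A dominant weight of level zero is fixed by the Weyl group, so a
  moving orbit of level zero has no top to start from; at nonzero level no element acts on a weight
  as a nontrivial shift by \<delta>, so there is nothing to divide by. The denominators of R are
  therefore used at level zero alone. With two indices and a regular dominant weight the orbit graph
  would be a line with two ends, on which the constants at infinity may differ; this is what the
  bound on the level excludes.\<close>

locale gcm =
  fixes a :: "'i::finite \<Rightarrow> 'i \<Rightarrow> int"
  assumes diag: "a i i = 2"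
    and offdiag: "i \<noteq> j \<Longrightarrow> a i j \<le> 0"
    and zero_sym: "a i j = 0 \<Longrightarrow> a j i = 0"
    and indec: "J \<noteq> {} \<Longrightarrow> (\<And>i j. i \<in> J \<Longrightarrow> j \<notin> J \<Longrightarrow> a i j = 0) \<Longrightarrow> J = UNIV"
begin

lemma gcm_transpose: "gcm (\<lambda>i j. a j i)"
proof
  fix J :: "'i set" assume *: "J \<noteq> {}" "\<And>i j. i \<in> J \<Longrightarrow> j \<notin> J \<Longrightarrow> a j i = 0"
  show "J = UNIV" using *(2) zero_sym by (intro indec[OF *(1)]) blast
qed (use diag offdiag zero_sym in auto)

text \<open>In a row i with \<open>x i = 0\<close> the surviving terms are all nonpositive and sum
  to zero, so each of them vanishes. No edge then leaves the zero set of x, and indecomposability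
  makes that set everything.\<close>

lemma null_vanish:
  fixes x :: "'i \<Rightarrow> 'b::linordered_idom"
  assumes null: "\<And>i. (\<Sum>j\<in>UNIV. of_int (a i j) * x j) = 0"
    and nonneg: "\<And>i. x i \<ge> 0" and "x k = 0"
  shows "x i = 0"
proof -
  define J where "J = {i. x i = 0}"
  have "a i j = 0" if ij: "i \<in> J" "j \<notin> J" for i j
  proof -
    have le: "of_int (a i l) * x l \<le> 0" for l
    proof (cases "l = i")
      case True then show ?thesis using ij by (simp add: J_def)
    next
      case False
      then have "of_int (a i l) \<le> (0::'b)" using offdiag[of i l] by simp
      then show ?thesis using nonneg[of l] by (rule mult_nonpos_nonneg)
    qed
    have "(\<Sum>l\<in>UNIV. - (of_int (a i l) * x l)) = 0"
      using null[of i] by (simp add: sum_negf)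
    then have "- (of_int (a i j) * x j) = 0"
      using le by (subst (asm) sum_nonneg_eq_0_iff) auto
    then show ?thesis using ij by (simp add: J_def)
  qed
  moreover have "J \<noteq> {}" using assms(3) by (auto simp: J_def)
  ultimately have "J = UNIV" using indec by blast
  then show ?thesis by (auto simp: J_def)
qed

text \<open>The signs of the entries make every column sum against \<open>\<bar>y\<bar>\<close>
  nonpositive. Weighting these sums with the positive null vector u gives total zero, so equality
  holds throughout. This turns a null vector of unknown sign into a nonnegative one.\<close>

lemma null_abs:
  fixes u y :: "'i \<Rightarrow> 'b::linordered_idom"
  assumes u: "\<And>i. u i > 0" "\<And>i. (\<Sum>j\<in>UNIV. of_int (a i j) * u j) = 0"
    and y: "\<And>j. (\<Sum>i\<in>UNIV. of_int (a i j) * y i) = 0"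
  shows "(\<Sum>i\<in>UNIV. of_int (a i j) * \<bar>y i\<bar>) = 0"
proof -
  have split: "(\<Sum>i\<in>UNIV. of_int (a i j) * z i) = 2 * z j + (\<Sum>i\<in>UNIV - {j}. of_int (a i j) * z i)"
    for z :: "'i \<Rightarrow> 'b" and j
    by (subst sum.remove[of UNIV j]) (auto simp: diag)
  have le: "(\<Sum>i\<in>UNIV. of_int (a i j) * \<bar>y i\<bar>) \<le> 0" for j
  proof -
    have "2 * y j = - (\<Sum>i\<in>UNIV - {j}. of_int (a i j) * y i)"
      using y[of j] by (simp add: split eq_neg_iff_add_eq_0)
    then have "\<bar>2 * y j\<bar> = \<bar>\<Sum>i\<in>UNIV - {j}. of_int (a i j) * y i\<bar>"
      by simp
    then have "2 * \<bar>y j\<bar> = \<bar>\<Sum>i\<in>UNIV - {j}. of_int (a i j) * y i\<bar>"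
      by (simp add: abs_mult)
    also have "\<dots> \<le> (\<Sum>i\<in>UNIV - {j}. \<bar>of_int (a i j) * y i\<bar>)" by (rule sum_abs)
    also have "\<dots> = - (\<Sum>i\<in>UNIV - {j}. of_int (a i j) * \<bar>y i\<bar>)"
      unfolding sum_negf[symmetric]
    proof (rule sum.cong)
      fix i assume "i \<in> UNIV - {j}"
      then have "of_int (a i j) \<le> (0::'b)" using offdiag[of i j] by simp
      then show "\<bar>of_int (a i j) * y i\<bar> = - (of_int (a i j) * \<bar>y i\<bar>)"
        by (metis abs_mult abs_of_nonpos mult_minus_left)
    qed simp
    finally show ?thesis by (simp add: split)
  qed
  have "(\<Sum>j\<in>UNIV. - (u j * (\<Sum>i\<in>UNIV. of_int (a i j) * \<bar>y i\<bar>)))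
      = - (\<Sum>i\<in>UNIV. \<bar>y i\<bar> * (\<Sum>j\<in>UNIV. of_int (a i j) * u j))"
    unfolding sum_distrib_left sum_negf
    by (subst sum.swap) (simp add: mult_ac)
  also have "\<dots> = 0" using u(2) by simp
  finally have "- (u j * (\<Sum>i\<in>UNIV. of_int (a i j) * \<bar>y i\<bar>)) = 0"
    using le u(1) by (subst (asm) sum_nonneg_eq_0_iff)
      (auto intro: mult_nonneg_nonpos less_imp_le)
  then show ?thesis using u(1)[of j] by simp
qed

end

text \<open>The affine hypothesis supplies only a real null vector. The determinant carries
  singularity over to the rationals, and the product of all denominators of a rational null vector
  makes it integral.\<close>

lemma singular_int_null:
  fixes A :: "int ^ 'i::finite ^ 'i"
  assumes "det A = 0"
  obtains x :: "'i \<Rightarrow> int" where "x \<noteq> (\<lambda>_. 0)" "\<And>i. (\<Sum>j\<in>UNIV. A $ i $ j * x j) = 0"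
proof -
  define B where "B = map_matrix rat_of_int A"
  have "det B = of_int (det A)"
    by (simp add: B_def det_def map_matrix_def)
  then have "det B = 0" using assms by simp
  then have "\<not> invertible B" by (simp add: invertible_det_nz)
  then have "\<not> (\<exists>C. C ** B = mat 1)" by (simp add: invertible_left_inverse)
  then obtain y where y: "B *v y = 0" "y \<noteq> 0"
    unfolding matrix_left_invertible_ker by blast
  define N where "N = (\<Prod>i\<in>UNIV. snd (quotient_of (y $ i)))"
  have N: "N > 0" unfolding N_def
    by (intro prod_pos) (metis prod.collapse quotient_of_denom_pos)
  have int: "\<exists>z. of_int N * y $ i = of_int z" for i
  proof -
    obtain p q where pq: "quotient_of (y $ i) = (p, q)" by fastforce
    have q: "q > 0" "y $ i = of_int p / of_int q"
      using pq quotient_of_denom_pos quotient_of_div by auto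
    have "q dvd N" unfolding N_def using pq
      by (metis UNIV_I dvd_prodI finite_class.finite_UNIV snd_conv)
    then obtain m where "N = q * m" by blast
    then have "of_int N * y $ i = of_int (m * p)" using q by simp
    then show ?thesis ..
  qed
  define x where "x = (\<lambda>i. SOME z. of_int N * y $ i = of_int z)"
  have x: "of_int (x i) = of_int N * y $ i" for i
    unfolding x_def using someI_ex[OF int[of i]] by simp
  show thesis
  proof
    obtain i where "y $ i \<noteq> 0" using y(2) by (metis vec_eq_iff zero_index)
    then have "x i \<noteq> 0" using x[of i] N by (metis less_irrefl mult_eq_0_iff of_int_eq_0_iff)
    then show "x \<noteq> (\<lambda>_. 0)" by metis
    fix i
    have "rat_of_int (\<Sum>j\<in>UNIV. A $ i $ j * x j) = of_int N * (B *v y) $ i"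
      by (simp add: x B_def matrix_vector_mult_def map_matrix_def sum_distrib_left mult_ac)
    also have "\<dots> = 0" by (simp add: y)
    finally show "(\<Sum>j\<in>UNIV. A $ i $ j * x j) = 0" by (simp only: of_int_eq_0_iff)
  qed
qed

context gcm begin

text \<open>Subtract from z the multiple of x given by the smallest ratio \<open>z l / x l\<close>,
  scaled by \<open>x l\<close> to stay integral. The result is a nonnegative null vector that
  vanishes at l, hence zero by \<open>null_vanish\<close>, so z is proportional to x.\<close>

lemma null_unique:
  fixes x z :: "'i \<Rightarrow> int"
  assumes x: "\<And>i. x i > 0" "\<And>i. (\<Sum>j\<in>UNIV. a i j * x j) = 0"
    and z: "\<And>i. (\<Sum>j\<in>UNIV. a i j * z j) = 0" "z k = 0"
  shows "z i = 0"
proof -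
  obtain l where l: "\<And>i. z i * x l \<ge> z l * x i"
  proof -
    define q where "q = (\<lambda>i. of_int (z i) / (of_int (x i) :: rat))"
    obtain l where l: "\<And>i. q l \<le> q i"
      using ex_min_if_finite[of "range q"] by (metis (mono_tags, lifting) UNIV_I finite finite_imageI image_iff empty_iff linorder_not_less)
    have "z l * x i \<le> z i * x l" for i
    proof -
      have "of_int (z l) * of_int (x i) \<le> (of_int (z i) * of_int (x l) :: rat)"
        using l[of i] x(1)[of i] x(1)[of l] by (simp add: q_def field_simps)
      then show ?thesis by (metis of_int_le_iff of_int_mult)
    qed
    then show thesis by (intro that)
  qed
  define w where "w = (\<lambda>i. z i * x l - z l * x i)"
  have "w i = 0" for i
  proof (rule null_vanish[of w l])
    show "(\<Sum>j\<in>UNIV. of_int (a i j) * w j) = 0" for i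
    proof -
      have "(\<Sum>j\<in>UNIV. of_int (a i j) * w j)
        = x l * (\<Sum>j\<in>UNIV. a i j * z j) - z l * (\<Sum>j\<in>UNIV. a i j * x j)"
        by (simp add: w_def algebra_simps sum_subtractf sum_distrib_left)
      then show ?thesis using x z by simp
    qed
  qed (use l in \<open>auto simp: w_def\<close>)
  then have eq: "z i * x l = z l * x i" for i by (simp add: w_def)
  have "z l = 0" using eq[of k] z(2) x(1)[of k] by auto
  then show ?thesis using eq[of i] x(1)[of l] by auto
qed

text \<open>Division with remainder in a single coordinate \<open>o'\<close>: take d positive with
  \<open>d o'\<close> minimal. A remainder that is nonzero at \<open>o'\<close> would be
  proportional to d with a positive ratio below 1, hence itself a smaller positive null
  vector.\<close>

lemma null_generator:
  fixes x :: "'i \<Rightarrow> int"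
  assumes "\<And>i. x i > 0" "\<And>i. (\<Sum>j\<in>UNIV. a i j * x j) = 0"
  obtains d :: "'i \<Rightarrow> int" where "\<And>i. d i > 0" "\<And>i. (\<Sum>j\<in>UNIV. a i j * d j) = 0"
    "\<forall>z. (\<forall>i. (\<Sum>j\<in>UNIV. a i j * z j) = 0) \<longrightarrow> (\<exists>k. \<forall>i. z i = k * d i)"
proof -
  fix o' :: 'i
  define P where "P = (\<lambda>d :: 'i \<Rightarrow> int. (\<forall>i. d i > 0) \<and> (\<forall>i. (\<Sum>j\<in>UNIV. a i j * d j) = 0))"
  have "P x" using assms by (auto simp: P_def)
  then obtain d where d: "P d" "\<And>d'. P d' \<Longrightarrow> nat (d o') \<le> nat (d' o')"
    using ex_has_least_nat[of P x "\<lambda>d. nat (d o')"] by blast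
  have gen: "\<exists>k. \<forall>i. z i = k * d i" if z: "\<And>i. (\<Sum>j\<in>UNIV. a i j * z j) = 0" for z
  proof -
    define w where "w = (\<lambda>i. z i - (z o' div d o') * d i)"
    have w0: "(\<Sum>j\<in>UNIV. a i j * w j) = 0" for i
    proof -
      have "(\<Sum>j\<in>UNIV. a i j * w j)
        = (\<Sum>j\<in>UNIV. a i j * z j) - (z o' div d o') * (\<Sum>j\<in>UNIV. a i j * d j)"
        by (simp add: w_def algebra_simps sum_subtractf sum_distrib_left)
      then show ?thesis using z d(1) by (simp add: P_def)
    qed
    have wo: "w o' = z o' mod d o'" by (simp add: w_def minus_div_mult_eq_mod)
    have dpos: "d i > 0" for i using d(1) by (auto simp: P_def)
    have "w o' = 0"
    proof (rule ccontr)
      assume "w o' \<noteq> 0"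
      with wo dpos[of o'] have wpos: "w o' > 0" "w o' < d o'"
        using pos_mod_bound[of "d o'" "z o'"] pos_mod_sign[of "d o'" "z o'"]
        by linarith+
      have "w i > 0" for i
      proof -
        define v where "v = (\<lambda>i. w i * d o' - w o' * d i)"
        have "v i = 0"
        proof (rule null_unique[where x = d and z = v and k = o'])
          show "d i > 0" for i by (rule dpos)
          show "(\<Sum>j\<in>UNIV. a i j * d j) = 0" for i using d(1) by (auto simp: P_def)
          show "(\<Sum>j\<in>UNIV. a i j * v j) = 0" for i
          proof -
            have "(\<Sum>j\<in>UNIV. a i j * v j)
              = d o' * (\<Sum>j\<in>UNIV. a i j * w j) - w o' * (\<Sum>j\<in>UNIV. a i j * d j)"
              by (simp add: v_def right_diff_distrib sum_subtractf sum_distrib_left mult_ac)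
            then show ?thesis using w0 d(1) by (simp add: P_def)
          qed
        qed (simp add: v_def)
        then have "w i * d o' = w o' * d i" by (simp add: v_def)
        then show ?thesis using wpos dpos[of i] dpos[of o']
          by (metis zero_less_mult_pos2 mult_pos_pos)
      qed
      then have "P w" using w0 by (auto simp: P_def)
      then show False using d(2)[of w] wpos by simp
    qed
    then have "w i = 0" for i
      using null_unique[where x = d and z = w and k = o'] dpos w0 d(1) by (auto simp: P_def)
    then have "z i = (z o' div d o') * d i" for i
      unfolding w_def by (metis eq_iff_diff_eq_0)
    then show ?thesis by blast
  qed
  have "d i > 0" "(\<Sum>j\<in>UNIV. a i j * d j) = 0" for i
    using d(1) by (simp_all add: P_def)
  then show thesis by (rule that) (use gen in blast)
qed


text \<open>Each \<open>R k * L k\<close> below is at most \<open>d k * d k\<close> by the inequality of arithmetic and geometric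
  means, whereas around the cycle the product of the former is at least that of the latter.\<close>

lemma cycle_rigid:
  fixes d :: "'i \<Rightarrow> int"
  assumes d: "\<And>i. d i > 0" "\<And>i. (\<Sum>j\<in>UNIV. a i j * d j) = 0"
    and nx: "bij_betw nx T T"
    and T: "\<And>k. k \<in> T \<Longrightarrow> nx k \<noteq> k \<and> nx (nx k) \<noteq> k \<and> a k (nx k) \<noteq> 0"
    and "k \<in> T"
  shows "- a k (nx k) * d (nx k) = d k"
proof -
  define pv where "pv = inv_into T nx"
  have pv: "pv k \<in> T" "nx (pv k) = k" if "k \<in> T" for k
    using bij_betw_inv_into[OF nx] that nx
    by (auto simp: pv_def bij_betwE bij_betw_inv_into_right)
  have pvn: "pv (nx k) = k" if "k \<in> T" for k
    using nx that by (simp add: pv_def bij_betw_inv_into_left)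
  define R where "R = (\<lambda>k. - a k (nx k) * d (nx k))"
  define L where "L = (\<lambda>k. - a k (pv k) * d (pv k))"
  have neg: "a k (nx k) \<le> - 1" "a (nx k) k \<le> - 1" if "k \<in> T" for k
    using T[OF that] offdiag[of k "nx k"] offdiag[of "nx k" k] zero_sym[of "nx k" k] by force+
  have neg': "a k (pv k) \<le> - 1" if "k \<in> T" for k
    using neg(2)[OF pv(1)[OF that]] pv(2)[OF that] by simp
  have pos: "R k > 0" "L k > 0" if "k \<in> T" for k
    using neg(1)[OF that] neg'[OF that] d(1)
    by (auto simp: R_def L_def mult_less_0_iff)
  \<comment> \<open>\<open>R k\<close> and \<open>L k\<close> are two off-diagonal terms of row k of
    the null equation, with their signs reversed; all the other off-diagonal terms are
    nonpositive.\<close>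
  have le: "R k + L k \<le> 2 * d k" if k: "k \<in> T" for k
  proof -
    have ne: "nx k \<noteq> k" "pv k \<noteq> k" "pv k \<noteq> nx k"
      using T[OF k] T[OF pv(1)[OF k]] pv(2)[OF k] by auto
    have "0 = (\<Sum>j\<in>UNIV. a k j * d j)" using d(2) by simp
    also have "\<dots> = 2 * d k - R k - L k + (\<Sum>j\<in>UNIV - {k} - {nx k} - {pv k}. a k j * d j)"
      using ne by (subst sum.remove[of UNIV k], simp, simp, subst sum.remove[of _ "nx k"], simp, simp,
          subst sum.remove[of _ "pv k"]) (simp_all add: diag R_def L_def)
    also have "(\<Sum>j\<in>UNIV - {k} - {nx k} - {pv k}. a k j * d j) \<le> 0"
      using offdiag[of k] d(1) by (intro sum_nonpos mult_nonpos_nonneg) (auto intro: less_imp_le)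
    finally show ?thesis by simp
  qed
  have RL: "R k * L k \<le> d k * d k" if k: "k \<in> T" for k
  proof -
    have "(R k + L k)\<^sup>2 \<le> (2 * d k)\<^sup>2"
      using le[OF k] pos[OF k] by (intro power_mono) auto
    moreover have "0 \<le> (R k - L k)\<^sup>2" by simp
    ultimately show ?thesis by (simp add: power2_eq_square algebra_simps)
  qed
  \<comment> \<open>Reindexing L along the cycle brings the two entries of each edge together, and
    their product is at least 1.\<close>
  have "(\<Prod>k\<in>T. R k * L k) = (\<Prod>k\<in>T. R k) * (\<Prod>k\<in>T. L (nx k))"
    using prod.reindex_bij_betw[OF nx, of L] by (simp add: prod.distrib)
  also have "\<dots> = (\<Prod>k\<in>T. (a k (nx k) * a (nx k) k) * d k * d (nx k))"
    unfolding prod.distrib[symmetric]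
    by (rule prod.cong) (auto simp: R_def L_def pvn mult_ac)
  also have "\<dots> = (\<Prod>k\<in>T. a k (nx k) * a (nx k) k) * (\<Prod>k\<in>T. d k * d k)"
    using prod.reindex_bij_betw[OF nx, of d] by (simp add: prod.distrib)
  also have "\<dots> \<ge> 1 * (\<Prod>k\<in>T. d k * d k)"
  proof (rule mult_right_mono)
    have "1 \<le> a k (nx k) * a (nx k) k" if "k \<in> T" for k
      using mult_mono[of 1 "- a k (nx k)" 1 "- a (nx k) k"] neg[OF that] by simp
    then show "1 \<le> (\<Prod>k\<in>T. a k (nx k) * a (nx k) k)" by (intro prod_ge_1) auto
  qed (use d(1) in \<open>auto intro!: prod_nonneg less_imp_le\<close>)
  finally have ge: "(\<Prod>k\<in>T. d k * d k) \<le> (\<Prod>k\<in>T. R k * L k)" by simp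
  have "R k * L k = d k * d k"
  proof (rule ccontr)
    assume "R k * L k \<noteq> d k * d k"
    then have lt: "R k * L k < d k * d k" using RL[OF \<open>k \<in> T\<close>] by simp
    have "(\<Prod>k\<in>T. R k * L k) = R k * L k * (\<Prod>k\<in>T - {k}. R k * L k)"
      using \<open>k \<in> T\<close> by (simp add: prod.remove)
    also have "\<dots> < d k * d k * (\<Prod>k\<in>T - {k}. R k * L k)"
      using lt pos by (intro mult_strict_right_mono prod_pos) auto
    also have "\<dots> \<le> d k * d k * (\<Prod>k\<in>T - {k}. d k * d k)"
      using RL pos by (intro mult_left_mono prod_mono) (auto intro: less_imp_le)
    also have "\<dots> = (\<Prod>k\<in>T. d k * d k)"
      using \<open>k \<in> T\<close> by (simp add: prod.remove)
    finally show False using ge by simp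
  qed
  moreover have "(R k + L k)\<^sup>2 \<le> (2 * d k)\<^sup>2"
    using le[OF \<open>k \<in> T\<close>] pos[OF \<open>k \<in> T\<close>] by (intro power_mono) auto
  ultimately have "(R k - L k)\<^sup>2 \<le> 0"
    by (simp add: power2_eq_square algebra_simps)
  then have "R k = L k" by simp
  with \<open>R k * L k = d k * d k\<close> have "(R k)\<^sup>2 = (d k)\<^sup>2" by (simp add: power2_eq_square)
  then have "R k = d k"
    using pos(1)[OF \<open>k \<in> T\<close>] d(1)[of k] by (simp add: power2_eq_iff)
  then show ?thesis by (simp add: R_def)
qed

text \<open>The antisymmetric part \<open>f\<close> of the matrix has zero row sums, so if it did not vanish its support
  would contain a directed cycle, on which \<open>cycle_rigid\<close> makes \<open>f\<close> vanish.\<close>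

lemma null_symmetric:
  fixes c d :: "'i \<Rightarrow> int"
  assumes d: "\<And>i. d i > 0" "\<And>i. (\<Sum>j\<in>UNIV. a i j * d j) = 0"
    and c: "\<And>i. c i > 0" "\<And>j. (\<Sum>i\<in>UNIV. a i j * c i) = 0"
  shows "c i * a i j * d j = c j * a j i * d i"
proof (rule ccontr)
  assume ne: "\<not> ?thesis"
  define f where "f = (\<lambda>i j. c j * a j i * d i - c i * a i j * d j)"
  have f_sum: "(\<Sum>j\<in>UNIV. f i j) = 0" for i
  proof -
    have "(\<Sum>j\<in>UNIV. f i j) = d i * (\<Sum>j\<in>UNIV. a j i * c j) - c i * (\<Sum>j\<in>UNIV. a i j * d j)"
      by (simp add: f_def sum_subtractf sum_distrib_left mult_ac)
    then show ?thesis using c(2) d(2) by simp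
  qed
  have f_anti: "f j i = - f i j" for i j by (simp add: f_def)
  define S where "S = {i. \<exists>j. f i j > 0}"
  define nx where "nx = (\<lambda>i. SOME j. f i j > 0)"
  have nx: "f i (nx i) > 0" if "i \<in> S" for i
    using that unfolding S_def nx_def by (auto intro: someI_ex)
  have nxS: "nx i \<in> S" if "i \<in> S" for i
  proof (rule ccontr)
    assume "nx i \<notin> S"
    then have le: "f (nx i) j \<le> 0" for j by (auto simp: S_def not_less)
    have "(\<Sum>j\<in>UNIV. - f (nx i) j) = 0" using f_sum by (simp add: sum_negf)
    then have "- f (nx i) i = 0"
      using le by (subst (asm) sum_nonneg_eq_0_iff) auto
    then show False using nx[OF that] f_anti[of "nx i" i] by simp
  qed
  have "S \<noteq> {}"
  proof -
    have "f i j \<noteq> 0" using ne by (simp add: f_def)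
    then have "f i j > 0 \<or> f j i > 0" using f_anti[of i j] by linarith
    then show ?thesis by (auto simp: S_def)
  qed
  \<comment> \<open>The successor map permutes a nonempty stable subset of least size; there the
    cycle argument applies.\<close>
  define Cl where "Cl = (\<lambda>T. T \<noteq> {} \<and> T \<subseteq> S \<and> nx ` T \<subseteq> T)"
  have "Cl S" using \<open>S \<noteq> {}\<close> nxS by (auto simp: Cl_def)
  then obtain T where T: "Cl T" "\<And>T'. Cl T' \<Longrightarrow> card T \<le> card T'"
    using ex_has_least_nat[of Cl S card] by blast
  have "Cl (nx ` T)" using T(1) by (auto simp: Cl_def)
  then have "nx ` T = T"
    using T(1) T(2)[of "nx ` T"] by (intro card_subset_eq antisym card_image_le) (auto simp: Cl_def)
  then have bij: "bij_betw nx T T"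
    by (simp add: bij_betw_def finite_surj_inj)
  have cyc: "nx k \<noteq> k \<and> nx (nx k) \<noteq> k \<and> a k (nx k) \<noteq> 0 \<and> a (nx k) k \<noteq> 0" if "k \<in> T" for k
  proof -
    have *: "k \<in> S" "nx k \<in> S" using that T(1) nxS by (auto simp: Cl_def)
    have "f k k = 0" by (simp add: f_def)
    then have "nx k \<noteq> k" using nx[OF *(1)] by auto
    moreover have "nx (nx k) \<noteq> k"
      using nx[OF *(1)] nx[OF *(2)] f_anti[of k "nx k"] by auto
    moreover have "a k (nx k) \<noteq> 0 \<or> a (nx k) k \<noteq> 0"
      using nx[OF *(1)] by (auto simp: f_def)
    ultimately show ?thesis using zero_sym by blast
  qed
  obtain k where k: "k \<in> T" using T(1) by (auto simp: Cl_def)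
  \<comment> \<open>Rigidity for the matrix and for its transpose turns the two terms of
    \<open>f k (nx k)\<close> into \<open>- c k * d k\<close> and \<open>c k * d k\<close>, which
    cancel.\<close>
  have 1: "- a k (nx k) * d (nx k) = d k"
    using cyc by (intro cycle_rigid[OF d bij _ k]) auto
  have 2: "- a (nx k) k * c (nx k) = c k"
    using cyc by (intro gcm.cycle_rigid[OF gcm_transpose c bij _ k]) auto
  have "f k (nx k) = - (c k * d k) + c k * d k"
  proof -
    have "f k (nx k) = - (- a (nx k) k * c (nx k)) * d k + c k * (- a k (nx k) * d (nx k))"
      by (simp add: f_def mult_ac)
    then show ?thesis unfolding 1 2 by simp
  qed
  then show False using nx[of k] k T(1) by (auto simp: Cl_def)
qed

text \<open>Rows i and j of the null equation bound each of the two entries by the ratio of the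
  marks. A product of at least 4 makes both bounds tight, which leaves no room for other entries in
  these rows; then i and j form a component by themselves, against the assumption of a third
  index.\<close>

lemma rank_two_bound:
  fixes d :: "'i \<Rightarrow> int"
  assumes d: "\<And>i. d i > 0" "\<And>i. (\<Sum>j\<in>UNIV. a i j * d j) = 0"
    and "i \<noteq> j" "CARD('i) > 2"
  shows "a i j * a j i < 4"
proof (rule ccontr)
  assume "\<not> ?thesis"
  then have ge: "a i j * a j i \<ge> 4" by simp
  have split: "0 = 2 * d k + a k l * d l + (\<Sum>m\<in>UNIV - {k} - {l}. a k m * d m)" if "k \<noteq> l" for k l
  proof -
    have "0 = (\<Sum>j\<in>UNIV. a k j * d j)" using d(2) by simp
    also have "\<dots> = 2 * d k + a k l * d l + (\<Sum>m\<in>UNIV - {k} - {l}. a k m * d m)"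
      using that by (subst sum.remove[of UNIV k], simp, simp, subst sum.remove[of _ "l"])
        (simp_all add: diag)
    finally show ?thesis .
  qed
  have rest: "(\<Sum>m\<in>UNIV - {k} - {l}. a k m * d m) \<le> 0" for k l
    using offdiag[of k] d(1) by (intro sum_nonpos mult_nonpos_nonneg) (auto intro: less_imp_le)
  have "a i j \<noteq> 0" "a j i \<noteq> 0" using ge by auto
  then have neg: "a i j < 0" "a j i < 0" using offdiag[of i j] offdiag[of j i] assms(3) by auto
  have bound: "- a k l * d l \<le> 2 * d k" if "k \<noteq> l" for k l
    using split[OF that] rest[of k l] by simp
  \<comment> \<open>The bound for the pair (l, k), multiplied by \<open>- a k l\<close> and combined
    with the product being at least 4, reverses the bound for (k, l).\<close>
  have tight: "- a k l * d l = 2 * d k" if kl: "k \<noteq> l" "a k l < 0" "a l k < 0" "a k l * a l k \<ge> 4" for k l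
  proof -
    have "2 * (2 * d k - - a k l * d l) = 4 * d k - 2 * (- a k l * d l)" by simp
    also have "\<dots> \<le> (a k l * a l k) * d k - 2 * (- a k l * d l)"
      using kl(4) d(1)[of k] by (intro diff_right_mono mult_right_mono) auto
    also have "\<dots> = - a k l * (- a l k * d k - 2 * d l)" by (simp add: algebra_simps)
    also have "\<dots> \<le> 0" using bound[of l k] kl by (intro mult_nonneg_nonpos) auto
    finally show ?thesis using bound[OF kl(1)] by simp
  qed
  have zero: "a k m = 0" if kl: "k \<noteq> l" "a k l < 0" "a l k < 0" "a k l * a l k \<ge> 4" "m \<noteq> k" "m \<noteq> l" for k l m
  proof -
    have "(\<Sum>m\<in>UNIV - {k} - {l}. - (a k m * d m)) = 0"
      using split[OF kl(1)] tight[OF kl(1-4)] by (simp add: sum_negf)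
    then have "- (a k m * d m) = 0"
      using kl(5,6) offdiag[of k] d(1)
      by (subst (asm) sum_nonneg_eq_0_iff) (auto intro!: mult_nonpos_nonneg intro: less_imp_le)
    then show ?thesis using d(1)[of m] by simp
  qed
  have "{i, j} = UNIV"
  proof (rule indec)
    fix k m assume "k \<in> {i, j}" "m \<notin> {i, j}"
    then show "a k m = 0"
      using zero[of i j m] zero[of j i m] neg assms(3) ge by (auto simp: mult.commute)
  qed simp
  then have "CARD('i) = card {i, j}" by simp
  then show False using assms(3,4) by simp
qed

end

section \<open>Weights and coroots in coordinates\<close>

lemma weight_eq_iff:
  fixes x y :: "'i::finite weight"
  shows "x = y \<longleftrightarrow> (\<forall>i. x $ Inl i = y $ Inl i) \<and> (\<forall>i. x $ Inr i = y $ Inr i)"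
  by (auto simp: vec_eq_iff split_sum_all)

lemma simple_root_nth [simp]:
  "simple_root i $ Inl j = 0" "simple_root i $ Inr j = (if i = j then 1 else 0)"
  by (auto simp: simple_root_def axis_def)

lemma fund_weight_nth [simp]:
  "fund_weight i $ Inr j = 0" "fund_weight i $ Inl j = (if i = j then 1 else 0)"
  by (auto simp: fund_weight_def axis_def)

lemma sum_simple_root_nth [simp]:
  "(\<Sum>i\<in>UNIV. n i *s simple_root i) $ Inl j = 0"
  "(\<Sum>i\<in>UNIV. n i *s simple_root i) $ Inr j = n j"
  by (simp_all add: if_distrib if_distribR cong: if_cong)

lemma root_lattice_iff: "x \<in> root_lattice \<longleftrightarrow> (\<forall>i. x $ Inl i = 0)"
proof
  assume "\<forall>i. x $ Inl i = 0"
  then have "x = (\<Sum>i\<in>UNIV. x $ Inr i *s simple_root i)" by (simp add: weight_eq_iff del: sum_component)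
  then show "x \<in> root_lattice"
    unfolding root_lattice_def by (auto intro: exI[of _ "\<lambda>i. x $ Inr i"])
qed (auto simp: root_lattice_def simp del: sum_component)

lemma coroot_add: "coroot A i (x + y) = coroot A i x + coroot A i y"
  by (simp add: coroot_def distrib_left sum.distrib)

lemma coroot_diff: "coroot A i (x - y) = coroot A i x - coroot A i y"
  by (simp add: coroot_def right_diff_distrib sum_subtractf)

lemma coroot_scale: "coroot A i (k *s x) = k * coroot A i x"
  by (simp add: coroot_def distrib_left sum_distrib_left mult_ac)

lemma coroot_minus: "coroot A i (- x) = - coroot A i x"
  by (simp add: coroot_def sum_negf)

lemma coroot_zero [simp]: "coroot A i 0 = 0"
  by (simp add: coroot_def)

lemma coroot_simple_root [simp]: "coroot A i (simple_root j) = A $ i $ j"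
  by (simp add: coroot_def if_distrib cong: if_cong)

lemma coroot_fund_weight [simp]: "coroot A i (fund_weight j) = (if i = j then 1 else 0)"
  by (auto simp: coroot_def)

lemma coroot_sum: "coroot A i (sum f S) = (\<Sum>s\<in>S. coroot A i (f s))"
  by (induction S rule: infinite_finite_induct) (auto simp: coroot_add)

lemmas coroot_linear = coroot_add coroot_diff coroot_scale coroot_minus

lemma coroot_rho [simp]: "coroot A i rho = 1"
  by (simp add: rho_def coroot_sum)

section \<open>Marks, comarks and the level\<close>

locale affine_cartan =
  fixes A :: "int ^ 'i::finite ^ 'i"
  assumes affine: "affine_cartan_matrix A"
begin

abbreviation "h \<equiv> coroot A"
abbreviation "\<delta> \<equiv> null_root A"
abbreviation "s \<equiv> simple_reflection A"
abbreviation "\<alpha> \<equiv> (simple_root :: 'i \<Rightarrow> 'i weight)"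
abbreviation "\<Lambda> \<equiv> (fund_weight :: 'i \<Rightarrow> 'i weight)"
abbreviation "level \<equiv> central_element A"

definition "mark i = \<delta> $ Inr i"
text \<open>Fundamental weights are dual to the simple coroots, so evaluating c at
  \<open>\<Lambda> i\<close> reads off its coefficient at \<open>h i\<close>.\<close>

definition "comark i = level (\<Lambda> i)"

sublocale gcm "\<lambda>i j. A $ i $ j"
proof
  show "A $ i $ i = 2" for i
    using affine by (auto simp: affine_cartan_matrix_def generalized_cartan_matrix_def)
  show "A $ i $ j \<le> 0" if "i \<noteq> j" for i j
    using affine that by (auto simp: affine_cartan_matrix_def generalized_cartan_matrix_def)
  show zs: "A $ j $ i = 0" if "A $ i $ j = 0" for i j
    using affine that by (auto simp: affine_cartan_matrix_def generalized_cartan_matrix_def)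
  show "J = UNIV" if "J \<noteq> {}" "\<And>i j. i \<in> J \<Longrightarrow> j \<notin> J \<Longrightarrow> A $ i $ j = 0" for J
    using affine that zs unfolding affine_cartan_matrix_def indecomposable_matrix_def
    by (metis ComplD)
qed

text \<open>The real positive null vector u makes the determinant zero, so integral null vectors
  exist on both sides, with unknown signs. Pairing with u makes the absolute values of the left one
  null, pairing with these does the same for the right one, and \<open>null_vanish\<close> gives
  strict positivity.\<close>

lemma null_vectors_exist:
  obtains x y :: "'i \<Rightarrow> int" where
    "\<And>i. x i > 0" "\<And>i. (\<Sum>j\<in>UNIV. A $ i $ j * x j) = 0"
    "\<And>i. y i > 0" "\<And>j. (\<Sum>i\<in>UNIV. A $ i $ j * y i) = 0"
proof -
  define A' where "A' = map_matrix real_of_int A"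
  obtain u where u: "\<And>i. u $ i > 0" "A' *v u = 0"
    using affine by (auto simp: affine_cartan_matrix_def Let_def A'_def)
  have u': "(\<Sum>j\<in>UNIV. of_int (A $ i $ j) * u $ j) = 0" for i
    using arg_cong[OF u(2), of "\<lambda>v. v $ i"]
    by (simp add: A'_def matrix_vector_mult_def map_matrix_def)
  have "u \<noteq> 0" using u(1) by (metis less_irrefl zero_index)
  then have "\<not> (\<exists>C. C ** A' = mat 1)"
    using u(2) unfolding matrix_left_invertible_ker by blast
  then have "\<not> invertible A'" by (simp add: invertible_left_inverse)
  then have "det A' = 0" by (simp add: invertible_det_nz)
  moreover have "det A' = of_int (det A)"
    by (simp add: A'_def det_def map_matrix_def)
  ultimately have det: "det A = 0" by simp
  have "det (transpose A) = 0" using det by simp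
  then obtain y where y': "y \<noteq> (\<lambda>_. 0)" "\<And>j. (\<Sum>i\<in>UNIV. transpose A $ j $ i * y i) = 0"
    by (rule singular_int_null) (rule that, assumption+)
  have y: "y \<noteq> (\<lambda>_. 0)" "\<And>j. (\<Sum>i\<in>UNIV. A $ i $ j * y i) = 0"
    using y' by (simp_all add: transpose_def)
  obtain x where x: "x \<noteq> (\<lambda>_. 0)" "\<And>i. (\<Sum>j\<in>UNIV. A $ i $ j * x j) = 0"
    by (rule singular_int_null[OF det]) (rule that, assumption+)
  have "(\<Sum>i\<in>UNIV. of_int (A $ i $ j) * \<bar>real_of_int (y i)\<bar>) = 0" for j
  proof (rule null_abs[OF u(1) u'])
    show "(\<Sum>i\<in>UNIV. real_of_int (A $ i $ j) * real_of_int (y i)) = 0" for j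
      using arg_cong[OF y(2)[of j], of real_of_int] by simp
  qed
  then have "real_of_int (\<Sum>i\<in>UNIV. A $ i $ j * \<bar>y i\<bar>) = 0" for j
    by simp
  then have y0: "(\<Sum>i\<in>UNIV. A $ i $ j * \<bar>y i\<bar>) = 0" for j
    by (simp only: of_int_eq_0_iff)
  have ypos: "\<bar>y i\<bar> > 0" for i
    using gcm.null_vanish[OF gcm_transpose, of "\<lambda>i. \<bar>y i\<bar>" i] y0 y(1) by fastforce
  have x0: "(\<Sum>j\<in>UNIV. A $ i $ j * \<bar>x j\<bar>) = 0" for i
    using gcm.null_abs[OF gcm_transpose, of "\<lambda>i. \<bar>y i\<bar>" x i] ypos y0 x(2) by simp
  have xpos: "\<bar>x i\<bar> > 0" for i
    using null_vanish[of "\<lambda>i. \<bar>x i\<bar>" i] x0 x(1) by fastforce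
  show thesis by (rule that[OF xpos x0 ypos y0])
qed

text \<open>\<delta> is a definite description, so besides the positive generator its uniqueness is
  required: two generators of the same cyclic group divide each other in every coefficient, and
  nonnegative integers that do so are equal.\<close>

lemma null_root_props:
  shows null_root_Inl: "\<delta> $ Inl i = 0"
    and mark_pos: "mark i > 0"
    and mark_null: "(\<Sum>j\<in>UNIV. A $ i $ j * mark j) = 0"
    and null_multiple: "(\<And>i. (\<Sum>j\<in>UNIV. A $ i $ j * z j) = 0) \<Longrightarrow> \<exists>k. \<forall>i. z i = k * mark i"
proof -
  obtain x y where x: "\<And>i. x i > 0" "\<And>i. (\<Sum>j\<in>UNIV. A $ i $ j * x j) = 0"
    and "\<And>i. y i > 0" "\<And>j. (\<Sum>i\<in>UNIV. A $ i $ j * y i) = 0"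
    by (rule null_vectors_exist) (rule that, assumption+)
  obtain d where d: "\<And>i. d i > 0" "\<And>i. (\<Sum>j\<in>UNIV. A $ i $ j * d j) = 0"
    "\<forall>z. (\<forall>i. (\<Sum>j\<in>UNIV. A $ i $ j * z j) = 0) \<longrightarrow> (\<exists>k. \<forall>i. z i = k * d i)"
    by (rule null_generator[OF x]) (rule that, assumption+)
  define D where "D = (\<Sum>i\<in>UNIV. d i *s \<alpha> i)"
  have Dn: "D $ Inl i = 0" "D $ Inr i = d i" for i by (simp_all add: D_def del: sum_component)
  have set_eq: "{x \<in> root_lattice. \<forall>i. h i x = 0} = {k *s D | k. True}"
  proof (intro equalityI subsetI)
    fix x assume "x \<in> {x \<in> root_lattice. \<forall>i. h i x = 0}"
    then have x: "\<And>i. x $ Inl i = 0" "\<And>i. h i x = 0" by (auto simp: root_lattice_iff)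
    then obtain k where "\<And>i. x $ Inr i = k * d i"
      using spec[OF d(3), of "\<lambda>j. x $ Inr j"] by (auto simp: coroot_def)
    then have "x = k *s D" using x by (simp add: weight_eq_iff Dn)
    then show "x \<in> {k *s D | k. True}" by blast
  next
    fix x assume "x \<in> {k *s D | k. True}"
    then obtain k where x: "x = k *s D" by blast
    have "h i D = 0" for i using d(2)[of i] by (simp add: coroot_def Dn)
    then show "x \<in> {x \<in> root_lattice. \<forall>i. h i x = 0}"
      by (simp add: x root_lattice_iff Dn coroot_scale)
  qed
  have "\<delta> = D"
    unfolding null_root_def
  proof (rule the_equality)
    show "(\<exists>n. D = (\<Sum>i\<in>UNIV. int (n i) *s \<alpha> i)) \<and>
      {x \<in> root_lattice. \<forall>i. h i x = 0} = {k *s D | k. True}"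
      using set_eq d(1) by (auto intro!: exI[of _ "\<lambda>i. nat (d i)"] simp: D_def less_imp_le)
    fix E :: "'i weight" assume E: "(\<exists>n. E = (\<Sum>i\<in>UNIV. int (n i) *s \<alpha> i)) \<and>
      {x \<in> root_lattice. \<forall>i. h i x = 0} = {k *s E | k. True}"
    then obtain n where n: "E = (\<Sum>i\<in>UNIV. int (n i) *s \<alpha> i)" by blast
    note DE = trans[OF set_eq[symmetric] conjunct2[OF E]]
    have "D \<in> {k *s E | k. True}" unfolding DE[symmetric] by (auto intro: exI[of _ 1])
    then obtain k where k: "D = k *s E" by blast
    have "E \<in> {k *s D | k. True}" unfolding DE by (auto intro: exI[of _ 1])
    then obtain l where l: "E = l *s D" by blast
    have "E $ Inr i = D $ Inr i" for i
    proof (rule zdvd_antisym_nonneg)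
      show "E $ Inr i \<ge> 0" by (simp add: n del: sum_component)
      show "D $ Inr i \<ge> 0" using d(1)[of i] by (simp add: Dn)
      show "E $ Inr i dvd D $ Inr i" by (subst k) simp
      show "D $ Inr i dvd E $ Inr i" by (subst l) simp
    qed
    then show "E = D" by (simp add: weight_eq_iff n Dn(1) del: sum_component)
  qed
  then have m: "mark = d" by (intro ext) (simp only: mark_def Dn)
  show "\<delta> $ Inl i = 0" using \<open>\<delta> = D\<close> Dn by simp
  show "mark i > 0" "(\<Sum>j\<in>UNIV. A $ i $ j * mark j) = 0" using d m by auto
  show "(\<And>i. (\<Sum>j\<in>UNIV. A $ i $ j * z j) = 0) \<Longrightarrow> \<exists>k. \<forall>i. z i = k * mark i"
    using d(3) m by simp
qed

lemma null_root_Inr: "\<delta> $ Inr i = mark i" by (simp add: mark_def)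

text \<open>The argument for \<delta> applied to the transposed matrix. Functionals are compared
  through their values on the fundamental weights, which are their coefficients.\<close>

lemma central_props:
  shows level_eq: "level x = (\<Sum>i\<in>UNIV. comark i * h i x)"
    and comark_pos: "comark i > 0"
    and comark_null: "(\<Sum>i\<in>UNIV. A $ i $ j * comark i) = 0"
proof -
  obtain y u where "\<And>i. y i > 0" "\<And>i. (\<Sum>j\<in>UNIV. A $ i $ j * y j) = 0"
    and u: "\<And>i. u i > 0" "\<And>j. (\<Sum>i\<in>UNIV. A $ i $ j * u i) = 0"
    by (rule null_vectors_exist) (rule that, assumption+)
  obtain d where d: "\<And>i. d i > 0" "\<And>j. (\<Sum>i\<in>UNIV. A $ i $ j * d i) = 0"
    "\<forall>z. (\<forall>j. (\<Sum>i\<in>UNIV. A $ i $ j * z i) = 0) \<longrightarrow> (\<exists>k. \<forall>i. z i = k * d i)"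
    by (rule gcm.null_generator[OF gcm_transpose u]) (rule that, assumption+)
  define D where "D = (\<lambda>x. \<Sum>i\<in>UNIV. d i * h i x)"
  have lin: "(\<Sum>i\<in>UNIV. n i * h i (\<Lambda> j)) = n j" for n :: "'i \<Rightarrow> int" and j
    by (simp add: if_distrib cong: if_cong)
  have set_eq: "{f \<in> coroot_lattice A. \<forall>i. f (\<alpha> i) = 0} = {\<lambda>x. k * D x | k. True}"
  proof (intro equalityI subsetI)
    fix f assume "f \<in> {f \<in> coroot_lattice A. \<forall>i. f (\<alpha> i) = 0}"
    then obtain n where f: "f = (\<lambda>x. \<Sum>i\<in>UNIV. n i * h i x)" "\<And>i. f (\<alpha> i) = 0"
      by (auto simp: coroot_lattice_def)
    then obtain k where "\<And>i. n i = k * d i"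
      using spec[OF d(3), of n] by (auto simp: mult.commute)
    then have "f = (\<lambda>x. k * D x)" by (simp add: f D_def sum_distrib_left mult.assoc)
    then show "f \<in> {\<lambda>x. k * D x | k. True}" by blast
  next
    fix f assume "f \<in> {\<lambda>x. k * D x | k. True}"
    then obtain k where f: "f = (\<lambda>x. k * D x)" by blast
    have "f = (\<lambda>x. \<Sum>i\<in>UNIV. (k * d i) * h i x)" by (simp add: f D_def sum_distrib_left mult.assoc)
    then have "f \<in> coroot_lattice A" unfolding coroot_lattice_def
      by (intro CollectI exI[of _ "\<lambda>i. k * d i"]) simp
    moreover have "f (\<alpha> j) = 0" for j using d(2)[of j] by (simp add: f D_def mult.commute)
    ultimately show "f \<in> {f \<in> coroot_lattice A. \<forall>i. f (\<alpha> i) = 0}" by blast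
  qed
  have "level = D"
    unfolding central_element_def
  proof (rule the_equality)
    show "(\<exists>n. D = (\<lambda>x. \<Sum>i\<in>UNIV. int (n i) * h i x)) \<and>
      {f \<in> coroot_lattice A. \<forall>i. f (\<alpha> i) = 0} = {\<lambda>x. k * D x | k. True}"
      using set_eq d(1) by (auto intro!: exI[of _ "\<lambda>i. nat (d i)"] simp: D_def less_imp_le)
    fix E assume E: "(\<exists>n. E = (\<lambda>x. \<Sum>i\<in>UNIV. int (n i) * h i x)) \<and>
      {f \<in> coroot_lattice A. \<forall>i. f (\<alpha> i) = 0} = {\<lambda>x. k * E x | k. True}"
    then obtain n where n: "E = (\<lambda>x. \<Sum>i\<in>UNIV. int (n i) * h i x)" by blast
    note DE = trans[OF set_eq[symmetric] conjunct2[OF E]]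
    have "D \<in> {\<lambda>x. k * E x | k. True}" unfolding DE[symmetric] by (auto intro: exI[of _ 1])
    then obtain k where k: "D = (\<lambda>x. k * E x)" by blast
    have "E \<in> {\<lambda>x. k * D x | k. True}" unfolding DE by (auto intro: exI[of _ 1])
    then obtain l where l: "E = (\<lambda>x. l * D x)" by blast
    have "E (\<Lambda> i) = D (\<Lambda> i)" for i
    proof (rule zdvd_antisym_nonneg)
      show "E (\<Lambda> i) \<ge> 0" unfolding n lin by simp
      show "D (\<Lambda> i) \<ge> 0" using d(1)[of i] unfolding D_def lin by simp
      show "E (\<Lambda> i) dvd D (\<Lambda> i)" by (subst k) simp
      show "D (\<Lambda> i) dvd E (\<Lambda> i)" by (subst l) simp
    qed
    then show "E = D" unfolding n D_def lin by simp
  qed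
  then have m: "comark = d" by (intro ext) (simp only: comark_def D_def lin)
  show "level x = (\<Sum>i\<in>UNIV. comark i * h i x)" by (simp add: \<open>level = D\<close> D_def m)
  show "comark i > 0" "(\<Sum>i\<in>UNIV. A $ i $ j * comark i) = 0" using d m by auto
qed

lemma mark_symmetric: "comark i * A $ i $ j * mark j = comark j * A $ j $ i * mark i"
  by (rule null_symmetric) (use mark_pos mark_null comark_pos comark_null in auto)

lemma coroot_delta [simp]: "h i \<delta> = 0"
  using mark_null[of i] by (simp add: coroot_def null_root_Inl null_root_Inr)

lemma level_root [simp]: "level (\<alpha> i) = 0"
  using comark_null[of i] by (simp add: level_eq mult.commute)

lemma level_linear:
  "level (x + y) = level x + level y" "level (x - y) = level x - level y"
  "level (k *s x) = k * level x" "level (- x) = - level x"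
  by (simp_all add: level_eq coroot_linear distrib_left right_diff_distrib sum.distrib
      sum_subtractf sum_distrib_left sum_negf mult.left_commute)

lemma level_rho: "level rho = (\<Sum>i\<in>UNIV. comark i)"
  by (simp add: level_eq)

end

section \<open>The Weyl group and its invariant form\<close>

abbreviation invf :: "('a \<Rightarrow> 'b) \<Rightarrow> 'b \<Rightarrow> 'a" where
  "invf \<equiv> inv_into UNIV"

context affine_cartan begin

lemma reflection_nth [simp]:
  "s i x $ Inl j = x $ Inl j" "s i x $ Inr j = (if i = j then x $ Inr j - h i x else x $ Inr j)"
  by (simp_all add: simple_reflection_def)

lemma coroot_reflection: "h j (s i x) = h j x - h i x * A $ j $ i"
  by (simp add: simple_reflection_def coroot_linear)

lemma reflection_linear:
  "s i (x + y) = s i x + s i y" "s i (x - y) = s i x - s i y"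
  "s i (k *s x) = k *s s i x" "s i (- x) = - s i x"
  by (simp_all add: weight_eq_iff coroot_linear algebra_simps)

lemma reflection_involution [simp]: "s i (s i x) = x"
  by (simp add: weight_eq_iff coroot_reflection diag)

lemma reflection_fixed: "h i x = 0 \<Longrightarrow> s i x = x"
  by (simp add: weight_eq_iff)

lemma level_reflection: "level (s i x) = level x"
  by (simp add: simple_reflection_def level_linear)

text \<open>Simple reflections are involutions, so words in them are closed under inverses. This
  form gives induction on one letter at the left; \<open>carrier_weyl_group\<close> identifies it
  with the group generated by the reflections.\<close>

inductive_set W :: "('i weight \<Rightarrow> 'i weight) set" where
  W_id: "id \<in> W"
| W_step: "w \<in> W \<Longrightarrow> s i \<circ> w \<in> W"

lemma W_reflection: "s i \<in> W"
  using W_step[OF W_id] by simp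

lemma W_comp: "v \<in> W \<Longrightarrow> w \<in> W \<Longrightarrow> v \<circ> w \<in> W"
  by (induction rule: W.induct) (auto simp: comp_assoc intro: W_step)

lemma reflection_inv: "invf (s i) = s i"
  by (rule inv_unique_comp) auto

lemma reflection_bij: "bij (s i)"
  by (rule o_bij[of "s i"]) auto

lemma W_bij: "w \<in> W \<Longrightarrow> bij w"
  by (induction rule: W.induct) (intro bij_id, intro bij_comp reflection_bij)

lemma W_inv: "w \<in> W \<Longrightarrow> invf w \<in> W"
proof (induction rule: W.induct)
  case (W_step w i)
  have "invf (s i \<circ> w) = invf w \<circ> s i"
    using o_inv_distrib[OF reflection_bij W_bij[OF W_step(1)], of i] by (simp only: reflection_inv)
  then show ?case using W_comp[OF W_step.IH W_reflection] by (simp only:)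
qed (simp only: inv_id W.W_id)

lemma W_inv_apply: "w \<in> W \<Longrightarrow> invf w (w x) = x" "w \<in> W \<Longrightarrow> w (invf w x) = x"
  by (simp_all add: W_bij bij_is_inj bij_is_surj surj_f_inv_f)

lemma W_linear:
  assumes "w \<in> W"
  shows W_add: "w (x + y) = w x + w y" and W_diff: "w (x - y) = w x - w y"
    and W_scale: "w (k *s x) = k *s w x" and W_minus: "w (- x) = - w x"
  using assms
  by (induction arbitrary: x y rule: W.induct) (auto simp: reflection_linear)

lemma W_fixed: "w \<in> W \<Longrightarrow> (\<And>i. h i x = 0) \<Longrightarrow> w x = x"
  by (induction rule: W.induct) (auto simp: reflection_fixed)

lemma W_delta [simp]: "w \<in> W \<Longrightarrow> w \<delta> = \<delta>"
  by (simp add: W_fixed)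

lemma W_level: "w \<in> W \<Longrightarrow> level (w x) = level x"
  by (induction rule: W.induct) (auto simp: level_reflection)

lemma W_Inl: "w \<in> W \<Longrightarrow> w x $ Inl i = x $ Inl i"
  by (induction rule: W.induct) auto

lemma weyl_group_mult:
  assumes "bij f" "bij g"
  shows "f \<otimes>\<^bsub>weyl_group A\<^esub> g = f \<circ> g"
  using assms
  by (auto simp: weyl_group_def subgroup_generated_def AutoGroup_def BijGroup_def weight_group_def
      Bij_def compose_def)

lemma weyl_group_one: "\<one>\<^bsub>weyl_group A\<^esub> = id"
  by (auto simp: weyl_group_def subgroup_generated_def AutoGroup_def BijGroup_def weight_group_def)

lemma group_weight_group: "group (weight_group :: 'i weight monoid)"
  unfolding weight_group_def
  by (rule groupI) (auto simp: add.assoc intro: exI[of _ "- x" for x])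

lemma group_weyl_group: "group (weyl_group A)"
  unfolding weyl_group_def
  by (intro group.group_subgroup_generated group.AutoGroup group_weight_group)

lemma reflection_auto: "s i \<in> carrier (AutoGroup weight_group)"
  by (auto simp: AutoGroup_def auto_def hom_def weight_group_def Bij_def reflection_bij reflection_linear)

lemma carrier_weyl_group: "carrier (weyl_group A) = W"
proof
  let ?G = "AutoGroup (weight_group :: 'i weight monoid)"
  have gen: "carrier (weyl_group A) = generate ?G (range s)"
    using reflection_auto
    by (auto simp: weyl_group_def carrier_subgroup_generated Int_absorb1 image_subset_iff)
  have mult: "f \<otimes>\<^bsub>?G\<^esub> g = f \<circ> g" if "bij f" "bij g" for f g
    using weyl_group_mult[OF that] by (simp add: weyl_group_def subgroup_generated_def)
  have one: "\<one>\<^bsub>?G\<^esub> = id"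
    using weyl_group_one by (simp add: weyl_group_def subgroup_generated_def)
  have G: "group ?G" by (intro group.AutoGroup group_weight_group)
  have inv: "inv\<^bsub>?G\<^esub> (s i) = s i" for i
    by (rule group.inv_equality[OF G]) (auto simp: mult reflection_bij one reflection_auto)
  show "carrier (weyl_group A) \<subseteq> W"
    unfolding gen
  proof
    fix w assume "w \<in> generate ?G (range s)"
    then show "w \<in> W"
    proof (induction rule: generate.induct)
      case one
      then show ?case by (simp only: \<open>\<one>\<^bsub>?G\<^esub> = id\<close> W_id)
    next
      case (eng v w)
      then show ?case by (simp only: mult W_bij W_comp)
    qed (auto simp: inv W_reflection)
  qed
  show "W \<subseteq> carrier (weyl_group A)"
    unfolding gen
  proof
    fix w assume "w \<in> W"
    then show "w \<in> generate ?G (range s)"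
    proof (induction rule: W.induct)
      case W_id
      then show ?case using generate.one[of ?G] by (simp only: one)
    next
      case (W_step w i)
      have "s i \<otimes>\<^bsub>?G\<^esub> w \<in> generate ?G (range s)"
        using W_step by (intro generate.eng[OF generate.incl]) auto
      then show ?case using W_step by (simp only: mult W_bij reflection_bij)
    qed
  qed
qed

text \<open>For the pairing of roots with weights in which \<alpha>_i corresponds to
  \<open>comark i / mark i\<close> times \<open>h i\<close>, this is (x, 2 \<mu> + x), that is, the
  norm of \<mu> + x minus the norm of \<mu>. Only this difference is used, so no form on all of P
  has to be chosen.\<close>

definition "form \<mu> x = (\<Sum>i\<in>UNIV. of_int (comark i) / of_int (mark i) * of_int (x $ Inr i)
  * (2 * of_int (h i \<mu>) + of_int (h i x)) :: real)"

text \<open>The Dirichlet energy of y on the diagram; the weights of the edges are nonnegative since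
  off-diagonal entries of the matrix are nonpositive.\<close>

definition "energy y = (\<Sum>i\<in>UNIV. \<Sum>j\<in>UNIV.
  - of_int (comark i * A $ i $ j * mark j) * (y i - y j)\<^sup>2 :: real)"

lemma mark_symmetric_real:
  "of_int (comark i) / of_int (mark i) * of_int (A $ i $ j)
    = (of_int (comark j) / of_int (mark j) * of_int (A $ j $ i) :: real)"
proof -
  have "real_of_int (comark i * A $ i $ j * mark j) = real_of_int (comark j * A $ j $ i * mark i)"
    by (simp only: mark_symmetric)
  then show ?thesis using mark_pos[of i] mark_pos[of j] by (simp add: field_simps)
qed

lemma root_coroot: "(\<And>i. x $ Inl i = 0) \<Longrightarrow> h k x = (\<Sum>i\<in>UNIV. A $ k $ i * x $ Inr i)"
  by (simp add: coroot_def)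

text \<open>The new argument is s_k(\<mu> + x) - \<mu>. Adding n \<alpha>_k changes the form by a
  multiple of \<open>n * (h k (\<mu> + x) + n)\<close>, where symmetrizability merges the two cross
  terms; the second factor vanishes for the n of the reflection.\<close>

lemma form_step:
  assumes "\<And>i. x $ Inl i = 0"
  shows "form \<mu> (x - h k (\<mu> + x) *s \<alpha> k) = form \<mu> x"
proof -
  define n where "n = - h k (\<mu> + x)"
  define D where "D = (\<lambda>i. of_int (comark i) / of_int (mark i) :: real)"
  have "form \<mu> (x + n *s \<alpha> k) = (\<Sum>i\<in>UNIV. D i * (of_int (x $ Inr i) + of_int (if k = i then n else 0))
      * (2 * of_int (h i \<mu>) + of_int (h i x) + of_int n * of_int (A $ i $ k)))"
    unfolding form_def by (rule sum.cong) (auto simp: D_def coroot_linear)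
  also have "\<dots> = (\<Sum>i\<in>UNIV. D i * of_int (x $ Inr i) * (2 * of_int (h i \<mu>) + of_int (h i x)))
     + (\<Sum>i\<in>UNIV. of_int n * (D i * of_int (A $ i $ k)) * of_int (x $ Inr i))
     + (\<Sum>i\<in>UNIV. if k = i then D i * of_int n * (2 * of_int (h i \<mu>) + of_int (h i x) + of_int n * of_int (A $ i $ k)) else 0)"
    unfolding sum.distrib[symmetric] by (rule sum.cong) (auto simp: algebra_simps)
  also have "(\<Sum>i\<in>UNIV. of_int n * (D i * of_int (A $ i $ k)) * of_int (x $ Inr i))
     = of_int n * D k * of_int (h k x)"
    unfolding D_def mark_symmetric_real[of _ k]
    by (simp add: root_coroot[OF assms] sum_distrib_left mult_ac)
  also have "(\<Sum>i\<in>UNIV. if k = i then D i * of_int n * (2 * of_int (h i \<mu>) + of_int (h i x) + of_int n * of_int (A $ i $ k)) else 0)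
    = D k * of_int n * (2 * of_int (h k \<mu>) + of_int (h k x) + of_int n * 2)"
    by (simp add: diag)
  also have "(\<Sum>i\<in>UNIV. D i * of_int (x $ Inr i) * (2 * of_int (h i \<mu>) + of_int (h i x))) = form \<mu> x"
    by (simp add: form_def D_def)
  finally have "form \<mu> (x + n *s \<alpha> k) = form \<mu> x + of_int n * D k *
      (2 * (of_int (h k \<mu>) + of_int (h k x) + of_int n))"
    by (simp add: algebra_simps)
  moreover have "of_int (h k \<mu>) + of_int (h k x) + of_int n = (0 :: real)"
    by (simp add: n_def coroot_linear)
  ultimately have "form \<mu> (x + n *s \<alpha> k) = form \<mu> x" by simp
  moreover have "x - h k (\<mu> + x) *s \<alpha> k = x + n *s \<alpha> k"
    by (simp add: n_def weight_eq_iff)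
  ultimately show ?thesis by (simp only:)
qed

lemma form_orbit:
  assumes "w \<in> W"
  shows "form \<mu> (w \<mu> - \<mu>) = 0"
  using assms
proof (induction rule: W.induct)
  case W_id
  then show ?case by (simp add: form_def)
next
  case (W_step w k)
  have "form \<mu> ((w \<mu> - \<mu>) - h k (\<mu> + (w \<mu> - \<mu>)) *s \<alpha> k) = form \<mu> (w \<mu> - \<mu>)"
    using W_step by (intro form_step) (simp add: W_Inl)
  moreover have "(w \<mu> - \<mu>) - h k (\<mu> + (w \<mu> - \<mu>)) *s \<alpha> k = (s k \<circ> w) \<mu> - \<mu>"
    by (simp add: simple_reflection_def algebra_simps)
  ultimately show ?case using W_step by (simp only:)
qed

text \<open>Summation by parts: the rows and columns of \<open>comark i * A $ i $ j * mark j\<close>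
  sum to zero, so the quadratic form in the ratios \<open>x $ Inr i / mark i\<close> depends on
  their differences only.\<close>

lemma form_energy:
  assumes "\<And>i. x $ Inl i = 0" and y: "\<And>i. y i = of_int (x $ Inr i) / of_int (mark i)"
  shows "form \<mu> x = energy y / 2 + 2 * (\<Sum>i\<in>UNIV. of_int (comark i * h i \<mu>) * y i)"
proof -
  have xy: "of_int (x $ Inr i) = of_int (mark i) * y i" for i
    using mark_pos[of i] by (simp add: y)
  have row: "(\<Sum>j\<in>UNIV. real_of_int (comark i * A $ i $ j * mark j)) = 0" for i
  proof -
    have "(\<Sum>j\<in>UNIV. real_of_int (comark i * A $ i $ j * mark j))
      = real_of_int (comark i * (\<Sum>j\<in>UNIV. A $ i $ j * mark j))"
      by (simp add: sum_distrib_left mult_ac)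
    then show ?thesis by (simp add: mark_null)
  qed
  have col: "(\<Sum>i\<in>UNIV. real_of_int (comark i * A $ i $ j * mark j)) = 0" for j
    using row[of j] mark_symmetric[of _ j] by simp
  define C where "C = (\<lambda>i j. real_of_int (comark i * A $ i $ j * mark j))"
  have "energy y = (\<Sum>i\<in>UNIV. \<Sum>j\<in>UNIV. 2 * (C i j * y i * y j) - (C i j * (y i)\<^sup>2 + C i j * (y j)\<^sup>2))"
    unfolding energy_def C_def by (intro sum.cong refl) (simp add: power2_eq_square algebra_simps)
  also have "\<dots> = 2 * (\<Sum>i\<in>UNIV. \<Sum>j\<in>UNIV. C i j * y i * y j)
    - ((\<Sum>i\<in>UNIV. \<Sum>j\<in>UNIV. C i j * (y i)\<^sup>2) + (\<Sum>i\<in>UNIV. \<Sum>j\<in>UNIV. C i j * (y j)\<^sup>2))"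
    by (simp add: sum_subtractf sum.distrib sum_distrib_left)
  also have "(\<Sum>i\<in>UNIV. \<Sum>j\<in>UNIV. C i j * (y i)\<^sup>2) = 0"
    using row by (simp only: sum_distrib_right[symmetric] C_def) simp
  also have "(\<Sum>i\<in>UNIV. \<Sum>j\<in>UNIV. C i j * (y j)\<^sup>2) = 0"
    using col by (subst sum.swap, simp only: sum_distrib_right[symmetric] C_def) simp
  finally have en: "energy y / 2 = (\<Sum>i\<in>UNIV. \<Sum>j\<in>UNIV. C i j * y i * y j)" by simp
  have "form \<mu> x = (\<Sum>i\<in>UNIV. of_int (comark i) * y i
      * (2 * of_int (h i \<mu>) + (\<Sum>j\<in>UNIV. of_int (A $ i $ j) * (of_int (mark j) * y j))))"
    unfolding form_def
  proof (rule sum.cong)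
    fix i
    show "of_int (comark i) / of_int (mark i) * of_int (x $ Inr i) * (2 * of_int (h i \<mu>) + of_int (h i x))
      = of_int (comark i) * y i * (2 * of_int (h i \<mu>) + (\<Sum>j\<in>UNIV. of_int (A $ i $ j) * (of_int (mark j) * y j)))"
      using mark_pos[of i] by (simp add: xy root_coroot[OF assms(1)])
  qed simp
  also have "\<dots> = (\<Sum>i\<in>UNIV. \<Sum>j\<in>UNIV. C i j * y i * y j) + 2 * (\<Sum>i\<in>UNIV. of_int (comark i * h i \<mu>) * y i)"
    by (simp add: distrib_left sum.distrib sum_distrib_left C_def mult_ac)
  finally show ?thesis by (simp add: en)
qed

lemma energy_term_nonneg: "0 \<le> - of_int (comark i * A $ i $ j * mark j) * (y i - y j :: real)\<^sup>2"
proof (cases "i = j")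
  case False
  then have "comark i * A $ i $ j * mark j \<le> 0"
    using offdiag[of i j] comark_pos[of i] mark_pos[of j]
    by (simp add: mult_nonneg_nonpos mult_nonpos_nonneg less_imp_le)
  then have "real_of_int (comark i * A $ i $ j * mark j) \<le> 0"
    by (simp only: of_int_le_0_iff)
  then show ?thesis by (intro mult_nonneg_nonneg) auto
qed simp

lemma energy_edge:
  assumes "A $ i $ j \<noteq> 0" "i \<noteq> j"
  shows "(y i - y j)\<^sup>2 \<le> energy y"
proof -
  have "comark i * A $ i $ j < 0"
    using assms offdiag[of i j] comark_pos[of i] by (intro mult_pos_neg) auto
  then have "comark i * A $ i $ j * mark j < 0"
    using mark_pos[of j] by (rule mult_neg_pos)
  then have "real_of_int (comark i * A $ i $ j * mark j) \<le> - 1"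
    by linarith
  then have "(y i - y j)\<^sup>2 \<le> - of_int (comark i * A $ i $ j * mark j) * (y i - y j)\<^sup>2"
    using mult_right_mono[of 1 "- of_int (comark i * A $ i $ j * mark j)" "(y i - y j)\<^sup>2"] by simp
  also have "\<dots> \<le> (\<Sum>j\<in>UNIV. - of_int (comark i * A $ i $ j * mark j) * (y i - y j)\<^sup>2)"
    by (rule member_le_sum[where f = "\<lambda>j. - of_int (comark i * A $ i $ j * mark j) * (y i - y j)\<^sup>2"])
      (use energy_term_nonneg in auto)
  also have "\<dots> \<le> energy y"
    unfolding energy_def
    by (rule member_le_sum[where f = "\<lambda>i. \<Sum>j\<in>UNIV. - of_int (comark i * A $ i $ j * mark j) * (y i - y j)\<^sup>2"])
      (use energy_term_nonneg in \<open>auto intro!: sum_nonneg simp del: of_int_mult\<close>)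
  finally show ?thesis .
qed

text \<open>Every edge of the diagram controls the difference across it, and the diagram is
  connected. The constants doubled along a path are harmless, as there are finitely many pairs of
  vertices.\<close>

lemma energy_coercive: "\<exists>K. \<forall>y i j. (y i - y j)\<^sup>2 \<le> K * energy y"
proof -
  have nonneg: "energy y \<ge> 0" for y
    unfolding energy_def by (intro sum_nonneg energy_term_nonneg)
  have conn: "\<exists>K. \<forall>y. (y k - y i)\<^sup>2 \<le> K * energy y" for k i
  proof -
    define J where "J = {i. \<exists>K. \<forall>y. (y k - y i)\<^sup>2 \<le> K * energy y}"
    have "k \<in> J" by (auto simp: J_def intro!: exI[of _ 0])
    moreover have "A $ i $ j = 0" if ij: "i \<in> J" "j \<notin> J" for i j
    proof (rule ccontr)
      assume ne: "A $ i $ j \<noteq> 0"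
      have "i \<noteq> j" using ij by auto
      obtain K where K: "\<And>y. (y k - y i)\<^sup>2 \<le> K * energy y" using ij by (auto simp: J_def)
      have "(y k - y j)\<^sup>2 \<le> (2 * K + 2) * energy y" for y
      proof -
        have "0 \<le> ((y k - y i) - (y i - y j))\<^sup>2" by simp
        then have "(y k - y j)\<^sup>2 \<le> 2 * (y k - y i)\<^sup>2 + 2 * (y i - y j)\<^sup>2"
          by (simp add: power2_eq_square algebra_simps)
        also have "\<dots> \<le> 2 * (K * energy y) + 2 * energy y"
          using K[of y] energy_edge[OF ne \<open>i \<noteq> j\<close>, of y] by simp
        finally show ?thesis by (simp add: algebra_simps)
      qed
      then have "j \<in> J" by (auto simp: J_def)
      then show False using ij by simp
    qed
    ultimately have "J = UNIV" using indec[of J] by blast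
    then show ?thesis by (auto simp: J_def)
  qed
  then obtain K where K: "\<And>k i y. (y k - y i)\<^sup>2 \<le> K k i * energy y" by metis
  define M where "M = (\<Sum>k\<in>UNIV. \<Sum>i\<in>UNIV. \<bar>K k i\<bar>)"
  have KM: "K k i \<le> M" for k i
  proof -
    have "K k i \<le> \<bar>K k i\<bar>" by simp
    also have "\<dots> \<le> (\<Sum>i\<in>UNIV. \<bar>K k i\<bar>)" by (rule member_le_sum) auto
    also have "\<dots> \<le> M" unfolding M_def
      by (rule member_le_sum[where f = "\<lambda>k. \<Sum>i\<in>UNIV. \<bar>K k i\<bar>"]) (auto intro: sum_nonneg)
    finally show ?thesis .
  qed
  have "(y k - y i)\<^sup>2 \<le> M * energy y" for y k i
    using K[of y k i] mult_right_mono[OF KM nonneg, of k i y] by linarith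
  then show ?thesis by blast
qed

lemma energy_nonneg: "energy y \<ge> 0"
  unfolding energy_def by (intro sum_nonneg energy_term_nonneg)

lemma weighted_sum_bound:
  fixes p v :: "'i \<Rightarrow> real"
  assumes "\<And>i. \<bar>v i\<bar> \<le> z"
  shows "- (\<Sum>i\<in>UNIV. p i * v i) \<le> (\<Sum>i\<in>UNIV. \<bar>p i\<bar>) * z"
  unfolding sum_negf[symmetric] sum_distrib_right
proof (rule sum_mono)
  fix i
  have "- (p i * v i) \<le> \<bar>p i\<bar> * \<bar>v i\<bar>" by (metis abs_ge_minus_self abs_mult)
  also have "\<dots> \<le> \<bar>p i\<bar> * z" using assms by (intro mult_left_mono) auto
  finally show "- (p i * v i) \<le> \<bar>p i\<bar> * z" .
qed

text \<open>The energy is quadratic and the other term linear: if z is the largest deviation from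
  \<open>y r\<close> and S the sum of the \<open>\<bar>p i\<bar>\<close>, then z^2 is at most K
  times the energy, which is at most 4 S z. The hypothesis comes from the form being zero on
  orbits.\<close>

lemma spread_bound:
  fixes p :: "'i \<Rightarrow> real"
  obtains C where "\<And>y r i. energy y / 2 + 2 * (\<Sum>i\<in>UNIV. p i * (y i - y r)) \<le> 0 \<Longrightarrow> \<bar>y i - y r\<bar> \<le> C"
proof -
  obtain K where K: "\<And>y i j. (y i - y j)\<^sup>2 \<le> K * energy y" using energy_coercive by metis
  define S where "S = (\<Sum>i\<in>UNIV. \<bar>p i\<bar>)"
  have "\<bar>y i - y r\<bar> \<le> 4 * \<bar>K\<bar> * S" if le: "energy y / 2 + 2 * (\<Sum>i\<in>UNIV. p i * (y i - y r)) \<le> 0" for y r i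
  proof -
    obtain m where m: "\<And>i. \<bar>y i - y r\<bar> \<le> \<bar>y m - y r\<bar>"
    proof -
      have "Max (range (\<lambda>i. \<bar>y i - y r\<bar>)) \<in> range (\<lambda>i. \<bar>y i - y r\<bar>)" by (rule Max_in) auto
      then obtain m where "Max (range (\<lambda>i. \<bar>y i - y r\<bar>)) = \<bar>y m - y r\<bar>" by (rule rangeE)
      then have "\<bar>y i - y r\<bar> \<le> \<bar>y m - y r\<bar>" for i
        using Max_ge[of "range (\<lambda>i. \<bar>y i - y r\<bar>)" "\<bar>y i - y r\<bar>"] by auto
      then show thesis by (rule that)
    qed
    define z where "z = \<bar>y m - y r\<bar>"
    have "energy y \<le> 4 * (S * z)"
      using weighted_sum_bound[of "\<lambda>i. y i - y r" z p] m le by (simp add: S_def z_def)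
    have "z * z \<le> K * energy y" using K[of y m r] by (simp add: z_def power2_eq_square)
    also have "\<dots> \<le> \<bar>K\<bar> * energy y" using energy_nonneg by (intro mult_right_mono) auto
    also have "\<dots> \<le> \<bar>K\<bar> * (4 * (S * z))" using \<open>energy y \<le> _\<close> by (intro mult_left_mono) auto
    finally have "z * z \<le> (4 * \<bar>K\<bar> * S) * z" by (simp add: mult_ac)
    moreover have "z \<ge> 0" "0 \<le> 4 * \<bar>K\<bar> * S" by (auto simp: z_def S_def intro!: sum_nonneg)
    ultimately have "z \<le> 4 * \<bar>K\<bar> * S" by (metis mult_right_le_imp_le order_le_less)
    then show ?thesis using m[of i] by (simp add: z_def)
  qed
  then show thesis by (rule that)
qed

end

section \<open>Dominant weights\<close>

lemma finite_bounded_vectors: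
  "finite {x :: int ^ 'n::finite. \<forall>k. \<bar>x $ k\<bar> \<le> N k}"
proof -
  have "{x :: int ^ 'n. \<forall>k. \<bar>x $ k\<bar> \<le> N k} \<subseteq> vec_lambda ` (\<Pi>\<^sub>E k\<in>UNIV. {- N k..N k})"
  proof
    fix x :: "int ^ 'n" assume "x \<in> {x. \<forall>k. \<bar>x $ k\<bar> \<le> N k}"
    then have "(\<lambda>k. x $ k) \<in> (\<Pi>\<^sub>E k\<in>UNIV. {- N k..N k})" by (auto simp: abs_le_iff minus_le_iff)
    then show "x \<in> vec_lambda ` (\<Pi>\<^sub>E k\<in>UNIV. {- N k..N k})"
      by (intro image_eqI[of _ _ "\<lambda>k. x $ k"]) simp_all
  qed
  then show ?thesis by (rule finite_subset) (intro finite_imageI finite_PiE, auto)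
qed

context affine_cartan begin

definition "raises x y \<longleftrightarrow> (\<exists>i. h i x < 0 \<and> y = s i x)"
definition "lowers x y \<longleftrightarrow> (\<exists>i. h i x > 0 \<and> y = s i x)"
text \<open>Meant for differences within an orbit: there the coordinates at the fundamental weights
  are constant and \<open>ht\<close> measures the root lattice displacement.\<close>

definition "ht x = (\<Sum>i\<in>UNIV. x $ Inr i)" for x :: "'i weight"
definition "dominant x \<longleftrightarrow> (\<forall>i. h i x \<ge> 0)"

lemma ht_linear: "ht (x + y) = ht x + ht y" "ht (x - y) = ht x - ht y" "ht (k *s x) = k * ht x"
  by (simp_all add: ht_def sum.distrib sum_subtractf sum_distrib_left)

lemma ht_reflection: "ht (s i x) = ht x - h i x"
  by (simp add: simple_reflection_def ht_linear) (simp add: ht_def)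

lemma raise_minus: "raises (- x) (- y) \<longleftrightarrow> lowers x y"
  by (auto simp: raises_def lowers_def coroot_minus reflection_linear)

lemma raises_lowers: "raises x y \<longleftrightarrow> lowers y x"
proof -
  have neg: "h i (s i x) = - h i x" for i x by (simp add: coroot_reflection diag)
  show ?thesis
  proof
    assume "raises x y"
    then obtain i where "h i x < 0" "y = s i x" by (auto simp: raises_def)
    then show "lowers y x" unfolding lowers_def by (intro exI[of _ i]) (simp add: neg)
  next
    assume "lowers y x"
    then obtain i where "h i y > 0" "x = s i y" by (auto simp: lowers_def)
    then show "raises x y" unfolding raises_def by (intro exI[of _ i]) (simp add: neg)
  qed
qed

lemma raise_star_minus: "raises\<^sup>*\<^sup>* (- x) (- y) \<longleftrightarrow> lowers\<^sup>*\<^sup>* x y"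
proof -
  have 1: "raises\<^sup>*\<^sup>* x y \<Longrightarrow> lowers\<^sup>*\<^sup>* (- x) (- y)" for x y
  proof (induction rule: rtranclp_induct)
    case (step y z)
    then have "lowers (- y) (- z)" using raise_minus[of "- y" "- z"] by simp
    with step.IH show ?case by (rule rtranclp.rtrancl_into_rtrancl)
  qed simp
  have 2: "lowers\<^sup>*\<^sup>* x y \<Longrightarrow> raises\<^sup>*\<^sup>* (- x) (- y)" for x y
  proof (induction rule: rtranclp_induct)
    case (step y z)
    then have "raises (- y) (- z)" using raise_minus[of y z] by simp
    with step.IH show ?case by (rule rtranclp.rtrancl_into_rtrancl)
  qed simp
  show ?thesis using 1[of "- x" "- y"] 2[of x y] by auto
qed

lemma raise_star_props:
  assumes "raises\<^sup>*\<^sup>* x y"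
  shows raise_star_W: "\<exists>w\<in>W. y = w x" and raise_star_Inr: "x $ Inr i \<le> y $ Inr i"
    and raise_star_level: "level y = level x"
proof -
  have "(\<exists>w\<in>W. y = w x) \<and> (\<forall>i. x $ Inr i \<le> y $ Inr i) \<and> level y = level x"
    using assms
  proof (induction rule: rtranclp_induct)
    case base then show ?case using W_id by (auto intro!: bexI[of _ id])
  next
    case (step y z)
    then obtain i w where "h i y < 0" "z = s i y" "w \<in> W" "y = w x" by (auto simp: raises_def)
    then have "s i \<circ> w \<in> W" "z = (s i \<circ> w) x" by (auto intro: W_step)
    moreover have "x $ Inr k \<le> z $ Inr k" for k
      using step.IH \<open>h i y < 0\<close> \<open>z = s i y\<close> by (auto intro: order_trans)
    moreover have "level z = level x" using step.IH \<open>z = s i y\<close> by (simp add: level_reflection)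
    ultimately show ?case by blast
  qed
  then show "\<exists>w\<in>W. y = w x" "x $ Inr i \<le> y $ Inr i" "level y = level x" by auto
qed

lemma raise_ht: "raises x y \<Longrightarrow> ht x < ht y"
  by (auto simp: raises_def ht_reflection)

lemma raise_star_ht: "raises\<^sup>*\<^sup>* x y \<Longrightarrow> ht x \<le> ht y"
  by (induction rule: rtranclp_induct) (auto dest: raise_ht)

text \<open>The form is constant on orbits. Along an upward chain the displacement is nonnegative, and at
  positive level the linear part of the form then dominates the positive semidefinite one.\<close>

lemma finite_up_star:
  assumes "level \<mu> > 0"
  shows "finite {y. raises\<^sup>*\<^sup>* \<mu> y}"
proof -
  define p where "p = (\<lambda>i. real_of_int (comark i * h i \<mu>))"
  obtain C where C: "\<And>y r i. energy y / 2 + 2 * (\<Sum>i\<in>UNIV. p i * (y i - y r)) \<le> 0 \<Longrightarrow> \<bar>y i - y r\<bar> \<le> C"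
    by (rule spread_bound[of p]) (rule that, assumption)
  define S where "S = (\<Sum>i\<in>UNIV. \<bar>p i\<bar>)"
  define N where "N = case_sum (\<lambda>_ :: 'i. 0) (\<lambda>i. \<lceil>mark i * (S * \<bar>C\<bar> + \<bar>C\<bar>)\<rceil>)"
  have lev: "(\<Sum>i\<in>UNIV. p i) = level \<mu>" by (simp add: p_def level_eq)
  have "{y. raises\<^sup>*\<^sup>* \<mu> y} \<subseteq> (\<lambda>x. \<mu> + x) ` {x. \<forall>k. \<bar>x $ k\<bar> \<le> N k}"
  proof
    fix y assume "y \<in> {y. raises\<^sup>*\<^sup>* \<mu> y}"
    then have raises: "raises\<^sup>*\<^sup>* \<mu> y" by simp
    obtain w where w: "w \<in> W" "y = w \<mu>" using raise_star_W[OF raises] by blast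
    define x where "x = y - \<mu>"
    have x: "x $ Inl i = 0" "x $ Inr i \<ge> 0" for i
      using raise_star_Inr[OF raises, of i] by (auto simp: x_def w W_Inl)
    define z where "z = (\<lambda>i. real_of_int (x $ Inr i) / of_int (mark i))"
    have znn: "z i \<ge> 0" for i using x(2)[of i] mark_pos[of i] by (simp add: z_def)
    have "form \<mu> x = 0" using form_orbit[OF w(1)] by (simp add: x_def w)
    then have form0: "energy z / 2 + 2 * (\<Sum>i\<in>UNIV. p i * z i) = 0"
      using form_energy[of x z \<mu>] x(1) by (simp add: z_def p_def)
    have "Min (range z) \<in> range z" by (rule Min_in) auto
    then obtain r where "Min (range z) = z r" by (rule rangeE)
    then have zr: "z r \<le> z i" for i using Min_le[of "range z" "z i"] by auto
    \<comment> \<open>This splits off the part of the displacement along \<delta>. Its coefficient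
      is the level, so positivity gives first the hypothesis of \<open>spread_bound\<close> and then
      a bound for \<open>z r\<close> itself.\<close>
    have split: "(\<Sum>i\<in>UNIV. p i * z i) = (\<Sum>i\<in>UNIV. p i * (z i - z r)) + level \<mu> * z r"
      by (simp add: lev[symmetric] sum_distrib_right right_diff_distrib sum_subtractf)
    have lz: "level \<mu> * z r \<ge> 0" using znn assms by simp
    have zC: "\<bar>z i - z r\<bar> \<le> C" for i using form0 lz by (intro C) (simp add: split)
    have Cnn: "C \<ge> 0" using zC[of r] by simp
    have "- (\<Sum>i\<in>UNIV. p i * (z i - z r)) \<le> S * C"
      unfolding S_def by (rule weighted_sum_bound[OF zC])
    then have "level \<mu> * z r \<le> S * C"
      using form0 energy_nonneg[of z] by (simp add: split)
    moreover have "1 * z r \<le> level \<mu> * z r" using assms znn by (intro mult_right_mono) auto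
    ultimately have zr': "z r \<le> S * C" by simp
    have "z i \<le> S * \<bar>C\<bar> + \<bar>C\<bar>" for i using zC[of i] zr' Cnn by simp
    then have "real_of_int (x $ Inr i) \<le> mark i * (S * \<bar>C\<bar> + \<bar>C\<bar>)" for i
      using mark_pos by (simp add: z_def pos_divide_le_eq mult.commute)
    then have "real_of_int (x $ Inr i) \<le> of_int \<lceil>mark i * (S * \<bar>C\<bar> + \<bar>C\<bar>)\<rceil>" for i
      by (meson le_of_int_ceiling order_trans)
    then have "\<bar>x $ k\<bar> \<le> N k" for k
      using x by (cases k) (simp_all add: N_def)
    then show "y \<in> (\<lambda>x. \<mu> + x) ` {x. \<forall>k. \<bar>x $ k\<bar> \<le> N k}"
      by (intro image_eqI[of _ _ x]) (auto simp: x_def)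
  qed
  then show ?thesis by (rule finite_subset) (intro finite_imageI finite_bounded_vectors)
qed

text \<open>Induction on the number of weights reachable upwards, which is finite at positive level.
  It drops at each step because a weight cannot be reached again from a weight of larger
  height.\<close>

lemma raise_induct [consumes 1, case_names step]:
  assumes "level x > 0" and step: "\<And>x. level x > 0 \<Longrightarrow> (\<And>y. raises x y \<Longrightarrow> P y) \<Longrightarrow> P x"
  shows "P x"
  using assms(1)
proof (induction "card {y. raises\<^sup>*\<^sup>* x y}" arbitrary: x rule: less_induct)
  case less
  show ?case
  proof (rule step[OF less.prems])
    fix y assume raises: "raises x y"
    have "x \<notin> {z. raises\<^sup>*\<^sup>* y z}" using raise_ht[OF raises] raise_star_ht[of y x] by auto
    then have "{z. raises\<^sup>*\<^sup>* y z} \<subset> {z. raises\<^sup>*\<^sup>* x z}"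
      using raises by (auto intro: converse_rtranclp_into_rtranclp)
    then have "card {z. raises\<^sup>*\<^sup>* y z} < card {z. raises\<^sup>*\<^sup>* x z}"
      using finite_up_star[OF less.prems] by (rule psubset_card_mono[rotated])
    moreover have "level y > 0" using raises less.prems by (auto simp: raises_def level_reflection)
    ultimately show "P y" using less.hyps by blast
  qed
qed

text \<open>The two chains below are the two halves of the orbit of a rank two finite Weyl group.\<close>

lemma rank_two_confluence:
  assumes p: "h i x > 0" and q: "h j x > 0" and "i \<noteq> j" and lt: "A $ i $ j * A $ j $ i < 4"
  shows "\<exists>z. lowers\<^sup>*\<^sup>* (s i x) z \<and> lowers\<^sup>*\<^sup>* (s j x) z"
proof -
  have main: "\<exists>z. lowers\<^sup>*\<^sup>* (s i x) z \<and> lowers\<^sup>*\<^sup>* (s j x) z"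
    if p: "h i x > 0" and q: "h j x > 0" and ij: "i \<noteq> j"
      and ab: "(A $ i $ j, A $ j $ i) \<in> {(0, 0), (-1, -1), (-1, -2), (-1, -3)}" for i j
  proof -
    define p where "p = h i x"
    define q where "q = h j x"
    define pt where "pt = (\<lambda>m n. x - m *s \<alpha> i - n *s \<alpha> j)"
    have pq: "p > 0" "q > 0" using p q by (auto simp: p_def q_def)
    have si: "lowers (pt m n) (pt m' n)"
      if "p - 2 * m - A $ i $ j * n > 0" "m' = p - m - A $ i $ j * n" for m n m'
    proof -
      have "h i (pt m n) = p - 2 * m - A $ i $ j * n"
        by (simp add: pt_def coroot_linear p_def diag mult.commute)
      moreover from this have "s i (pt m n) = pt m' n"
        using that(2) by (simp add: weight_eq_iff pt_def)
      ultimately show ?thesis using that by (auto simp: lowers_def intro!: exI[of _ i])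
    qed
    have sj: "lowers (pt m n) (pt m n')"
      if "q - A $ j $ i * m - 2 * n > 0" "n' = q - A $ j $ i * m - n" for m n n'
    proof -
      have "h j (pt m n) = q - A $ j $ i * m - 2 * n"
        by (simp add: pt_def coroot_linear q_def diag mult.commute)
      moreover from this have "s j (pt m n) = pt m n'"
        using that(2) by (simp add: weight_eq_iff pt_def)
      ultimately show ?thesis using that by (auto simp: lowers_def intro!: exI[of _ j])
    qed
    have start: "s i x = pt p 0" "s j x = pt 0 q"
      by (simp_all add: weight_eq_iff pt_def p_def q_def)
    note step = converse_rtranclp_into_rtranclp[of lowers]
    \<comment> \<open>Types A_1 x A_1, A_2, B_2 and G_2. Counting the first reflection, the two
      chains have 2, 3, 4 and 6 reflections, the length of the longest element, and meet at the
      lowest point of the orbit of x under the rank two group.\<close>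
    consider "A $ i $ j = 0" "A $ j $ i = 0" | "A $ i $ j = -1" "A $ j $ i = -1"
      | "A $ i $ j = -1" "A $ j $ i = -2" | "A $ i $ j = -1" "A $ j $ i = -3"
      using ab by auto
    then have "\<exists>z. lowers\<^sup>*\<^sup>* (pt p 0) z \<and> lowers\<^sup>*\<^sup>* (pt 0 q) z"
    proof cases
      case 1
      have "lowers\<^sup>*\<^sup>* (pt p 0) (pt p q)"
        by (rule step[OF sj[of _ _ "q"]]) (use 1 pq in auto)
      moreover have "lowers\<^sup>*\<^sup>* (pt 0 q) (pt p q)"
        by (rule step[OF si[of _ _ "p"]]) (use 1 pq in auto)
      ultimately show ?thesis by blast
    next
      case 2
      have "lowers\<^sup>*\<^sup>* (pt p 0) (pt (p + q) (p + q))"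
        by (rule step[OF sj[of _ _ "p + q"] step[OF si[of _ _ "p + q"]]]) (use 2 pq in auto)
      moreover have "lowers\<^sup>*\<^sup>* (pt 0 q) (pt (p + q) (p + q))"
        by (rule step[OF si[of _ _ "p + q"] step[OF sj[of _ _ "p + q"]]]) (use 2 pq in auto)
      ultimately show ?thesis by blast
    next
      case 3
      have "lowers\<^sup>*\<^sup>* (pt p 0) (pt (2 * p + q) (2 * p + 2 * q))"
        by (rule step[OF sj[of _ _ "2 * p + q"] step[OF si[of _ _ "2 * p + q"]
            step[OF sj[of _ _ "2 * p + 2 * q"]]]]) (use 3 pq in auto)
      moreover have "lowers\<^sup>*\<^sup>* (pt 0 q) (pt (2 * p + q) (2 * p + 2 * q))"
        by (rule step[OF si[of _ _ "p + q"] step[OF sj[of _ _ "2 * p + 2 * q"]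
            step[OF si[of _ _ "2 * p + q"]]]]) (use 3 pq in auto)
      ultimately show ?thesis by blast
    next
      case 4
      have "lowers\<^sup>*\<^sup>* (pt p 0) (pt (4 * p + 2 * q) (6 * p + 4 * q))"
        by (rule step[OF sj[of _ _ "3 * p + q"] step[OF si[of _ _ "3 * p + q"]
            step[OF sj[of _ _ "6 * p + 3 * q"] step[OF si[of _ _ "4 * p + 2 * q"]
            step[OF sj[of _ _ "6 * p + 4 * q"]]]]]]) (use 4 pq in auto)
      moreover have "lowers\<^sup>*\<^sup>* (pt 0 q) (pt (4 * p + 2 * q) (6 * p + 4 * q))"
        by (rule step[OF si[of _ _ "p + q"] step[OF sj[of _ _ "3 * p + 3 * q"]
            step[OF si[of _ _ "3 * p + 2 * q"] step[OF sj[of _ _ "6 * p + 4 * q"]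
            step[OF si[of _ _ "4 * p + 2 * q"]]]]]]) (use 4 pq in auto)
      ultimately show ?thesis by blast
    qed
    then show ?thesis by (simp only: start)
  qed
  define a where "a = - A $ i $ j"
  define b where "b = - A $ j $ i"
  have nn: "a \<ge> 0" "b \<ge> 0" using offdiag[of i j] offdiag[of j i] assms(3) by (auto simp: a_def b_def)
  have ab4: "a * b < 4" using lt by (simp add: a_def b_def)
  have zero: "a = 0 \<longleftrightarrow> b = 0" using zero_sym[of i j] zero_sym[of j i] by (auto simp: a_def b_def)
  have "(A $ i $ j, A $ j $ i) \<in> {(0, 0), (-1, -1), (-1, -2), (-1, -3)} \<or>
    (A $ j $ i, A $ i $ j) \<in> {(0, 0), (-1, -1), (-1, -2), (-1, -3)}"
  proof (cases "a = 0")
    case True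
    then show ?thesis using zero by (auto simp: a_def b_def)
  next
    case False
    then have "a \<ge> 1" "b \<ge> 1" using nn zero by linarith+
    moreover have "a * 1 \<le> a * b" "1 * b \<le> a * b"
      using \<open>a \<ge> 1\<close> \<open>b \<ge> 1\<close> by (auto intro: mult_left_mono mult_right_mono)
    ultimately have "a = 1 \<or> a = 2 \<or> a = 3" "b = 1 \<or> b = 2 \<or> b = 3" using ab4 by linarith+
    then have "(a, b) \<in> {(1, 1), (1, 2), (1, 3)} \<or> (b, a) \<in> {(1, 1), (1, 2), (1, 3)}"
      using ab4 by auto
    moreover have "A $ i $ j = - a" "A $ j $ i = - b" by (simp_all add: a_def b_def)
    ultimately show ?thesis by auto
  qed
  then show ?thesis
    using main[OF p q assms(3)] main[OF q p assms(3)[symmetric]] by blast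
qed

lemma CARD_two: "\<not> CARD('i) > 2 \<Longrightarrow> i \<noteq> j \<Longrightarrow> (UNIV :: 'i set) = {i, j}"
  by (rule sym, rule card_seteq) auto

lemma finite_type_pair: "CARD('i) > 2 \<Longrightarrow> i \<noteq> j \<Longrightarrow> A $ i $ j * A $ j $ i < 4"
  using rank_two_bound[of mark i j] mark_pos mark_null by blast

text \<open>Negation exchanges raising and lowering, so this is the confluence of the rank two
  orbits. With only two indices a fork cannot occur: the level, a positive combination of both
  coroots, would be negative.\<close>

lemma raise_confluence:
  assumes "level x > 0" "raises x y" "raises x z"
  shows "\<exists>u. raises\<^sup>*\<^sup>* y u \<and> raises\<^sup>*\<^sup>* z u"
proof -
  obtain i j where ij: "h i x < 0" "y = s i x" "h j x < 0" "z = s j x"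
    using assms by (auto simp: raises_def)
  show ?thesis
  proof (cases "i = j")
    case True
    then show ?thesis using ij by blast
  next
    case False
    have "CARD('i) > 2"
    proof (rule ccontr)
      assume "\<not> CARD('i) > 2"
      then have "UNIV = {i, j}" using False by (rule CARD_two)
      then have "level x = (\<Sum>k\<in>{i, j}. comark k * h k x)" by (simp only: level_eq)
      then have "level x = comark i * h i x + comark j * h j x" using False by simp
      moreover have "comark i * h i x < 0" "comark j * h j x < 0"
        using ij comark_pos by (auto intro: mult_pos_neg)
      ultimately show False using assms(1) by linarith
    qed
    then have "\<exists>u. lowers\<^sup>*\<^sup>* (s i (- x)) u \<and> lowers\<^sup>*\<^sup>* (s j (- x)) u"
      using ij False by (intro rank_two_confluence finite_type_pair) (auto simp: coroot_minus)
    then obtain u where "lowers\<^sup>*\<^sup>* (- y) u" "lowers\<^sup>*\<^sup>* (- z) u" by (auto simp: reflection_linear ij)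
    then have "raises\<^sup>*\<^sup>* y (- u)" "raises\<^sup>*\<^sup>* z (- u)"
      using raise_star_minus[of "- y" u] raise_star_minus[of "- z" u] by auto
    then show ?thesis by blast
  qed
qed

lemma dominant_no_up: "dominant x \<Longrightarrow> raises\<^sup>*\<^sup>* x y \<Longrightarrow> y = x"
  by (erule converse_rtranclpE) (auto simp: raises_def dominant_def not_less[symmetric])

lemma dominant_exists:
  assumes "level x > 0"
  shows "\<exists>d. dominant d \<and> raises\<^sup>*\<^sup>* x d"
  using assms
proof (induction rule: raise_induct)
  case (step x)
  show ?case
  proof (cases "dominant x")
    case False
    then obtain i where "raises x (s i x)" by (auto simp: dominant_def raises_def not_le)
    then show ?thesis using step.IH by (meson converse_rtranclp_into_rtranclp)
  qed auto
qed

text \<open>Newman's lemma: \<open>raise_confluence\<close> is local confluence,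
  \<open>raise_induct\<close> is termination, and dominant weights are the normal forms.\<close>

lemma dominant_unique:
  assumes "level x > 0"
  shows "dominant d \<Longrightarrow> dominant d' \<Longrightarrow> raises\<^sup>*\<^sup>* x d \<Longrightarrow> raises\<^sup>*\<^sup>* x d' \<Longrightarrow> d = d'"
  using assms
proof (induction arbitrary: d d' rule: raise_induct)
  case (step x)
  show ?case
  proof (cases "x = d \<or> x = d'")
    case True
    then show ?thesis using step.prems dominant_no_up by blast
  next
    case False
    then obtain y z where y: "raises x y" "raises\<^sup>*\<^sup>* y d" and z: "raises x z" "raises\<^sup>*\<^sup>* z d'"
      using step.prems by (metis converse_rtranclpE)
    obtain u where u: "raises\<^sup>*\<^sup>* y u" "raises\<^sup>*\<^sup>* z u" using raise_confluence[OF step.hyps y(1) z(1)] by blast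
    have "level u > 0"
      using step.hyps raise_star_level[OF u(1)] raise_star_level[OF r_into_rtranclp[of raises, OF y(1)]] by simp
    then obtain e where e: "dominant e" "raises\<^sup>*\<^sup>* u e" using dominant_exists by blast
    have "d = e" using step.IH[OF y(1) step.prems(1) e(1) y(2)] rtranclp_trans[OF u(1) e(2)] by simp
    moreover have "d' = e" using step.IH[OF z(1) step.prems(2) e(1) z(2)] rtranclp_trans[OF u(2) e(2)] by simp
    ultimately show ?thesis by simp
  qed
qed

text \<open>A reflection applied to \<open>w d\<close> either lowers it or leaves it fixed, and then
  the known chain is extended at its start, or raises it, and then any maximal chain from there ends
  at d by uniqueness. In particular d dominates its orbit coefficientwise.\<close>

lemma dominant_top:
  assumes "dominant d" "level d > 0" "w \<in> W"
  shows "raises\<^sup>*\<^sup>* (w d) d"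
  using assms(3)
proof (induction rule: W.induct)
  case W_id then show ?case by simp
next
  case (W_step w i)
  have lev: "level (w d) > 0" using W_step assms(2) by (simp add: W_level)
  show ?case
  proof (cases "h i (w d) < 0")
    case True
    then have raises: "raises (w d) (s i (w d))" by (auto simp: raises_def)
    have "level (s i (w d)) > 0" using lev by (simp add: level_reflection)
    then obtain e where e: "dominant e" "raises\<^sup>*\<^sup>* (s i (w d)) e" using dominant_exists by blast
    have "raises\<^sup>*\<^sup>* (w d) e" using raises e(2) by (rule converse_rtranclp_into_rtranclp)
    then have "e = d" using dominant_unique[OF lev e(1) assms(1)] W_step.IH by blast
    then show ?thesis using e by simp
  next
    case False
    then have "s i (w d) = w d \<or> raises (s i (w d)) (w d)"
      unfolding raises_lowers lowers_def
      by (cases "h i (w d) = 0") (simp add: reflection_fixed, metis linorder_neqE)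
    then show ?thesis using W_step.IH by (auto intro: converse_rtranclp_into_rtranclp)
  qed
qed

lemma dominant_in_orbit:
  assumes "dominant d" "level d > 0" "w \<in> W" "dominant (w d)"
  shows "w d = d"
  using dominant_no_up[OF assms(4) dominant_top[OF assms(1-3)]] by simp

end

section \<open>Cocycles on orbits of nonzero level\<close>

context affine_cartan begin

section \<open>Faithfulness of the action on weights and on roots\<close>

lemma W_zero: "w \<in> W \<Longrightarrow> w 0 = 0"
  by (rule W_fixed) simp_all

lemma W_sum: "w \<in> W \<Longrightarrow> w (\<Sum>k\<in>S. f k) = (\<Sum>k\<in>S. w (f k))"
  by (induction S rule: infinite_finite_induct) (auto simp: W_zero W_add)

lemma root_expand: "(\<And>i. x $ Inl i = 0) \<Longrightarrow> x = (\<Sum>i\<in>UNIV. x $ Inr i *s \<alpha> i)"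
  by (simp add: weight_eq_iff del: sum_component)

text \<open>Subtracting a combination of fundamental weights from x leaves a weight killed by all
  coroots, and such a weight is fixed by the Weyl group.\<close>

lemma W_fix_fund:
  assumes "u \<in> W" "\<And>j. u (\<Lambda> j) = \<Lambda> j"
  shows "u = id"
proof
  fix x
  define y where "y = (\<Sum>i\<in>UNIV. h i x *s \<Lambda> i)"
  have "h j (x - y) = 0" for j
    by (simp add: y_def coroot_diff coroot_sum coroot_scale if_distrib cong: if_cong)
  then have "u (x - y) = x - y" by (rule W_fixed[OF assms(1)])
  moreover have "u y = y" by (simp add: y_def W_sum[OF assms(1)] W_scale[OF assms(1)] assms(2))
  ultimately show "u x = id x" by (simp add: W_diff[OF assms(1)])
qed

lemma level_rho_pos: "level rho > 0"
  by (auto simp: level_rho intro!: sum_pos comark_pos)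

text \<open>For large N the weight \<open>N *s rho + \<Lambda> j\<close> and its image
  \<open>N *s rho + u (\<Lambda> j)\<close> are both dominant, hence equal, since an orbit contains
  one dominant weight only.\<close>

lemma W_fix_rho:
  assumes u: "u \<in> W" and "u rho = rho"
  shows "u = id"
proof (rule W_fix_fund[OF u])
  fix j
  define N where "N = 1 + (\<Sum>i\<in>UNIV. \<bar>h i (u (\<Lambda> j))\<bar>)"
  have N: "N \<ge> 1" by (auto simp: N_def intro!: sum_nonneg)
  have le: "- N \<le> h i (u (\<Lambda> j))" for i
  proof -
    have "\<bar>h i (u (\<Lambda> j))\<bar> \<le> (\<Sum>i\<in>UNIV. \<bar>h i (u (\<Lambda> j))\<bar>)" by (rule member_le_sum) auto
    then show ?thesis unfolding N_def by linarith
  qed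
  define \<mu> where "\<mu> = N *s rho + \<Lambda> j"
  have u\<mu>: "u \<mu> = N *s rho + u (\<Lambda> j)"
    using assms by (simp add: \<mu>_def W_add W_scale)
  have "dominant \<mu>" using N by (auto simp: \<mu>_def dominant_def coroot_linear)
  moreover have "level \<mu> > 0"
  proof -
    have "level \<mu> = N * level rho + comark j" by (simp add: \<mu>_def level_linear comark_def)
    moreover have "level rho \<ge> 0" using level_rho_pos by simp
    moreover from this have "0 \<le> N * level rho" using N by (intro mult_nonneg_nonneg) auto
    ultimately show ?thesis using comark_pos[of j] by linarith
  qed
  moreover have "dominant (u \<mu>)"
    unfolding dominant_def
  proof
    show "0 \<le> h i (u \<mu>)" for i using le[of i] by (simp add: u\<mu> coroot_linear)
  qed
  ultimately have "u \<mu> = \<mu>" using dominant_in_orbit u by blast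
  then show "u (\<Lambda> j) = \<Lambda> j" by (simp add: u\<mu>) (simp add: \<mu>_def)
qed

lemma dominant_fund: "dominant (\<Lambda> j)"
  by (simp add: dominant_def)

lemma dominant_rho: "dominant rho"
  by (simp add: dominant_def)

lemma level_fund: "level (\<Lambda> j) > 0"
  using comark_pos[of j] by (simp add: comark_def)

lemma dominant_ge:
  assumes "dominant d" "level d > 0" "w \<in> W"
  shows "w d $ Inr i \<le> d $ Inr i"
  using raise_star_Inr[OF dominant_top[OF assms]] .

text \<open>The difference \<gamma> of \<open>\<Lambda> j\<close> and its image lies in the root
  lattice and is fixed by u. So u and its inverse move \<open>\<Lambda> j\<close> by -\<gamma> and
  by \<gamma>; as both images lie below \<open>\<Lambda> j\<close>, \<gamma> vanishes.\<close>

lemma W_fix_roots: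
  assumes u: "u \<in> W" and fx: "\<And>i. u (\<alpha> i) = \<alpha> i"
  shows "u = id"
proof (rule W_fix_fund[OF u])
  fix j
  define \<gamma> where "\<gamma> = \<Lambda> j - u (\<Lambda> j)"
  have inl: "\<gamma> $ Inl i = 0" for i by (simp add: \<gamma>_def W_Inl[OF u])
  have "u \<gamma> = u (\<Sum>i\<in>UNIV. \<gamma> $ Inr i *s \<alpha> i)" using root_expand[of \<gamma>] inl by simp
  also have "\<dots> = (\<Sum>i\<in>UNIV. \<gamma> $ Inr i *s \<alpha> i)" by (simp add: W_sum[OF u] W_scale[OF u] fx)
  also have "\<dots> = \<gamma>" using root_expand[of \<gamma>] inl by simp
  finally have "u (\<Lambda> j + \<gamma>) = u (\<Lambda> j) + \<gamma>" by (simp only: W_add[OF u])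
  also have "\<dots> = \<Lambda> j" by (simp add: \<gamma>_def)
  finally have inv: "invf u (\<Lambda> j) = \<Lambda> j + \<gamma>" using W_inv_apply(1)[OF u] by metis
  have "\<gamma> $ Inr i = 0" for i
  proof -
    have "invf u (\<Lambda> j) $ Inr i \<le> \<Lambda> j $ Inr i" "u (\<Lambda> j) $ Inr i \<le> \<Lambda> j $ Inr i"
      using dominant_ge[OF dominant_fund level_fund] u W_inv by blast+
    then show ?thesis by (simp add: inv) (simp add: \<gamma>_def)
  qed
  then have "\<gamma> = 0" using inl by (simp add: weight_eq_iff)
  then show "u (\<Lambda> j) = \<Lambda> j" by (simp add: \<gamma>_def)
qed

section \<open>Cocycles of functions on weights, and stabilizers of dominant weights\<close>

definition cocycle :: "(('i weight \<Rightarrow> 'i weight) \<Rightarrow> 'i weight \<Rightarrow> 'k::ab_group_add) \<Rightarrow> bool" where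
  "cocycle F \<longleftrightarrow> (\<forall>v\<in>W. \<forall>w\<in>W. \<forall>x. F (v \<circ> w) x = F v x + F w (invf v x))"

lemma cocycleD: "cocycle F \<Longrightarrow> v \<in> W \<Longrightarrow> w \<in> W \<Longrightarrow> F (v \<circ> w) x = F v x + F w (invf v x)"
  by (simp only: cocycle_def)

lemma cocycle_id: "cocycle F \<Longrightarrow> F id x = 0"
  using cocycleD[of F id id x] W_id by (simp only: comp_id inv_id id_apply) simp

text \<open>At a point fixed by the involution \<open>s i\<close> the cocycle relation for its
  square reads r + r = 0.\<close>

lemma cocycle_reflection_fixed:
  assumes F: "cocycle F" and tf: "\<And>r :: 'k::ab_group_add. r + r = 0 \<Longrightarrow> r = 0" and "h i x = 0"
  shows "F (s i) x = (0 :: 'k)"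
proof -
  have "s i \<circ> s i = id" by auto
  then have "0 = F (s i \<circ> s i) x" by (simp only: cocycle_id[OF F])
  also have "\<dots> = F (s i) x + F (s i) (invf (s i) x)" by (rule cocycleD[OF F W_reflection W_reflection])
  also have "invf (s i) x = x" using assms(3) by (simp only: reflection_inv reflection_fixed)
  finally show ?thesis by (rule tf[OF sym])
qed

text \<open>If \<open>u\<close> fixes \<open>d\<close> and \<open>u \<noteq> id\<close>, then \<open>u\<close> moves the regular weight \<open>N d + rho\<close> out of the dominant
  chamber, and for large \<open>N\<close> a wall that separates it from the chamber contains \<open>d\<close>.\<close>

lemma cocycle_stabilizer:
  fixes F :: "('i weight \<Rightarrow> 'i weight) \<Rightarrow> 'i weight \<Rightarrow> 'k::ab_group_add"
  assumes F: "cocycle F" and tf: "\<And>r :: 'k. r + r = 0 \<Longrightarrow> r = 0"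
    and d: "dominant d" "level d > 0"
  shows "u \<in> W \<Longrightarrow> u d = d \<Longrightarrow> F u d = 0"
proof (induction "nat (ht (rho - u rho))" arbitrary: u rule: less_induct)
  case less
  have ge: "u rho $ Inr i \<le> rho $ Inr i" if "u \<in> W" for u i
    using dominant_ge[OF dominant_rho level_rho_pos that] .
  show ?case
  proof (cases "u rho = rho")
    case True
    then have "u = id" by (rule W_fix_rho[OF less.prems(1)])
    then show ?thesis using cocycle_id[OF F] by simp
  next
    case False
    define N where "N = 1 + (\<Sum>i\<in>UNIV. \<bar>h i (u rho)\<bar>)"
    have N: "\<bar>h i (u rho)\<bar> < N" for i
    proof -
      have "\<bar>h i (u rho)\<bar> \<le> (\<Sum>i\<in>UNIV. \<bar>h i (u rho)\<bar>)" by (rule member_le_sum) auto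
      then show ?thesis unfolding N_def by linarith
    qed
    define \<mu> where "\<mu> = N *s d + rho"
    have "N > 0" using N by (meson abs_ge_zero order_le_less_trans)
    have u\<mu>: "u \<mu> = N *s d + u rho"
      using less.prems by (simp add: \<mu>_def W_add W_scale)
    have "dominant \<mu>"
      using \<open>N > 0\<close> d(1) by (auto simp: \<mu>_def dominant_def coroot_linear intro!: add_nonneg_nonneg)
    moreover have "level \<mu> > 0"
    proof -
      have "0 < N * level d" using \<open>N > 0\<close> d(2) by (rule mult_pos_pos)
      then show ?thesis using level_rho_pos by (simp add: \<mu>_def level_linear)
    qed
    moreover have "u \<mu> \<noteq> \<mu>" using False by (simp add: u\<mu>) (simp add: \<mu>_def)
    ultimately have "\<not> dominant (u \<mu>)" using dominant_in_orbit less.prems(1) by blast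
    then obtain i where i: "h i (u \<mu>) < 0" by (auto simp: dominant_def not_le)
    then have neg: "N * h i d + h i (u rho) < 0" by (simp add: u\<mu> coroot_linear)
    have "h i d = 0"
    proof (rule ccontr)
      assume "h i d \<noteq> 0"
      then have "h i d \<ge> 1" using d(1) by (simp add: dominant_def order_less_le int_one_le_iff_zero_less)
      then have "N * 1 \<le> N * h i d" using \<open>N > 0\<close> by (intro mult_left_mono) auto
      then show False using neg N[of i] by linarith
    qed
    then have hneg: "h i (u rho) < 0" using neg by simp
    \<comment> \<open>Crossing this wall keeps d fixed and brings the image of rho closer to rho;
      the depth of \<open>u rho\<close> serves as the length of u.\<close>
    define v where "v = s i \<circ> u"
    have v: "v \<in> W" unfolding v_def by (rule W_step[OF less.prems(1)])
    have vd: "v d = d" using less.prems(2) \<open>h i d = 0\<close> by (simp add: v_def reflection_fixed)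
    have vrho: "ht (rho - v rho) = ht (rho - u rho) + h i (u rho)"
      by (simp add: v_def ht_linear ht_reflection)
    have "ht (rho - v rho) \<ge> 0" unfolding ht_def using ge[OF v] by (intro sum_nonneg) simp
    then have "nat (ht (rho - v rho)) < nat (ht (rho - u rho))" using vrho hneg by linarith
    then have "F v d = 0" using less.hyps v vd by blast
    moreover have "u = s i \<circ> v" by (auto simp: v_def)
    then have "F u d = F (s i) d + F v (invf (s i) d)"
      using cocycleD[OF F W_reflection v] by (simp only:)
    moreover have "invf (s i) d = d" using \<open>h i d = 0\<close> by (simp only: reflection_inv reflection_fixed)
    ultimately show ?thesis using cocycle_reflection_fixed[OF F tf \<open>h i d = 0\<close>] by simp
  qed
qed

section \<open>Orbit graphs and finitely supported primitives\<close>

definition "weyl_orbit x = {w x | w. w \<in> W}"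

lemma orbit_self: "x \<in> weyl_orbit x"
  using W_id by (auto simp: weyl_orbit_def intro!: exI[of _ id])

lemma orbit_W: "y \<in> weyl_orbit x \<Longrightarrow> w \<in> W \<Longrightarrow> w y \<in> weyl_orbit x"
  by (auto simp: weyl_orbit_def) (metis W_comp comp_apply)

lemma orbit_level: "y \<in> weyl_orbit x \<Longrightarrow> level y = level x"
  by (auto simp: weyl_orbit_def W_level)

lemma orbit_reflection: "y \<in> weyl_orbit x \<Longrightarrow> s i y \<in> weyl_orbit x"
  by (rule orbit_W[OF _ W_reflection])

text \<open>One-endedness of the orbit graph: deleting a vertex \<open>x\<close> of minimal depth does
  not disconnect its lower neighbours, as any two of them have a common descendant.\<close>

lemma orbit_connected_below:
  assumes d: "dominant d" "level d > 0" and nr: "CARD('i) > 2 \<or> (\<exists>i. h i d = 0)"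
  shows "(\<And>x i. x \<in> weyl_orbit d \<Longrightarrow> int n \<le> ht d - ht x \<Longrightarrow> int n \<le> ht d - ht (s i x) \<Longrightarrow> g (s i x) = g x)
    \<Longrightarrow> x \<in> weyl_orbit d \<Longrightarrow> y \<in> weyl_orbit d \<Longrightarrow> int n \<le> ht d - ht x \<Longrightarrow> int n \<le> ht d - ht y \<Longrightarrow> g x = g y"
proof (induction n arbitrary: g x y)
  case 0
  have nonneg: "0 \<le> ht d - ht x" if "x \<in> weyl_orbit d" for x
    using that dominant_ge[OF d] by (auto simp: weyl_orbit_def ht_def intro!: sum_mono)
  have "g (w d) = g d" if "w \<in> W" for w
    using that
  proof (induction rule: W.induct)
    case (W_step w i)
    have "w d \<in> weyl_orbit d" using W_step by (auto simp: weyl_orbit_def)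
    then have "g (s i (w d)) = g (w d)"
      using nonneg[OF orbit_reflection] nonneg by (intro 0(1)) auto
    then show ?case using W_step by simp
  qed simp
  then show ?case using 0 by (auto simp: weyl_orbit_def)
next
  case (Suc n)
  define D where "D = (\<lambda>m. {x \<in> weyl_orbit d. int m \<le> ht d - ht x})"
  have edge: "g (s i x) = g x" if "x \<in> D (Suc n)" "s i x \<in> D (Suc n)" for x i
    using Suc.prems(1)[of x i] that by (simp add: D_def)
  have chain: "z \<in> D (Suc n) \<and> g z = g x" if "lowers\<^sup>*\<^sup>* x z" "x \<in> D (Suc n)" for x z
    using that
  proof (induction rule: rtranclp_induct)
    case (step y z)
    then obtain i where i: "h i y > 0" "z = s i y" by (auto simp: lowers_def)
    have "z \<in> D (Suc n)" using step i by (auto simp: D_def orbit_reflection ht_reflection)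
    then show ?case using edge[of y i] step i by simp
  qed simp
  have below: "s i x \<in> D (Suc n)" if "x \<in> D n" "h i x > 0" for x i
    using that by (auto simp: D_def orbit_reflection ht_reflection)
  have fork: "g (s i x) = g (s k x)" if x: "x \<in> D n" "h i x > 0" "h k x > 0" for x i k
  proof (cases "i = k")
    case False
    have "A $ i $ k * A $ k $ i < 4"
    proof (cases "CARD('i) > 2")
      case True
      then show ?thesis using finite_type_pair False by blast
    next
      case no: False
      then have U: "UNIV = {i, k}" using False CARD_two by blast
      \<comment> \<open>With two indices a vertex with two lower neighbours has both coroots
        positive, so it is d itself and regular; this contradicts the singularity assumed in that
        case.\<close>
      have "dominant x" unfolding dominant_def
      proof
        fix j have "j \<in> {i, k}" using U by blast
        then show "0 \<le> h j x" using x(2,3) by auto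
      qed
      moreover obtain w where "w \<in> W" "x = w d" using x by (auto simp: D_def weyl_orbit_def)
      ultimately have "x = d" using dominant_in_orbit[OF d] by blast
      obtain j where "h j x = 0" using nr no \<open>x = d\<close> by blast
      moreover have "j \<in> {i, k}" using U by blast
      ultimately show ?thesis using x(2,3) by auto
    qed
    then obtain z where "lowers\<^sup>*\<^sup>* (s i x) z" "lowers\<^sup>*\<^sup>* (s k x) z"
      using rank_two_confluence[OF x(2,3) False] by blast
    then show ?thesis using chain below x by metis
  qed simp
  \<comment> \<open>Extension of g to depth n by its value at a lower neighbour; \<open>fork\<close>
    makes the choice irrelevant. Two vertices of the same depth joined by a reflection coincide, so
    no other new edges have to be checked.\<close>
  define g' where "g' = (\<lambda>x. if x \<in> D (Suc n) then g x else g (s (SOME i. h i x > 0) x))"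
  have g'_low: "g' x = g (s i x)" if x: "x \<in> D n" "x \<notin> D (Suc n)" "h i x > 0" for x i
  proof -
    have "h (SOME i. h i x > 0) x > 0" using x(3) by (rule someI)
    from fork[OF x(1) this x(3)] show ?thesis by (simp only: g'_def x(2) if_False)
  qed
  have edge': "g' (s i x) = g' x" if x: "x \<in> D n" "s i x \<in> D n" for x i
  proof -
    have inv: "h i (s i x) = - h i x" by (simp add: coroot_reflection diag)
    consider "x \<in> D (Suc n)" "s i x \<in> D (Suc n)" | "x \<notin> D (Suc n)" | "s i x \<notin> D (Suc n)" by blast
    then show ?thesis
    proof cases
      case 1
      then show ?thesis using edge by (simp add: g'_def)
    next
      case 2
      then have "h i x \<ge> 0" using x by (auto simp: D_def ht_reflection)
      then consider "h i x = 0" | "h i x > 0" by linarith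
      then show ?thesis
      proof cases
        case 1 then show ?thesis by (simp add: reflection_fixed)
      next
        case b: 2
        then have "s i x \<in> D (Suc n)" using below x by blast
        then show ?thesis using g'_low[OF x(1) 2 b] by (simp add: g'_def)
      qed
    next
      case 3
      then have "h i x \<le> 0" using x by (auto simp: D_def ht_reflection)
      then consider "h i x = 0" | "h i (s i x) > 0" using inv by linarith
      then show ?thesis
      proof cases
        case 1 then show ?thesis by (simp add: reflection_fixed)
      next
        case b: 2
        then have "x \<in> D (Suc n)" using below[OF x(2) b] by simp
        then show ?thesis using g'_low[OF x(2) 3 b] by (simp add: g'_def)
      qed
    qed
  qed
  have "g' x = g' y"
  proof (rule Suc.IH)
    show "g' (s i x) = g' x" if "x \<in> weyl_orbit d" "int n \<le> ht d - ht x" "int n \<le> ht d - ht (s i x)" for x i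
      using that by (intro edge') (auto simp: D_def orbit_reflection)
  qed (use Suc.prems in auto)
  moreover have "x \<in> D (Suc n)" "y \<in> D (Suc n)" using Suc.prems by (auto simp: D_def)
  ultimately show ?case by (simp add: g'_def)
qed

lemma finite_orbit_above:
  assumes "dominant d" "level d > 0"
  shows "finite {x \<in> weyl_orbit d. ht d - ht x < n}"
proof -
  have "{x \<in> weyl_orbit d. ht d - ht x < n} \<subseteq> (\<lambda>x. d - x) ` {x. \<forall>k. \<bar>x $ k\<bar> \<le> n}"
  proof
    fix x assume x: "x \<in> {x \<in> weyl_orbit d. ht d - ht x < n}"
    then obtain w where w: "w \<in> W" "x = w d" by (auto simp: weyl_orbit_def)
    have nn: "(d - x) $ Inr i \<ge> 0" for i using dominant_ge[OF assms w(1)] w by simp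
    have "(d - x) $ Inr i \<le> ht (d - x)" for i
      unfolding ht_def using nn by (intro member_le_sum) auto
    moreover have "ht (d - x) < n" using x by (simp add: ht_linear)
    ultimately have "(d - x) $ Inr i \<le> n" for i by (meson order_trans less_imp_le)
    moreover have "(d - x) $ Inl i = 0" for i by (simp add: w W_Inl)
    ultimately have "\<bar>(d - x) $ k\<bar> \<le> n" for k
      using nn by (cases k) (metis abs_zero nn order_trans, metis abs_of_nonneg)
    then show "x \<in> (\<lambda>x. d - x) ` {x. \<forall>k. \<bar>x $ k\<bar> \<le> n}"
      by (intro image_eqI[of _ _ "d - x"]) auto
  qed
  then show ?thesis by (rule finite_subset) (intro finite_imageI finite_bounded_vectors)
qed

definition finite_primitive :: "'k set \<Rightarrow> (('i weight \<Rightarrow> 'i weight) \<Rightarrow> 'i weight \<Rightarrow> 'k::ab_group_add)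
    \<Rightarrow> 'i weight set \<Rightarrow> ('i weight \<Rightarrow> 'k) \<Rightarrow> bool" where
  "finite_primitive R F Z b \<longleftrightarrow> finite {x. b x \<noteq> 0} \<and> (\<forall>x. b x \<in> R) \<and>
    (\<forall>x. b x \<noteq> 0 \<longrightarrow> x \<in> Z) \<and> (\<forall>w\<in>W. \<forall>x\<in>Z. F w x = b (invf w x) - b x)"

text \<open>The primitive with value 0 at d is forced to be \<open>- F w (w d)\<close> at
  \<open>w d\<close>, and the vanishing on the stabilizer makes it well defined. It takes values in
  R but need not have finite support before its value far from d is subtracted.\<close>

lemma orbit_coboundary_dominant:
  fixes F :: "('i weight \<Rightarrow> 'i weight) \<Rightarrow> 'i weight \<Rightarrow> 'k::ab_group_add"
  assumes F: "cocycle F" and tf: "\<And>r :: 'k. r + r = 0 \<Longrightarrow> r = 0"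
    and d: "dominant d" "level d > 0" and nr: "CARD('i) > 2 \<or> (\<exists>i. h i d = 0)"
    and fin: "\<And>i. finite {x \<in> weyl_orbit d. F (s i) x \<noteq> 0}"
    and R: "0 \<in> R" "\<And>r r'. r \<in> R \<Longrightarrow> r' \<in> R \<Longrightarrow> r - r' \<in> R" "\<And>w x. w \<in> W \<Longrightarrow> F w x \<in> R"
  shows "\<exists>b. finite_primitive R F (weyl_orbit d) b"
proof -
  define g where "g = (\<lambda>x. - F (SOME w. w \<in> W \<and> w d = x) x)"
  have welldef: "F v (v d) = F w (w d)" if vw: "v \<in> W" "w \<in> W" "v d = w d" for v w
  proof -
    define u where "u = invf w \<circ> v"
    have u: "u \<in> W" unfolding u_def by (intro W_comp W_inv vw)
    have "u d = d" using vw by (simp add: u_def W_inv_apply)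
    have "v = w \<circ> u" by (auto simp: u_def W_inv_apply vw)
    then have "F v (v d) = F w (v d) + F u (invf w (v d))" using cocycleD[OF F vw(2) u] by (simp only:)
    also have "invf w (v d) = d" using vw by (simp add: W_inv_apply)
    finally show ?thesis using cocycle_stabilizer[OF F tf d u \<open>u d = d\<close>] vw by simp
  qed
  have g: "g (w d) = - F w (w d)" if "w \<in> W" for w
  proof -
    define v where "v = (SOME v. v \<in> W \<and> v d = w d)"
    have "v \<in> W \<and> v d = w d" unfolding v_def by (rule someI[of _ w]) (simp add: that)
    then show ?thesis using welldef[of v w] that by (simp add: g_def v_def[symmetric])
  qed
  have Fg: "F w x = g (invf w x) - g x" if w: "w \<in> W" and x: "x \<in> weyl_orbit d" for w x
  proof -
    obtain v where v: "v \<in> W" "x = v d" using x by (auto simp: weyl_orbit_def)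
    define u where "u = invf w \<circ> v"
    have u: "u \<in> W" unfolding u_def by (intro W_comp W_inv v w)
    have "v = w \<circ> u" by (auto simp: u_def W_inv_apply w)
    then have "F v x = F w x + F u (invf w x)" using cocycleD[OF F w u] by (simp only:)
    moreover have "g x = - F v x" using g[OF v(1)] v(2) by simp
    moreover have "invf w x = u d" by (simp add: u_def v)
    then have "g (invf w x) = - F u (invf w x)" using g[OF u] by simp
    ultimately show ?thesis by simp
  qed
  \<comment> \<open>The points from which some simple reflection changes g. Beyond the depth n of
    all of them g is constant, as the orbit graph is connected there.\<close>
  define B where "B = (\<Union>i. {x \<in> weyl_orbit d. F (s i) x \<noteq> 0})"
  have "finite B" unfolding B_def using fin by (intro finite_UN_I) simp_all
  define n where "n = nat (\<Sum>x\<in>B. \<bar>ht d - ht x\<bar> + 1)"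
  have n: "ht d - ht x < int n" if "x \<in> B" for x
  proof -
    have "\<bar>ht d - ht x\<bar> + 1 \<le> (\<Sum>x\<in>B. \<bar>ht d - ht x\<bar> + 1)"
      using \<open>finite B\<close> that by (intro member_le_sum) auto
    then show ?thesis by (simp add: n_def)
  qed
  define D where "D = {x \<in> weyl_orbit d. int n \<le> ht d - ht x}"
  \<comment> \<open>The value at infinity, or 0 if no point of the orbit is that deep.\<close>
  define c where "c = (if D = {} then 0 else g (SOME x. x \<in> D))"
  have gc: "g x = c" if "x \<in> D" for x
  proof -
    have "(SOME x. x \<in> D) \<in> D" using that by (rule someI)
    moreover have "g x = g y" if "y \<in> D" for y
    proof (rule orbit_connected_below[OF d nr])
      fix x i assume x: "x \<in> weyl_orbit d" "int n \<le> ht d - ht x" "int n \<le> ht d - ht (s i x)"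
      then have "F (s i) x = 0" using n[of x] by (auto simp: B_def)
      then show "g (s i x) = g x" using Fg[OF W_reflection x(1), of i] by (simp add: reflection_inv)
    qed (use that \<open>x \<in> D\<close> in \<open>auto simp: D_def\<close>)
    ultimately show ?thesis using that by (auto simp: c_def)
  qed
  define b where "b = (\<lambda>x. if x \<in> weyl_orbit d then g x - c else 0)"
  have gR: "g x \<in> R" if x: "x \<in> weyl_orbit d" for x
  proof -
    obtain v where v: "v \<in> W" "x = v d" using x by (auto simp: weyl_orbit_def)
    then have "g x = 0 - F v x" using g[OF v(1)] by simp
    then show ?thesis using R(2)[OF R(1) R(3)[OF v(1)]] by simp
  qed
  have "c \<in> R"
  proof (cases "D = {}")
    case False
    then obtain y where "y \<in> D" by blast
    then have "(SOME x. x \<in> D) \<in> D" by (rule someI)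
    then have "g (SOME x. x \<in> D) \<in> R" by (intro gR) (simp add: D_def)
    then show ?thesis using False by (simp only: c_def if_False)
  qed (simp add: c_def R)
  show ?thesis
    unfolding finite_primitive_def
  proof (intro exI[of _ b] conjI allI ballI impI)
    have "{x. b x \<noteq> 0} \<subseteq> {x \<in> weyl_orbit d. ht d - ht x < int n}"
      using gc by (auto simp: b_def D_def split: if_splits) (meson linorder_not_less)
    then show "finite {x. b x \<noteq> 0}" by (rule finite_subset) (rule finite_orbit_above[OF d])
    show "b x \<in> R" for x using gR R(1,2) \<open>c \<in> R\<close> by (simp add: b_def)
    show "x \<in> weyl_orbit d" if "b x \<noteq> 0" for x using that by (simp add: b_def split: if_splits)
    show "F w x = b (invf w x) - b x" if "w \<in> W" "x \<in> weyl_orbit d" for w x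
      using Fg[OF that] that orbit_W[OF that(2) W_inv[OF that(1)]] by (simp add: b_def)
  qed
qed


lemma weyl_orbit_eq: "y \<in> weyl_orbit x \<Longrightarrow> weyl_orbit y = weyl_orbit x"
proof -
  assume "y \<in> weyl_orbit x"
  then obtain w where w: "w \<in> W" "y = w x" by (auto simp: weyl_orbit_def)
  have "x = invf w y" using w by (simp add: W_inv_apply)
  then have "x \<in> weyl_orbit y" using W_inv[OF w(1)] by (auto simp: weyl_orbit_def)
  show ?thesis
  proof
    show "weyl_orbit y \<subseteq> weyl_orbit x"
      using orbit_W[OF \<open>y \<in> weyl_orbit x\<close>] by (auto simp: weyl_orbit_def[of y])
    show "weyl_orbit x \<subseteq> weyl_orbit y"
      using orbit_W[OF \<open>x \<in> weyl_orbit y\<close>] by (auto simp: weyl_orbit_def[of x])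
  qed
qed

lemma orbit_coboundary_pos:
  fixes F :: "('i weight \<Rightarrow> 'i weight) \<Rightarrow> 'i weight \<Rightarrow> 'k::ab_group_add"
  assumes F: "cocycle F" and tf: "\<And>r :: 'k. r + r = 0 \<Longrightarrow> r = 0"
    and x: "level x > 0" and nr: "CARD('i) > 2 \<or> level x < level rho"
    and fin: "\<And>i. finite {y \<in> weyl_orbit x. F (s i) y \<noteq> 0}"
    and R: "0 \<in> R" "\<And>r r'. r \<in> R \<Longrightarrow> r' \<in> R \<Longrightarrow> r - r' \<in> R" "\<And>w x. w \<in> W \<Longrightarrow> F w x \<in> R"
  shows "\<exists>b. finite_primitive R F (weyl_orbit x) b"
proof -
  obtain d where d: "dominant d" "raises\<^sup>*\<^sup>* x d" using dominant_exists[OF x] by blast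
  obtain w where "w \<in> W" "d = w x" using raise_star_W[OF d(2)] by blast
  then have orb: "weyl_orbit d = weyl_orbit x" by (intro weyl_orbit_eq) (auto simp: weyl_orbit_def)
  have lev: "level d = level x" using raise_star_level[OF d(2)] .
  \<comment> \<open>If all coroots were positive on d they would be at least 1, and the level would
    reach the sum of the comarks, which is \<open>level rho\<close>.\<close>
  have "\<exists>i. h i d = 0" if "level x < level rho"
  proof (rule ccontr)
    assume "\<nexists>i. h i d = 0"
    then have "h i d \<ge> 1" for i using d(1) by (simp add: dominant_def order_less_le int_one_le_iff_zero_less)
    then have "(\<Sum>i\<in>UNIV. comark i * 1) \<le> level d"
      unfolding level_eq using comark_pos by (intro sum_mono mult_left_mono) (auto intro: less_imp_le)
    then show False using that lev by (simp add: level_rho)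
  qed
  then have "CARD('i) > 2 \<or> (\<exists>i. h i d = 0)" using nr by blast
  then show ?thesis
    using orbit_coboundary_dominant[OF F tf d(1) _ _ _ R] x lev fin by (simp only: orb)
qed

text \<open>Negation commutes with the Weyl group and reverses the level, so negative levels reduce
  to positive ones.\<close>

lemma orbit_coboundary:
  fixes F :: "('i weight \<Rightarrow> 'i weight) \<Rightarrow> 'i weight \<Rightarrow> 'k::ab_group_add"
  assumes F: "cocycle F" and tf: "\<And>r :: 'k. r + r = 0 \<Longrightarrow> r = 0"
    and x: "level x \<noteq> 0" and nr: "CARD('i) > 2 \<or> \<bar>level x\<bar> < level rho"
    and fin: "\<And>i. finite {y \<in> weyl_orbit x. F (s i) y \<noteq> 0}"
    and R: "0 \<in> R" "\<And>r r'. r \<in> R \<Longrightarrow> r' \<in> R \<Longrightarrow> r - r' \<in> R" "\<And>w x. w \<in> W \<Longrightarrow> F w x \<in> R"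
  shows "\<exists>b. finite_primitive R F (weyl_orbit x) b"
proof (cases "level x > 0")
  case True
  then show ?thesis using nr by (intro orbit_coboundary_pos[OF F tf _ _ fin R]) auto
next
  case False
  define F' where "F' = (\<lambda>w y. F w (- y))"
  have inv_minus: "invf w (- y) = - invf w y" if "w \<in> W" for w y
    using W_minus[OF W_inv[OF that]] .
  have F': "cocycle F'"
    unfolding cocycle_def F'_def
  proof (intro ballI allI)
    fix v w y assume "v \<in> W" "w \<in> W"
    then show "F (v \<circ> w) (- y) = F v (- y) + F w (- invf v y)"
      using cocycleD[OF F, of v w "- y"] by (simp only: inv_minus)
  qed
  have orb: "y \<in> weyl_orbit (- x) \<longleftrightarrow> - y \<in> weyl_orbit x" for y
    by (auto simp: weyl_orbit_def W_minus) (metis W_minus minus_minus)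
  have "\<exists>b. finite_primitive R F' (weyl_orbit (- x)) b"
  proof (rule orbit_coboundary_pos[OF F' tf _ _ _ R(1,2)])
    show "level (- x) > 0" "CARD('i) > 2 \<or> level (- x) < level rho"
      using x False nr by (auto simp: level_linear)
    show "finite {y \<in> weyl_orbit (- x). F' (s i) y \<noteq> 0}" for i
    proof -
      have "{y \<in> weyl_orbit (- x). F' (s i) y \<noteq> 0} \<subseteq> uminus ` {y \<in> weyl_orbit x. F (s i) y \<noteq> 0}"
      proof
        fix y assume "y \<in> {y \<in> weyl_orbit (- x). F' (s i) y \<noteq> 0}"
        then show "y \<in> uminus ` {y \<in> weyl_orbit x. F (s i) y \<noteq> 0}"
          by (intro image_eqI[of _ _ "- y"]) (simp_all add: orb F'_def)
      qed
      then show ?thesis by (rule finite_subset) (rule finite_imageI[OF fin])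
    qed
    show "F' w y \<in> R" if "w \<in> W" for w y using R(3)[OF that] by (simp add: F'_def)
  qed
  then obtain b where b: "finite {y. b y \<noteq> 0}" "\<And>y. b y \<in> R" "\<And>y. b y \<noteq> 0 \<Longrightarrow> y \<in> weyl_orbit (- x)"
    "\<And>w y. w \<in> W \<Longrightarrow> y \<in> weyl_orbit (- x) \<Longrightarrow> F' w y = b (invf w y) - b y"
    unfolding finite_primitive_def by blast
  show ?thesis
    unfolding finite_primitive_def
  proof (intro exI[of _ "\<lambda>y. b (- y)"] conjI allI ballI impI)
    have "{y. b (- y) \<noteq> 0} \<subseteq> uminus ` {y. b y \<noteq> 0}"
      by (auto intro: image_eqI[of _ _ "- y" for y])
    then show "finite {y. b (- y) \<noteq> 0}" by (rule finite_subset) (rule finite_imageI[OF b(1)])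
    show "b (- y) \<in> R" for y by (rule b(2))
    show "y \<in> weyl_orbit x" if "b (- y) \<noteq> 0" for y using b(3)[OF that] by (simp add: orb)
    show "F w y = b (- invf w y) - b (- y)" if "w \<in> W" "y \<in> weyl_orbit x" for w y
      using b(4)[OF that(1), of "- y"] that by (simp add: orb F'_def inv_minus)
  qed
qed

section \<open>Representatives modulo \<delta>, orbits of level zero, and translations\<close>

definition "base = (SOME i :: 'i. True)"
text \<open>Integer division in one fixed coordinate: since \<open>mark base\<close> is positive,
  shifts by \<delta> bring that coordinate into the range from 0 to below \<open>mark base\<close>
  in exactly one way, so \<open>nf\<close> selects one weight from each class.\<close>

definition "qt x = x $ Inr base div mark base" for x :: "'i weight"
definition "nf x = x - qt x *s \<delta>"

lemma delta_nth [simp]: "\<delta> $ Inl i = 0" "\<delta> $ Inr i = mark i"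
  by (simp_all add: null_root_Inl null_root_Inr)

lemma nf_qt: "x = nf x + qt x *s \<delta>"
  by (simp add: nf_def)

lemma vscale_add: "(k + l) *s x = k *s x + l *s (x :: 'i weight)"
  by (simp add: vec_eq_iff distrib_right)

lemma vscale_diff: "(k - l) *s x = k *s x - l *s (x :: 'i weight)"
  by (simp add: vec_eq_iff left_diff_distrib)

lemma qt_add: "qt (x + k *s \<delta>) = qt x + k"
  using mark_pos[of base] by (simp add: qt_def)

lemma nf_add [simp]: "nf (x + k *s \<delta>) = nf x"
  by (simp add: nf_def qt_add vscale_add)

lemma nf_eqD: "nf x = nf y \<Longrightarrow> y = x + (qt y - qt x) *s \<delta>"
  unfolding nf_def by (simp add: vscale_diff algebra_simps)

lemma nf_diff [simp]: "nf (x - k *s \<delta>) = nf x"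
proof -
  have "x - k *s \<delta> = x + (- k) *s \<delta>" by (simp add: vec_eq_iff)
  then show ?thesis by (simp only: nf_add)
qed

lemma nf_nf [simp]: "nf (nf x) = nf x"
  using nf_diff[of x "qt x"] by (simp only: nf_def[of x, symmetric])

lemma other_index: "\<exists>j. j \<noteq> (i :: 'i)"
proof (rule ccontr)
  assume "\<nexists>j. j \<noteq> i"
  then have "UNIV = {i}" by auto
  then have "(\<Sum>j\<in>{i}. A $ i $ j * mark j) = 0" using mark_null[of i] by (simp only:)
  then show False using mark_pos[of i] by (simp add: diag)
qed

lemma root_not_delta: "m *s \<alpha> i = k *s \<delta> \<Longrightarrow> m = 0"
proof -
  assume eq: "m *s \<alpha> i = k *s \<delta>"
  obtain j where "j \<noteq> i" using other_index by blast
  then have "k * mark j = 0" using arg_cong[OF eq, of "\<lambda>v. v $ Inr j"] by simp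
  then have "k = 0" using mark_pos[of j] by simp
  then show "m = 0" using arg_cong[OF eq, of "\<lambda>v. v $ Inr i"] by simp
qed

text \<open>At level zero the linear term of the form is insensitive to adding a constant to all z
  i. Hence \<open>spread_bound\<close> confines the displacement up to a multiple of \<delta>, and
  passing to \<open>nf\<close> removes that freedom.\<close>

lemma finite_orbit_level0:
  assumes "level x = 0"
  shows "finite (nf ` weyl_orbit x)"
proof -
  define p where "p = (\<lambda>i. real_of_int (comark i * h i x))"
  obtain C where C: "\<And>y r i. energy y / 2 + 2 * (\<Sum>i\<in>UNIV. p i * (y i - y r)) \<le> 0 \<Longrightarrow> \<bar>y i - y r\<bar> \<le> C"
    by (rule spread_bound[of p]) (rule that, assumption)
  have lev: "(\<Sum>i\<in>UNIV. p i) = 0"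
  proof -
    have "(\<Sum>i\<in>UNIV. p i) = real_of_int (level x)" by (simp add: p_def level_eq)
    then show ?thesis by (simp add: assms)
  qed
  define u where "u = (\<lambda>i. real_of_int (x $ Inr i) / of_int (mark i))"
  define N where "N = case_sum (\<lambda>i. \<bar>x $ Inl i\<bar>) (\<lambda>i. \<lceil>mark i * (\<bar>C\<bar> + \<bar>u i - u base\<bar> + 1)\<rceil>)"
  have "nf ` weyl_orbit x \<subseteq> {x. \<forall>k. \<bar>x $ k\<bar> \<le> N k}"
  proof
    fix y' assume "y' \<in> nf ` weyl_orbit x"
    then obtain w where w: "w \<in> W" and y': "y' = nf (w x)" by (auto simp: weyl_orbit_def)
    define e where "e = w x - x"
    have e: "e $ Inl i = 0" for i by (simp add: e_def W_Inl[OF w])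
    define z where "z = (\<lambda>i. real_of_int (e $ Inr i) / of_int (mark i))"
    have "energy z / 2 + 2 * (\<Sum>i\<in>UNIV. p i * z i) = 0"
      using form_energy[of e z x] e form_orbit[OF w, of x] by (simp add: z_def p_def e_def)
    moreover have "(\<Sum>i\<in>UNIV. p i * (z i - z r)) = (\<Sum>i\<in>UNIV. p i * z i)" for r
      using lev by (simp add: right_diff_distrib sum_subtractf sum_distrib_right[symmetric])
    ultimately have zC: "\<bar>z i - z base\<bar> \<le> C" for i by (intro C) simp
    \<comment> \<open>q is the integer part of \<open>u base + z base\<close>, so the normalized
      base coordinate has error less than 1; the other coordinates differ from it by a bounded
      amount.\<close>
    define q where "q = qt (w x)"
    have inr: "real_of_int (y' $ Inr i) = of_int (mark i) * (u i + z i - of_int q)" for i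
      using mark_pos[of i] by (simp add: y' nf_def q_def[symmetric] u_def z_def e_def field_simps)
    have "of_int q \<le> u base + z base" "u base + z base < of_int q + 1"
    proof -
      have "u base + z base = of_int (w x $ Inr base) / of_int (mark base)"
        by (simp add: u_def z_def e_def diff_divide_distrib)
      moreover have "q = \<lfloor>real_of_int (w x $ Inr base) / of_int (mark base)\<rfloor>"
        by (simp add: q_def qt_def floor_divide_of_int_eq)
      ultimately show "of_int q \<le> u base + z base" "u base + z base < of_int q + 1" by linarith+
    qed
    then have "\<bar>u i + z i - of_int q\<bar> \<le> \<bar>C\<bar> + \<bar>u i - u base\<bar> + 1" for i
      using zC[of i] by linarith
    then have "\<bar>real_of_int (y' $ Inr i)\<bar> \<le> mark i * (\<bar>C\<bar> + \<bar>u i - u base\<bar> + 1)" for i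
      using mark_pos[of i] by (simp add: inr abs_mult)
    then have "real_of_int \<bar>y' $ Inr i\<bar> \<le> of_int \<lceil>mark i * (\<bar>C\<bar> + \<bar>u i - u base\<bar> + 1)\<rceil>" for i
      by (metis le_of_int_ceiling of_int_abs order_trans)
    then have "\<bar>y' $ Inr i\<bar> \<le> N (Inr i)" for i unfolding N_def by (simp only: sum.case of_int_le_iff)
    moreover have "\<bar>y' $ Inl i\<bar> \<le> N (Inl i)" for i by (simp add: N_def y' nf_def W_Inl[OF w])
    ultimately have "\<bar>y' $ k\<bar> \<le> N k" for k by (cases k) simp_all
    then show "y' \<in> {x. \<forall>k. \<bar>x $ k\<bar> \<le> N k}" by simp
  qed
  then show ?thesis by (rule finite_subset) (rule finite_bounded_vectors)
qed

text \<open>Let z be the sum of the finitely many representatives of the orbit. Each simple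
  reflection permutes them modulo \<delta>, so it moves z by a multiple of \<delta>; it also moves z
  by a multiple of a simple root, so z is fixed. Statements about roots thus extend to all weights
  of level zero.\<close>

lemma orbit_average:
  assumes "level x = 0"
  obtains N z where "N > 0" "\<And>i. h i z = 0" "\<And>i. (N *s x - z) $ Inl i = 0"
proof -
  define S where "S = nf ` weyl_orbit x"
  have S: "finite S" unfolding S_def by (rule finite_orbit_level0[OF assms])
  have "S \<noteq> {}" using orbit_self by (auto simp: S_def)
  define z where "z = (\<Sum>y\<in>S. y)"
  have hz: "h i z = 0" for i
  proof -
    define f where "f = (\<lambda>y. nf (s i y))"
    have f_nf: "f (nf y) = f y" for y
      by (simp add: f_def nf_def[of y] reflection_linear reflection_fixed)
    have fS: "f y \<in> S" if y: "y \<in> S" for y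
    proof -
      obtain v where v: "v \<in> weyl_orbit x" "y = nf v" using y by (auto simp: S_def)
      have "f y = nf (s i v)" by (simp only: v(2) f_nf) (simp only: f_def)
      then show ?thesis using orbit_reflection[OF v(1)] by (simp add: S_def)
    qed
    have ff: "f (f y) = y" if "y \<in> S" for y
    proof -
      have "f y = nf (s i y)" by (simp only: f_def)
      then have "f (f y) = f (s i y)" by (simp only: f_nf)
      also have "\<dots> = nf y" by (simp add: f_def)
      also have "\<dots> = y" using that by (auto simp: S_def)
      finally show ?thesis .
    qed
    have "(\<Sum>y\<in>S. f y) = z"
      unfolding z_def by (rule sum.reindex_bij_witness[of _ f f]) (auto simp: ff fS)
    moreover have "s i z = (\<Sum>y\<in>S. s i y)" unfolding z_def by (rule W_sum[OF W_reflection])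
    moreover have "(\<Sum>y\<in>S. s i y) = (\<Sum>y\<in>S. f y + qt (s i y) *s \<delta>)"
      by (rule sum.cong) (simp_all add: f_def nf_qt[symmetric])
    ultimately have "s i z = z + (\<Sum>y\<in>S. qt (s i y) *s \<delta>)" by (simp add: sum.distrib)
    also have "(\<Sum>y\<in>S. qt (s i y) *s \<delta>) = (\<Sum>y\<in>S. qt (s i y)) *s \<delta>"
      by (simp add: vec_eq_iff sum_distrib_right)
    finally have "(- h i z) *s \<alpha> i = (\<Sum>y\<in>S. qt (s i y)) *s \<delta>"
      by (simp add: simple_reflection_def vec_eq_iff)
    then have "- h i z = 0" by (rule root_not_delta)
    then show ?thesis by simp
  qed
  have "y $ Inl i = x $ Inl i" if "y \<in> S" for y i
    using that by (auto simp: S_def nf_def weyl_orbit_def W_Inl)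
  then have "(int (card S) *s x - z) $ Inl i = 0" for i
    by (simp add: z_def)
  then show thesis using hz S \<open>S \<noteq> {}\<close> by (intro that[of "int (card S)" z]) (auto simp: card_gt_0_iff)
qed

text \<open>The kernel of the action on the root lattice modulo \<delta>. Described in this way,
  translations are normal in W without any formula for them.\<close>

definition "transl = {t \<in> W. \<forall>i. \<exists>k. t (\<alpha> i) = \<alpha> i + k *s \<delta>}"

lemma transl_W: "t \<in> transl \<Longrightarrow> t \<in> W"
  by (simp add: transl_def)

lemma transl_root_lattice:
  assumes "t \<in> transl" "\<And>i. x $ Inl i = 0"
  shows "\<exists>k. t x = x + k *s \<delta>"
proof -
  have t: "t \<in> W" using assms(1) by (rule transl_W)
  obtain k where k: "\<And>i. t (\<alpha> i) = \<alpha> i + k i *s \<delta>"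
    using assms(1) by (simp add: transl_def) metis
  have "t x = t (\<Sum>i\<in>UNIV. x $ Inr i *s \<alpha> i)" using root_expand[of x] assms(2) by simp
  also have "\<dots> = (\<Sum>i\<in>UNIV. x $ Inr i *s \<alpha> i) + (\<Sum>i\<in>UNIV. x $ Inr i * k i) *s \<delta>"
    by (simp add: W_sum[OF t] W_scale[OF t] k) (simp add: vec_eq_iff distrib_left sum.distrib sum_distrib_left sum_distrib_right mult_ac)
  also have "(\<Sum>i\<in>UNIV. x $ Inr i *s \<alpha> i) = x" using root_expand[of x] assms(2) by simp
  finally show ?thesis ..
qed

text \<open>A multiple of x is a root lattice element plus a fixed weight, so N (t x - x) is a
  multiple of \<delta>. Then t x - x, which lies in the root lattice, is killed by all coroots and
  is itself a multiple of \<delta>.\<close>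

lemma transl_level0:
  assumes "t \<in> transl" "level x = 0"
  shows "\<exists>k. t x = x + k *s \<delta>"
proof -
  have t: "t \<in> W" using assms(1) by (rule transl_W)
  obtain N z where N: "N > 0" "\<And>i. h i z = 0" "\<And>i. (N *s x - z) $ Inl i = 0"
    using assms(2) by (rule orbit_average) (rule that, assumption+)
  obtain k where "t (N *s x - z) = (N *s x - z) + k *s \<delta>"
    using transl_root_lattice[OF assms(1) N(3)] by blast
  then have eq: "N *s t x = N *s x + k *s \<delta>"
    using W_fixed[OF t N(2)] by (simp add: W_diff[OF t] W_scale[OF t])
  define e where "e = t x - x"
  have Ne: "N *s e = k *s \<delta>" using eq by (simp add: e_def vec_eq_iff right_diff_distrib) 
  have "h i e = 0" for i
    using arg_cong[OF Ne, of "h i"] N(1) by (simp add: coroot_scale)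
  moreover have inl: "e $ Inl i = 0" for i by (simp add: e_def W_Inl[OF t])
  ultimately have "(\<Sum>j\<in>UNIV. A $ i $ j * e $ Inr j) = 0" for i
    using root_coroot[of e i] by simp
  then obtain l where "\<forall>i. e $ Inr i = l * mark i" using null_multiple[of "\<lambda>i. e $ Inr i"] by blast
  then have "e = l *s \<delta>" using inl by (simp add: weight_eq_iff)
  then have "t x = x + l *s \<delta>" by (simp add: e_def algebra_simps)
  then show ?thesis ..
qed

lemma level_W_root: "w \<in> W \<Longrightarrow> level (w (\<alpha> i)) = 0"
  by (simp add: W_level)

lemma transl_conj:
  assumes "t \<in> transl" "w \<in> W"
  shows "invf w \<circ> t \<circ> w \<in> transl"
proof -
  have "\<exists>k. (invf w \<circ> t \<circ> w) (\<alpha> i) = \<alpha> i + k *s \<delta>" for i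
  proof -
    obtain k where "t (w (\<alpha> i)) = w (\<alpha> i) + k *s \<delta>"
      using transl_level0[OF assms(1) level_W_root[OF assms(2)]] by blast
    then have "(invf w \<circ> t \<circ> w) (\<alpha> i) = \<alpha> i + k *s \<delta>"
      using W_inv[OF assms(2)] by (simp add: W_add W_scale W_inv_apply assms(2))
    then show ?thesis ..
  qed
  moreover have "invf w \<circ> t \<circ> w \<in> W"
    by (intro W_comp W_inv assms transl_W)
  ultimately show ?thesis by (simp only: transl_def mem_Collect_eq) blast
qed

text \<open>On simple roots both composites add the same shifts, since \<delta> is fixed; the action
  on roots is faithful.\<close>

lemma transl_comm:
  assumes "t \<in> transl" "u \<in> transl"
  shows "t \<circ> u = u \<circ> t"
proof -
  note W = transl_W[OF assms(1)] transl_W[OF assms(2)]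
  define v where "v = invf (u \<circ> t) \<circ> (t \<circ> u)"
  have ut: "u \<circ> t \<in> W" by (rule W_comp[OF W(2,1)])
  have "v \<in> W" unfolding v_def by (rule W_comp[OF W_inv[OF ut] W_comp[OF W]])
  moreover have "v (\<alpha> i) = \<alpha> i" for i
  proof -
    obtain k where k: "t (\<alpha> i) = \<alpha> i + k *s \<delta>" using assms(1) by (auto simp: transl_def)
    obtain l where l: "u (\<alpha> i) = \<alpha> i + l *s \<delta>" using assms(2) by (auto simp: transl_def)
    have "(t \<circ> u) (\<alpha> i) = (u \<circ> t) (\<alpha> i)"
      using W by (simp add: k l W_add W_scale algebra_simps)
    then show ?thesis using W_inv_apply(1)[OF ut] by (simp only: v_def comp_apply)
  qed
  ultimately have "v = id" by (rule W_fix_roots)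
  then have "invf (u \<circ> t) ((t \<circ> u) x) = x" for x
    unfolding v_def by (metis comp_apply id_apply)
  then have "(t \<circ> u) x = (u \<circ> t) x" for x by (metis W_inv_apply(2)[OF ut])
  then show ?thesis by (rule ext)
qed

text \<open>The sum of all \<open>w rho\<close> over a finite group would be fixed, hence of level
  zero, but its level is the order of the group times the positive \<open>level rho\<close>.\<close>

lemma infinite_W: "infinite W"
proof
  assume fin: "finite W"
  define z where "z = (\<Sum>w\<in>W. w rho)"
  have "h i z = 0" for i
  proof -
    have "s i z = (\<Sum>w\<in>W. (s i \<circ> w) rho)" by (simp add: z_def W_sum[OF W_reflection])
    also have "\<dots> = z"
    proof -
      have "s i \<circ> (s i \<circ> w) = w" for w by auto
      then show ?thesis
        unfolding z_def by (intro sum.reindex_bij_witness[of _ "\<lambda>w. s i \<circ> w" "\<lambda>w. s i \<circ> w"])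
          (simp_all only: W_step)
    qed
    finally have "h i z *s \<alpha> i = 0" by (simp add: simple_reflection_def)
    then show ?thesis using arg_cong[of "h i z *s \<alpha> i" 0 "\<lambda>v. v $ Inr i"] by simp
  qed
  then have "level z = 0" by (simp add: level_eq)
  moreover have "level z = (\<Sum>w\<in>W. level (w rho))"
  proof -
    have "level 0 = 0" by (simp add: level_eq)
    with fin show ?thesis
      unfolding z_def by (induction rule: finite_induct) (simp_all add: level_linear)
  qed
  then have "level z = int (card W) * level rho" by (simp add: W_level)
  moreover have "card W > 0" using fin W_id by (auto simp: card_gt_0_iff)
  ultimately show False using level_rho_pos by simp
qed

text \<open>If all translations fix x they also fix \<open>s i x\<close> by normality, hence the
  root \<open>\<alpha> i\<close>, and by connectedness of the diagram every simple root. Then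
  \<open>transl\<close> is trivial and W embeds into a finite product of level zero orbits modulo
  \<delta>, contrary to its infinity.\<close>

lemma transl_moves:
  assumes "level x = 0" "h i x \<noteq> 0"
  obtains t n where "t \<in> transl" "n \<noteq> 0" "t x = x + n *s \<delta>"
proof -
  have "\<exists>t\<in>transl. t x \<noteq> x"
  proof (rule ccontr)
    assume "\<not> ?thesis"
    then have x: "\<forall>t\<in>transl. t x = x" by blast
    have refl: "\<forall>t\<in>transl. t (s j y) = s j y" if y: "\<forall>t\<in>transl. t y = y" for y j
    proof
      fix t assume "t \<in> transl"
      then have "(invf (s j) \<circ> t \<circ> s j) y = y" using y transl_conj[OF _ W_reflection] by blast
      then have "s j (t (s j y)) = y" by (simp add: reflection_inv)
      then show "t (s j y) = s j y" by (metis reflection_involution)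
    qed
    have root: "\<forall>t\<in>transl. t (\<alpha> j) = \<alpha> j" if y: "\<forall>t\<in>transl. t y = y" "h j y \<noteq> 0" for y j
    proof
      fix t assume t: "t \<in> transl"
      have "t y = y" "t (s j y) = s j y" using t y(1) refl[OF y(1), of j] by blast+
      then have "t (y - s j y) = y - s j y" using t by (simp add: W_diff transl_W)
      then have "h j y *s t (\<alpha> j) = h j y *s \<alpha> j"
        using t by (simp add: simple_reflection_def W_scale transl_W)
      then show "t (\<alpha> j) = \<alpha> j" using y(2) by (simp add: vec_eq_iff)
    qed
    define J where "J = {j. \<forall>t\<in>transl. t (\<alpha> j) = \<alpha> j}"
    have "J = UNIV"
    proof (rule indec)
      show "J \<noteq> {}" using root[OF x assms(2)] by (auto simp: J_def)
      fix j k assume jk: "j \<in> J" "k \<notin> J"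
      show "A $ j $ k = 0"
      proof (rule ccontr)
        assume "A $ j $ k \<noteq> 0"
        then have "h k (\<alpha> j) \<noteq> 0" using zero_sym by auto
        then have "k \<in> J" using root[of "\<alpha> j" k] jk(1) by (auto simp: J_def)
        then show False using jk by simp
      qed
    qed
    then have triv: "t = id" if "t \<in> transl" for t
      using W_fix_roots[OF transl_W[OF that]] that by (auto simp: J_def)
    have "inj_on (\<lambda>w i. nf (w (\<alpha> i))) W"
    proof (rule inj_onI)
      fix v w assume vw: "v \<in> W" "w \<in> W" "(\<lambda>i. nf (v (\<alpha> i))) = (\<lambda>i. nf (w (\<alpha> i)))"
      have "\<exists>k. (invf v \<circ> w) (\<alpha> i) = \<alpha> i + k *s \<delta>" for i
      proof -
        obtain k where "w (\<alpha> i) = v (\<alpha> i) + k *s \<delta>"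
          using nf_eqD fun_cong[OF vw(3), of i] by blast
        then have "(invf v \<circ> w) (\<alpha> i) = \<alpha> i + k *s \<delta>"
          using vw W_inv[OF vw(1)] by (simp add: W_add W_scale W_inv_apply)
        then show ?thesis ..
      qed
      then have "invf v \<circ> w \<in> transl"
        using W_comp[OF W_inv[OF vw(1)] vw(2)] by (simp only: transl_def mem_Collect_eq) blast
      then have "invf v \<circ> w = id" by (rule triv)
      then have "invf v (w x) = x" for x by (metis comp_apply id_apply)
      then show "v = w" using W_inv_apply(2)[OF vw(1)] by (metis ext)
    qed
    moreover have "(\<lambda>w i. nf (w (\<alpha> i))) ` W \<subseteq> (\<Pi>\<^sub>E i\<in>UNIV. nf ` weyl_orbit (\<alpha> i))"
      by (auto simp: weyl_orbit_def)
    moreover have "finite (\<Pi>\<^sub>E i\<in>(UNIV :: 'i set). nf ` weyl_orbit (\<alpha> i))"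
      by (intro finite_PiE finite_orbit_level0) simp_all
    ultimately have "finite W" by (meson finite_imageD finite_subset)
    then show False using infinite_W by simp
  qed
  then obtain t where t: "t \<in> transl" "t x \<noteq> x" by blast
  obtain n where "t x = x + n *s \<delta>" using transl_level0[OF t(1) assms(1)] by blast
  then show thesis using t by (intro that[of t n]) auto
qed

end

section \<open>Cocycles at level zero, and all levels together\<close>

text \<open>What the tensor product contributes, stripped of its construction. \<open>E n\<close>
  stands for e^(n \<delta>). Values lie in a field so that division is possible, while membership in
  the subring R is carried along separately.\<close>

locale twisted_cocycle = affine_cartan A for A :: "int ^ 'i::finite ^ 'i" +
  fixes E :: "int \<Rightarrow> 'k::field" and R :: "'k set" and Y :: "'i weight set"
    and F :: "('i weight \<Rightarrow> 'i weight) \<Rightarrow> 'i weight \<Rightarrow> 'k"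
  assumes E_add: "E (m + n) = E m * E n" and E_eq_1_iff: "E n = 1 \<longleftrightarrow> n = 0"
    and R_zero: "0 \<in> R" and R_diff: "r \<in> R \<Longrightarrow> r' \<in> R \<Longrightarrow> r - r' \<in> R"
    and R_mult: "r \<in> R \<Longrightarrow> r' \<in> R \<Longrightarrow> r * r' \<in> R"
    and R_E: "E n \<in> R" and R_inverse: "n \<noteq> 0 \<Longrightarrow> inverse (E n - 1) \<in> R"
    and two_torsion_free: "r + r = (0 :: 'k) \<Longrightarrow> r = 0"
    and F: "cocycle F"
    and F_twist: "w \<in> W \<Longrightarrow> F w (x + n *s \<delta>) = E (- n) * F w x"
    and F_R: "w \<in> W \<Longrightarrow> F w x \<in> R"
    and F_supp: "w \<in> W \<Longrightarrow> F w x \<noteq> 0 \<Longrightarrow> x \<in> Y"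
    and F_fin: "finite (nf ` {x. F (s i) x \<noteq> 0})"
    and Y_stable: "x \<in> Y \<Longrightarrow> w \<in> W \<Longrightarrow> w x + n *s \<delta> \<in> Y"
    and Y_level: "CARD('i) > 2 \<or> (\<forall>x\<in>Y. \<bar>level x\<bar> < level rho)"
begin

section \<open>Orbits under the Weyl group together with shifts by \<delta>\<close>

definition "ext_orbit x = {w x + n *s \<delta> | w n. w \<in> W}"

lemma ext_orbit_self: "x \<in> ext_orbit x"
  unfolding ext_orbit_def using W_id by (auto intro!: exI[of _ id] exI[of _ 0])

lemma ext_orbit_W: "y \<in> ext_orbit x \<Longrightarrow> w \<in> W \<Longrightarrow> w y + n *s \<delta> \<in> ext_orbit x"
proof -
  assume "y \<in> ext_orbit x" and w: "w \<in> W"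
  then obtain v m where "v \<in> W" "y = v x + m *s \<delta>" by (auto simp: ext_orbit_def)
  then have "w y + n *s \<delta> = (w \<circ> v) x + (m + n) *s \<delta>"
    using w by (simp add: W_add W_scale vscale_add)
  then show ?thesis unfolding ext_orbit_def using W_comp[OF w \<open>v \<in> W\<close>] by blast
qed

lemma ext_orbit_eq: "y \<in> ext_orbit x \<Longrightarrow> ext_orbit y = ext_orbit x"
proof
  assume y: "y \<in> ext_orbit x"
  then obtain v m where v: "v \<in> W" "y = v x + m *s \<delta>" by (auto simp: ext_orbit_def)
  have "invf v y + (- m) *s \<delta> = x"
    using v W_inv[OF v(1)] by (simp add: W_add W_scale W_inv_apply) (simp add: vec_eq_iff)
  then have x: "x \<in> ext_orbit y" using ext_orbit_W[OF ext_orbit_self W_inv[OF v(1)], of y "- m"] by simp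
  show "ext_orbit y \<subseteq> ext_orbit x"
    using ext_orbit_W[OF y] by (auto simp: ext_orbit_def[of y])
  show "ext_orbit x \<subseteq> ext_orbit y"
    using ext_orbit_W[OF x] by (auto simp: ext_orbit_def[of x])
qed

lemma ext_orbit_shift: "ext_orbit (x + n *s \<delta>) = ext_orbit x"
  by (rule ext_orbit_eq) (use ext_orbit_W[OF ext_orbit_self W_id, of x n] in simp)

lemma shift_iff: "y + n *s \<delta> \<in> ext_orbit x \<longleftrightarrow> y \<in> ext_orbit x"
proof
  assume "y + n *s \<delta> \<in> ext_orbit x"
  then have "ext_orbit y = ext_orbit x" using ext_orbit_eq ext_orbit_shift by blast
  then show "y \<in> ext_orbit x" using ext_orbit_self by blast
next
  assume "y \<in> ext_orbit x"
  then show "y + n *s \<delta> \<in> ext_orbit x" using ext_orbit_W[OF _ W_id, of y x n] by simp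
qed

lemma ext_orbit_apply: "w \<in> W \<Longrightarrow> ext_orbit (w x) = ext_orbit x"
  by (rule ext_orbit_eq) (use ext_orbit_W[OF ext_orbit_self, of w x 0] in simp)

lemma ext_orbit_nf: "ext_orbit (nf x) = ext_orbit x"
  using ext_orbit_shift[of "nf x" "qt x"] nf_qt[of x] by simp

lemma ext_orbit_level: "y \<in> ext_orbit x \<Longrightarrow> level y = level x"
proof -
  have "level \<delta> = 0" by (simp add: level_eq)
  then show "y \<in> ext_orbit x \<Longrightarrow> level y = level x"
    by (auto simp: ext_orbit_def level_linear W_level)
qed

lemma nf_ext_orbit: "nf ` ext_orbit x = nf ` weyl_orbit x"
proof
  show "nf ` ext_orbit x \<subseteq> nf ` weyl_orbit x" by (auto simp: ext_orbit_def weyl_orbit_def)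
  have "weyl_orbit x \<subseteq> ext_orbit x"
    unfolding weyl_orbit_def using ext_orbit_W[OF ext_orbit_self, of _ x 0] by auto
  then show "nf ` weyl_orbit x \<subseteq> nf ` ext_orbit x" by blast
qed

lemma F_vanish:
  assumes "\<And>i y. y \<in> ext_orbit x \<Longrightarrow> F (s i) y = 0" and "w \<in> W"
  shows "y \<in> ext_orbit x \<Longrightarrow> F w y = 0"
  using assms(2)
proof (induction arbitrary: y rule: W.induct)
  case W_id
  then show ?case using cocycle_id[OF F] by blast
next
  case (W_step w i)
  have "s i y \<in> ext_orbit x" using ext_orbit_W[OF W_step.prems W_reflection, of i 0] by simp
  moreover have "F (s i \<circ> w) y = F (s i) y + F w (invf (s i) y)"
    by (rule cocycleD[OF F W_reflection W_step.hyps])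
  ultimately show ?case using W_step assms(1) by (simp only: reflection_inv) simp
qed

text \<open>At a fixed weight the cocycle is a homomorphism from a group generated by involutions to
  a group without 2-torsion. No translation moves such a weight, so division by
  \<open>E n - 1\<close> would not help here.\<close>

lemma F_invariant:
  assumes "\<And>i. h i x = 0" "w \<in> W"
  shows "F w x = 0"
  using assms(2)
proof (induction rule: W.induct)
  case W_id
  then show ?case by (rule cocycle_id[OF F])
next
  case (W_step w i)
  have "F (s i \<circ> w) x = F (s i) x + F w (invf (s i) x)"
    by (rule cocycleD[OF F W_reflection W_step.hyps])
  also have "invf (s i) x = x" using assms(1) by (simp only: reflection_inv reflection_fixed)
  finally show ?case
    using W_step.IH cocycle_reflection_fixed[OF F two_torsion_free assms(1)[of i]] by simp
qed

text \<open>At level zero a translation \<open>t\<close> moves \<open>x\<close> to \<open>x + n \<delta>\<close> with \<open>n \<noteq> 0\<close>, and a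
  primitive \<open>g\<close> of \<open>F\<close> is forced by \<open>F t x = (e\<^sup>n\<^sup>\<delta> - 1) g x\<close>. Commutativity
  of the translations makes this independent of \<open>t\<close>.\<close>

lemma level0_primitive:
  obtains g where "\<And>x n. g (x + n *s \<delta>) = E (- n) * g x" "\<And>x. g x \<in> R"
    "\<And>x w. level x = 0 \<Longrightarrow> w \<in> W \<Longrightarrow> F w x = g (invf w x) - g x"
proof -
  define M where "M = {x. level x = 0 \<and> (\<exists>i. h i x \<noteq> 0)}"
  define P where "P = (\<lambda>x p. fst p \<in> transl \<and> snd p \<noteq> 0 \<and> fst p x = x + snd p *s \<delta>)"
  define tn where "tn = (\<lambda>x. SOME p. P x p)"
  \<comment> \<open>The value 0 off M is right at level zero: such weights are fixed by W, and F
    vanishes on them.\<close>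
  define g where "g = (\<lambda>x. if x \<in> M then inverse (E (snd (tn x)) - 1) * F (fst (tn x)) x else 0)"
  have tn: "P x (tn x)" if x: "x \<in> M" for x
  proof -
    obtain i where "level x = 0" "h i x \<noteq> 0" using x by (auto simp: M_def)
    then obtain t n where "t \<in> transl" "n \<noteq> 0" "t x = x + n *s \<delta>" by (rule transl_moves)
    then have "P x (t, n)" by (simp add: P_def)
    then show ?thesis unfolding tn_def by (rule someI)
  qed
  have inv_shift: "invf t x = x - n *s \<delta>" if "t \<in> W" "t x = x + n *s \<delta>" for t x n
    using that W_inv_apply(1)[OF that(1), of "x - n *s \<delta>"] by (simp add: W_diff W_scale)
  have F_shift: "F w (x - n *s \<delta>) = E n * F w x" if "w \<in> W" for w x n
  proof -
    have "x - n *s \<delta> = x + (- n) *s \<delta>" by (simp add: vec_eq_iff)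
    then show ?thesis using F_twist[OF that, of x "- n"] by (simp only: minus_minus)
  qed
  have indep: "(E n - 1) * F u x = (E m - 1) * F t x"
    if "t \<in> transl" "u \<in> transl" "t x = x + n *s \<delta>" "u x = x + m *s \<delta>" for t u x n m
  proof -
    have W: "t \<in> W" "u \<in> W" using that by (auto intro: transl_W)
    have "F t x + F u (invf t x) = F u x + F t (invf u x)"
      using cocycleD[OF F W, of x] cocycleD[OF F W(2,1), of x] transl_comm[OF that(1,2)] by (simp only:)
    then have "F t x + E n * F u x = F u x + E m * F t x"
      by (simp only: inv_shift[OF W(1) that(3)] inv_shift[OF W(2) that(4)] F_shift[OF W(1)] F_shift[OF W(2)])
    then show ?thesis by (simp add: algebra_simps)
  qed
  have g: "(E n - 1) * g x = F t x" if "x \<in> M" "t \<in> transl" "t x = x + n *s \<delta>" for x t n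
  proof -
    have p: "fst (tn x) \<in> transl" "snd (tn x) \<noteq> 0" "fst (tn x) x = x + snd (tn x) *s \<delta>"
      using tn[OF that(1)] by (simp_all add: P_def)
    have "E (snd (tn x)) - 1 \<noteq> 0" using p(2) E_eq_1_iff by simp
    then show ?thesis
      using indep[OF that(2) p(1) that(3) p(3)] that(1) by (simp add: g_def field_simps)
  qed
  have M_shift: "x + n *s \<delta> \<in> M \<longleftrightarrow> x \<in> M" for x n
  proof -
    have "level \<delta> = 0" by (simp add: level_eq)
    then show ?thesis by (simp add: M_def level_linear coroot_linear)
  qed
  have h_zero: "w x = x" if "w \<in> W" "\<And>i. h i x = 0" for w x using W_fixed[OF that] .
  have M_W: "invf w x \<in> M" if "w \<in> W" "x \<in> M" for w x
  proof (rule ccontr)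
    assume *: "invf w x \<notin> M"
    have "level (invf w x) = 0" using that by (simp add: M_def W_level W_inv)
    then have "\<And>i. h i (invf w x) = 0" using * by (simp add: M_def)
    then have "w (invf w x) = invf w x" by (rule h_zero[OF that(1)])
    then have "invf w x = x" by (simp add: W_inv_apply that(1))
    then show False using * that(2) by simp
  qed
  have ne1: "E n - 1 \<noteq> 0" if "n \<noteq> 0" for n using that E_eq_1_iff by simp
  show thesis
  proof (rule that[of g])
    fix x n
    show "g (x + n *s \<delta>) = E (- n) * g x"
    proof (cases "x \<in> M")
      case True
      define t where "t = fst (tn x)"
      define m where "m = snd (tn x)"
      have t: "t \<in> transl" "m \<noteq> 0" "t x = x + m *s \<delta>"
        using tn[OF True] by (simp_all add: P_def t_def m_def)
      have tx: "t (x + n *s \<delta>) = (x + n *s \<delta>) + m *s \<delta>"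
        using t(3) transl_W[OF t(1)] by (simp add: W_add W_scale)
      have "(E m - 1) * g (x + n *s \<delta>) = F t (x + n *s \<delta>)"
        using M_shift True by (intro g[OF _ t(1) tx]) simp
      also have "\<dots> = E (- n) * F t x" by (rule F_twist[OF transl_W[OF t(1)]])
      also have "F t x = (E m - 1) * g x" using g[OF True t(1,3)] by simp
      finally show ?thesis using ne1[OF t(2)] by simp
    qed (simp add: g_def M_shift)
  next
    fix x show "g x \<in> R"
    proof (cases "x \<in> M")
      case True
      then show ?thesis
        using tn[OF True] by (simp add: g_def P_def) (intro R_mult R_inverse F_R transl_W, auto)
    qed (simp add: g_def R_zero)
  next
    fix x w assume x: "level x = 0" and w: "w \<in> W"
    show "F w x = g (invf w x) - g x"
    proof (cases "x \<in> M")
      case True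
      define t where "t = fst (tn x)"
      define n where "n = snd (tn x)"
      have t: "t \<in> transl" "n \<noteq> 0" "t x = x + n *s \<delta>"
        using tn[OF True] by (simp_all add: P_def t_def n_def)
      \<comment> \<open>The conjugate u shifts the preimage of x by the same n. Comparing the
        cocycle along w u = t w gives the wanted identity multiplied by
        \<open>E n - 1\<close>.\<close>
      define u where "u = invf w \<circ> t \<circ> w"
      have u: "u \<in> transl" unfolding u_def by (rule transl_conj[OF t(1) w])
      have ux: "u (invf w x) = invf w x + n *s \<delta>"
        using W_inv[OF w] by (simp add: u_def W_inv_apply w t(3) W_add W_scale)
      have "w \<circ> u = t \<circ> w" by (rule ext) (simp add: u_def W_inv_apply w)
      then have "F w x + F u (invf w x) = F t x + F w (invf t x)"
        using cocycleD[OF F w transl_W[OF u], of x] cocycleD[OF F transl_W[OF t(1)] w, of x] by (simp only:)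
      then have "F w x + F u (invf w x) = F t x + E n * F w x"
        by (simp only: inv_shift[OF transl_W[OF t(1)] t(3)] F_shift[OF w])
      moreover have "F u (invf w x) = (E n - 1) * g (invf w x)"
        by (rule g[OF M_W[OF w True] u ux, symmetric])
      moreover have "F t x = (E n - 1) * g x" by (rule g[OF True t(1,3), symmetric])
      ultimately have "(E n - 1) * F w x = (E n - 1) * (g (invf w x) - g x)"
        by (simp add: algebra_simps)
      then show ?thesis using ne1[OF t(2)] by simp
    next
      case False
      then have hx: "\<And>i. h i x = 0" using x by (simp add: M_def)
      then have "invf w x = x" by (rule h_zero[OF W_inv[OF w]])
      then show ?thesis using F_invariant[OF hx w] by simp
    qed
  qed
qed

definition "primitive_on Z b \<longleftrightarrow> (\<forall>x n. b (x + n *s \<delta>) = E (- n) * b x) \<and> (\<forall>x. b x \<in> R) \<and>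
  finite (nf ` {x. b x \<noteq> 0}) \<and> (\<forall>x. b x \<noteq> 0 \<longrightarrow> x \<in> Z) \<and>
  (\<forall>w\<in>W. \<forall>x\<in>Z. F w x = b (invf w x) - b x)"

text \<open>\<delta> is isotropic, so displacement by k \<delta> changes the norm of z by 2 k times
  the level, and this must vanish within an orbit.\<close>

lemma orbit_shift_unique:
  assumes "level z \<noteq> 0" "w \<in> W" "w z = z + k *s \<delta>"
  shows "k = 0"
proof -
  have "form z (k *s \<delta>) = 0" using form_orbit[OF assms(2), of z] assms(3) by simp
  moreover have "form z (k *s \<delta>) = 2 * of_int k * of_int (level z)"
  proof -
    have "form z (k *s \<delta>) = (\<Sum>i\<in>UNIV. 2 * of_int k * of_int (comark i * h i z))"
      unfolding form_def
    proof (rule sum.cong)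
      fix i
      show "real_of_int (comark i) / of_int (mark i) * of_int ((k *s \<delta>) $ Inr i) * (2 * of_int (h i z) + of_int (h i (k *s \<delta>)))
        = 2 * of_int k * of_int (comark i * h i z)"
        using mark_pos[of i] by (simp add: coroot_scale)
    qed simp
    then show ?thesis by (simp add: level_eq sum_distrib_left)
  qed
  ultimately show "k = 0" using assms(1) by simp
qed

text \<open>At level zero the primitive is restricted to one orbit, which is finite modulo \<delta>.
  At nonzero level the extended orbit consists of disjoint shifts of a Weyl orbit, so a finitely
  supported primitive on one copy extends to all of them by the twist.\<close>

lemma local_primitive:
  assumes x: "x \<in> Y"
  shows "\<exists>b. primitive_on (ext_orbit x) b"
proof (cases "level x = 0")
  case True
  obtain g where g: "\<And>x n. g (x + n *s \<delta>) = E (- n) * g x" "\<And>x. g x \<in> R"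
    "\<And>x w. level x = 0 \<Longrightarrow> w \<in> W \<Longrightarrow> F w x = g (invf w x) - g x"
    by (rule level0_primitive) (rule that, assumption+)
  define b where "b = (\<lambda>y. if y \<in> ext_orbit x then g y else 0)"
  have "primitive_on (ext_orbit x) b"
    unfolding primitive_on_def
  proof (intro conjI allI ballI impI)
    show "b (y + n *s \<delta>) = E (- n) * b y" for y n
    proof -
      have "y + n *s \<delta> \<in> ext_orbit x \<longleftrightarrow> y \<in> ext_orbit x"
        by (rule shift_iff)
      then show ?thesis by (simp add: b_def g(1))
    qed
    show "b y \<in> R" for y by (simp add: b_def g(2) R_zero)
    have "nf ` {y. b y \<noteq> 0} \<subseteq> nf ` weyl_orbit x"
      unfolding nf_ext_orbit[symmetric] by (auto simp: b_def split: if_splits)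
    then show "finite (nf ` {y. b y \<noteq> 0})"
      by (rule finite_subset) (rule finite_orbit_level0[OF True])
    show "y \<in> ext_orbit x" if "b y \<noteq> 0" for y using that by (simp add: b_def split: if_splits)
    show "F w y = b (invf w y) - b y" if "w \<in> W" "y \<in> ext_orbit x" for w y
    proof -
      have "invf w y \<in> ext_orbit x" using ext_orbit_W[OF that(2) W_inv[OF that(1)], of 0] by simp
      moreover have "level y = 0" using ext_orbit_level[OF that(2)] True by simp
      ultimately show ?thesis using g(3)[of y w] that by (simp add: b_def)
    qed
  qed
  then show ?thesis by blast
next
  case False
  have uniq: "m = n" if "y - m *s \<delta> \<in> weyl_orbit x" "y - n *s \<delta> \<in> weyl_orbit x" for y m n
  proof -
    have "y - n *s \<delta> \<in> weyl_orbit (y - m *s \<delta>)" using weyl_orbit_eq[OF that(1)] that(2) by simp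
    then obtain w where w: "w \<in> W" "w (y - m *s \<delta>) = y - n *s \<delta>" by (auto simp: weyl_orbit_def)
    have "y - n *s \<delta> = (y - m *s \<delta>) + (m - n) *s \<delta>" by (simp add: vscale_diff)
    then have eq: "w (y - m *s \<delta>) = (y - m *s \<delta>) + (m - n) *s \<delta>" using w(2) by simp
    have "level (y - m *s \<delta>) = level x" using orbit_level[OF that(1)] .
    then show ?thesis using orbit_shift_unique[OF _ w(1) eq] False by simp
  qed
  \<comment> \<open>This converts support that is finite modulo \<delta> into finite support on the
    orbit, as the one-ended graph argument requires.\<close>
  have inj: "inj_on nf (weyl_orbit x)"
  proof (rule inj_onI)
    fix y z assume yz: "y \<in> weyl_orbit x" "z \<in> weyl_orbit x" "nf y = nf z"
    obtain k where k: "z = y + k *s \<delta>" using nf_eqD[OF yz(3)] by blast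
    have "k = 0" using uniq[of z k 0] yz k by simp
    then show "y = z" using k by simp
  qed
  have "\<exists>b. finite_primitive R F (weyl_orbit x) b"
  proof (rule orbit_coboundary[OF F two_torsion_free False _ _ R_zero R_diff F_R])
    show "CARD('i) > 2 \<or> \<bar>level x\<bar> < level rho" using Y_level x by blast
    show "finite {y \<in> weyl_orbit x. F (s i) y \<noteq> 0}" for i
    proof (rule inj_on_finite[of nf])
      show "inj_on nf {y \<in> weyl_orbit x. F (s i) y \<noteq> 0}" by (rule inj_on_subset[OF inj]) auto
    qed (use F_fin[of i] in auto)
  qed
  then obtain b0 where b0: "finite {y. b0 y \<noteq> 0}" "\<And>y. b0 y \<in> R" "\<And>y. b0 y \<noteq> 0 \<Longrightarrow> y \<in> weyl_orbit x"
    "\<And>w y. w \<in> W \<Longrightarrow> y \<in> weyl_orbit x \<Longrightarrow> F w y = b0 (invf w y) - b0 y"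
    unfolding finite_primitive_def by blast
  define sh where "sh = (\<lambda>y. THE n. y - n *s \<delta> \<in> weyl_orbit x)"
  have sh: "sh (z + n *s \<delta>) = n" if "z \<in> weyl_orbit x" for z n
    unfolding sh_def by (rule the_equality) (use that uniq[of "z + n *s \<delta>" _ n] in auto)
  define b where "b = (\<lambda>y. if y \<in> ext_orbit x then E (- sh y) * b0 (y - sh y *s \<delta>) else 0)"
  have decomp: "\<exists>z n. z \<in> weyl_orbit x \<and> y = z + n *s \<delta>" if "y \<in> ext_orbit x" for y
    using that by (auto simp: ext_orbit_def weyl_orbit_def)
  have ext: "z + n *s \<delta> \<in> ext_orbit x" if "z \<in> weyl_orbit x" for z n
    using that by (auto simp: ext_orbit_def weyl_orbit_def)
  have b: "b (z + n *s \<delta>) = E (- n) * b0 z" if "z \<in> weyl_orbit x" for z n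
    by (simp add: b_def ext[OF that] sh[OF that])
  have "primitive_on (ext_orbit x) b"
    unfolding primitive_on_def
  proof (intro conjI allI ballI impI)
    show "b (y + n *s \<delta>) = E (- n) * b y" for y n
    proof (cases "y \<in> ext_orbit x")
      case True
      then obtain z m where z: "z \<in> weyl_orbit x" "y = z + m *s \<delta>" using decomp by blast
      have "y + n *s \<delta> = z + (m + n) *s \<delta>" by (simp add: z vscale_add)
      then have "b (y + n *s \<delta>) = E (- (m + n)) * b0 z" by (simp only: b[OF z(1)])
      also have "E (- (m + n)) = E (- n) * E (- m)" using E_add[of "- n" "- m"] by (simp add: algebra_simps)
      finally show ?thesis using b[OF z(1), of m] z(2) by simp
    next
      case no: False
      then have "y + n *s \<delta> \<notin> ext_orbit x" by (simp only: shift_iff not_False_eq_True)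
      then show ?thesis using no by (simp add: b_def)
    qed
    show "b y \<in> R" for y by (simp add: b_def R_zero R_mult R_E b0(2))
    have "nf ` {y. b y \<noteq> 0} \<subseteq> nf ` {y. b0 y \<noteq> 0}"
    proof
      fix u assume "u \<in> nf ` {y. b y \<noteq> 0}"
      then obtain y where y: "u = nf y" "b y \<noteq> 0" by blast
      then have "y \<in> ext_orbit x" by (simp add: b_def split: if_splits)
      then obtain z m where z: "z \<in> weyl_orbit x" "y = z + m *s \<delta>" using decomp by blast
      then have "b0 z \<noteq> 0" using y(2) b[OF z(1), of m] by auto
      then show "u \<in> nf ` {y. b0 y \<noteq> 0}" using y(1) z(2) by simp
    qed
    then show "finite (nf ` {y. b y \<noteq> 0})" by (rule finite_subset) (intro finite_imageI b0(1))
    show "y \<in> ext_orbit x" if "b y \<noteq> 0" for y using that by (simp add: b_def split: if_splits)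
    show "F w y = b (invf w y) - b y" if w: "w \<in> W" and y: "y \<in> ext_orbit x" for w y
    proof -
      obtain z m where z: "z \<in> weyl_orbit x" "y = z + m *s \<delta>" using decomp y by blast
      have "invf w y = invf w z + m *s \<delta>" using W_inv[OF w] by (simp add: z(2) W_add W_scale)
      then have "b (invf w y) = E (- m) * b0 (invf w z)" using b[OF orbit_W[OF z(1) W_inv[OF w]]] by simp
      moreover have "F w y = E (- m) * F w z" unfolding z(2) by (rule F_twist[OF w])
      ultimately show ?thesis using b[OF z(1), of m] b0(4)[OF w z(1)] z(2) by (simp add: algebra_simps)
    qed
  qed
  then show ?thesis by blast
qed

text \<open>There are finitely many simple reflections, each with a value supported on finitely many
  classes modulo \<delta>; only the finitely many extended orbits meeting these supports need a
  nonzero primitive. On all other orbits the cocycle relation makes F vanish.\<close>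

lemma primitive_exists: "\<exists>b. primitive_on Y b \<and> (\<forall>w\<in>W. \<forall>x. F w x = b (invf w x) - b x)"
proof -
  define \<O> where "\<O> = ext_orbit ` (\<Union>i. {x. F (s i) x \<noteq> 0})"
  have "\<O> = ext_orbit ` (\<Union>i. nf ` {x. F (s i) x \<noteq> 0})"
    by (simp add: \<O>_def image_UN image_image ext_orbit_nf)
  moreover have "finite (\<Union>i. nf ` {x. F (s i) x \<noteq> 0})"
    by (intro finite_UN_I) (simp_all add: F_fin)
  ultimately have "finite \<O>" by (simp only:) (rule finite_imageI)
  define bb where "bb = (\<lambda>Z. SOME b. primitive_on Z b)"
  have bb: "primitive_on Z (bb Z)" if Z: "Z \<in> \<O>" for Z
  proof -
    obtain i x where "Z = ext_orbit x" "F (s i) x \<noteq> 0" using Z by (auto simp: \<O>_def)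
    then have "\<exists>b. primitive_on Z b" using local_primitive F_supp[OF W_reflection] by blast
    then show ?thesis unfolding bb_def by (rule someI_ex)
  qed
  define b where "b = (\<lambda>y. if ext_orbit y \<in> \<O> then bb (ext_orbit y) y else 0)"
  have cob: "F w x = b (invf w x) - b x" if w: "w \<in> W" for w x
  proof (cases "ext_orbit x \<in> \<O>")
    case True
    have "F w x = bb (ext_orbit x) (invf w x) - bb (ext_orbit x) x"
      using bb[OF True] w ext_orbit_self[of x] unfolding primitive_on_def by blast
    then show ?thesis using True by (simp add: b_def ext_orbit_apply[OF W_inv[OF w]])
  next
    case False
    have "F (s i) y = 0" if "y \<in> ext_orbit x" for i y
    proof (rule ccontr)
      assume "F (s i) y \<noteq> 0"
      then have "ext_orbit y \<in> \<O>" by (auto simp: \<O>_def)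
      then show False using False ext_orbit_eq[OF that] by simp
    qed
    then have "F w x = 0" using F_vanish[OF _ w ext_orbit_self] by blast
    then show ?thesis using False by (simp add: b_def ext_orbit_apply[OF W_inv[OF w]])
  qed
  have "primitive_on Y b"
    unfolding primitive_on_def
  proof (intro conjI allI ballI impI)
    show "b (y + n *s \<delta>) = E (- n) * b y" for y n
      using bb[of "ext_orbit y"] by (simp add: b_def ext_orbit_shift primitive_on_def)
    show "b y \<in> R" for y
      using bb[of "ext_orbit y"] by (simp add: b_def primitive_on_def R_zero)
    have "nf ` {y. b y \<noteq> 0} \<subseteq> (\<Union>Z\<in>\<O>. nf ` {y. bb Z y \<noteq> 0})"
      by (auto simp: b_def split: if_splits)
    moreover have "finite (\<Union>Z\<in>\<O>. nf ` {y. bb Z y \<noteq> 0})"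
      using bb \<open>finite \<O>\<close> by (intro finite_UN_I) (auto simp: primitive_on_def)
    ultimately show "finite (nf ` {y. b y \<noteq> 0})" by (rule finite_subset)
    show "y \<in> Y" if y: "b y \<noteq> 0" for y
    proof -
      have "ext_orbit y \<in> \<O>" using y by (simp add: b_def split: if_splits)
      then obtain i x where x: "ext_orbit y = ext_orbit x" "F (s i) x \<noteq> 0" by (auto simp: \<O>_def)
      then have "x \<in> Y" using F_supp[OF W_reflection] by blast
      have "y \<in> ext_orbit x" using ext_orbit_self x(1) by blast
      then show ?thesis using Y_stable[OF \<open>x \<in> Y\<close>] by (auto simp: ext_orbit_def)
    qed
    show "F w x = b (invf w x) - b x" if "w \<in> W" for w x using cob[OF that] .
  qed
  then show ?thesis using cob by blast
qed

end

section \<open>The tensor product as a module of functions\<close>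

lemma minus_ring_of_type_algebra:
  "\<ominus>\<^bsub>ring_of_type_algebra\<^esub> x = - (x :: 'a::comm_ring_1)"
proof -
  interpret ring "ring_of_type_algebra :: 'a ring" by (rule ring_from_type_algebra)
  show ?thesis by (rule minus_equality) (simp_all add: ring_of_type_algebra_def)
qed

lemma R_one: "1 \<in> R_set"
  using generate_ring.one[of ring_of_type_algebra] unfolding R_set_def by (simp add: ring_of_type_algebra_def)

lemma R_uminus: "r \<in> R_set \<Longrightarrow> - r \<in> R_set"
  unfolding R_set_def by (drule generate_ring.a_inv) (simp add: minus_ring_of_type_algebra)

lemma R_add: "r \<in> R_set \<Longrightarrow> r' \<in> R_set \<Longrightarrow> r + r' \<in> R_set"
  unfolding R_set_def by (drule (1) generate_ring.eng_add) (simp add: ring_of_type_algebra_def)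

lemma R_times: "r \<in> R_set \<Longrightarrow> r' \<in> R_set \<Longrightarrow> r * r' \<in> R_set"
  unfolding R_set_def by (drule (1) generate_ring.eng_mult) (simp add: ring_of_type_algebra_def)

lemma R_minus: "r \<in> R_set \<Longrightarrow> r' \<in> R_set \<Longrightarrow> r - r' \<in> R_set"
  using R_add[of r "- r'"] R_uminus[of r'] by simp

lemma R_null: "0 \<in> R_set"
  using R_minus[OF R_one R_one] by simp

lemma exp_delta_add: "exp_delta (m + n) = exp_delta m * exp_delta n"
  by (simp add: exp_delta_def mult_single)

lemma exp_delta_eq_1_iff: "exp_delta n = 1 \<longleftrightarrow> n = 0"
proof -
  have "exp_delta n = 1 \<longleftrightarrow> Poly_Mapping.single n 1 = (1 :: laurent)"
    by (simp add: exp_delta_def One_fract_def eq_fract)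
  also have "\<dots> \<longleftrightarrow> n = 0"
    by (metis frag_of_eq single_one)
  finally show ?thesis .
qed

lemma exp_delta_0: "exp_delta 0 = 1"
  by (simp add: exp_delta_eq_1_iff)

lemma R_exp_delta: "exp_delta n \<in> R_set"
proof -
  have gen: "exp_delta 1 \<in> R_set" "exp_delta (-1) \<in> R_set"
    unfolding R_set_def by (auto intro: generate_ring.incl)
  show ?thesis
  proof (induction n rule: int_induct[where k = 0])
    case (step1 i)
    then show ?case using R_times[OF step1(2) gen(1)] by (simp add: exp_delta_add)
  next
    case (step2 i)
    then show ?case using R_times[OF step2(2) gen(2)] exp_delta_add[of i "-1"] by simp
  qed (simp add: exp_delta_0 R_one)
qed

lemma R_inverse_exp_delta: "n \<noteq> 0 \<Longrightarrow> inverse (exp_delta n - 1) \<in> R_set"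
  unfolding R_set_def by (intro generate_ring.incl) blast

lemma Fract_diff: "Fract (a - b) 1 = Fract a 1 - Fract b (1 :: 'a::idom)"
  by simp

lemma R_laurent: "Fract p 1 \<in> R_set" for p :: laurent
  using subset_UNIV[of "Poly_Mapping.keys p"]
proof (induction p rule: frag_induction)
  case zero
  then show ?case using R_null by (simp add: Zero_fract_def)
next
  case (one n)
  then show ?case using R_exp_delta[of n] by (simp add: exp_delta_def)
next
  case (diff a b)
  then show ?case by (simp only: Fract_diff R_minus)
qed

lemma R_of_int: "of_int n \<in> R_set"
proof (induction n rule: int_induct[where k = 0])
  case (step1 i) then show ?case using R_add[OF _ R_one] by simp
next
  case (step2 i) then show ?case using R_minus[OF _ R_one] by simp
qed (simp add: R_null)

lemma R_sum: "(\<And>i. i \<in> S \<Longrightarrow> f i \<in> R_set) \<Longrightarrow> sum f S \<in> R_set"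
  by (induction S rule: infinite_finite_induct) (auto simp: R_null R_add)

lemma fract_two_torsion_free: "r + r = 0 \<Longrightarrow> r = 0" for r :: "laurent fract"
proof -
  assume "r + r = 0"
  then have "2 * r = 0" by simp
  moreover have "(2 :: laurent fract) \<noteq> 0"
  proof -
    have "(2 :: laurent fract) = Fract (1 + 1) 1"
      by (simp only: one_add_one[symmetric] One_fract_def add_fract[OF one_neq_zero one_neq_zero] mult_1_right)
    moreover have "Fract (1 + 1) 1 \<noteq> (0 :: laurent fract)"
      by (simp add: Zero_fract_def eq_fract)
    ultimately show ?thesis by simp
  qed
  ultimately show "r = 0" by simp
qed

section \<open>Linear extension from a free abelian group to a ring\<close>

definition lin_ext :: "('a \<Rightarrow> 'b::comm_ring_1) \<Rightarrow> ('a \<Rightarrow>\<^sub>0 int) \<Rightarrow> 'b" where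
  "lin_ext f p = (\<Sum>k\<in>Poly_Mapping.keys p. of_int (Poly_Mapping.lookup p k) * f k)"

lemma lin_ext_superset:
  "finite S \<Longrightarrow> Poly_Mapping.keys p \<subseteq> S \<Longrightarrow> lin_ext f p = (\<Sum>k\<in>S. of_int (Poly_Mapping.lookup p k) * f k)"
  unfolding lin_ext_def by (rule sum.mono_neutral_left) (auto simp: in_keys_iff)

lemma lin_ext_diff: "lin_ext f (p - q) = lin_ext f p - lin_ext f q"
proof -
  let ?S = "Poly_Mapping.keys p \<union> Poly_Mapping.keys q"
  have "lin_ext f (p - q) = (\<Sum>k\<in>?S. of_int (Poly_Mapping.lookup (p - q) k) * f k)"
    by (rule lin_ext_superset) (auto simp: keys_diff)
  also have "\<dots> = (\<Sum>k\<in>?S. of_int (Poly_Mapping.lookup p k) * f k) - (\<Sum>k\<in>?S. of_int (Poly_Mapping.lookup q k) * f k)"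
    by (simp add: lookup_minus left_diff_distrib sum_subtractf)
  finally show ?thesis by (simp add: lin_ext_superset[of ?S])
qed

lemma lin_ext_zero [simp]: "lin_ext f 0 = 0"
  by (simp add: lin_ext_def)

lemma lin_ext_minus: "lin_ext f (- p) = - lin_ext f p"
  using lin_ext_diff[of f 0 p] by simp

lemma lin_ext_add: "lin_ext f (p + q) = lin_ext f p + lin_ext f q"
  using lin_ext_diff[of f p "- q"] by (simp add: lin_ext_minus)

lemma lin_ext_sum: "lin_ext f (\<Sum>i\<in>S. g i) = (\<Sum>i\<in>S. lin_ext f (g i))"
  by (induction S rule: infinite_finite_induct) (auto simp: lin_ext_add)

lemma lin_ext_frag_of [simp]: "lin_ext f (frag_of x) = f x"
  by (simp add: lin_ext_def)

lemma lin_ext_frag_extend: "lin_ext f (frag_extend g p) = lin_ext (\<lambda>x. lin_ext f (g x)) p"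
  using subset_UNIV[of "Poly_Mapping.keys p"]
  by (induction p rule: frag_induction) (auto simp: frag_extend_diff lin_ext_diff)

lemma lin_ext_nonzero: "lin_ext f p \<noteq> 0 \<Longrightarrow> \<exists>k\<in>Poly_Mapping.keys p. f k \<noteq> 0"
  unfolding lin_ext_def by (metis (no_types, lifting) mult_zero_right sum.neutral)

lemma frag_cmul_frag_of: "frag_cmul c (frag_of x) = Poly_Mapping.single x c"
  by (rule poly_mapping_eqI) (simp add: lookup_single when_def)

lemma laurent_embed_frag: "laurent_embed d p = frag_extend (\<lambda>k. frag_of (k *s d)) p"
  by (simp add: laurent_embed_def frag_extend_def frag_cmul_frag_of)

lemma weyl_act_frag: "weyl_act w p = frag_extend (\<lambda>x. frag_of (w x)) p"
  by (simp add: weyl_act_def frag_extend_def frag_cmul_frag_of)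

locale weight_tensor = affine_cartan A for A :: "int ^ 'i::finite ^ 'i" +
  fixes Y :: "'i weight set"
  assumes Y_stable: "x \<in> Y \<Longrightarrow> w \<in> W \<Longrightarrow> w x + n *s \<delta> \<in> Y"
begin

lemma Y_shift: "x \<in> Y \<Longrightarrow> x + n *s \<delta> \<in> Y"
  using Y_stable[OF _ W_id, of x n] by simp

lemma Y_W: "x \<in> Y \<Longrightarrow> w \<in> W \<Longrightarrow> w x \<in> Y"
  using Y_stable[of x w 0] by simp

lemma Y_nf: "x \<in> Y \<Longrightarrow> nf x \<in> Y"
proof -
  have "nf x = x + (- qt x) *s \<delta>" by (simp add: nf_def vec_eq_iff)
  then show "x \<in> Y \<Longrightarrow> nf x \<in> Y" using Y_shift by (simp only:)
qed

section \<open>The relations that define the tensor product\<close>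

definition "Wm = {p :: 'i weight \<Rightarrow>\<^sub>0 int. Poly_Mapping.keys p \<subseteq> Y}"
abbreviation "FR \<equiv> tensor_free R_module (weight_module A Y)"
abbreviation "Kn \<equiv> tensor_kernel (ring_of_type_algebra :: laurent ring) R_module (weight_module A Y)"
abbreviation "Rl \<equiv> tensor_relators (ring_of_type_algebra :: laurent ring) R_module (weight_module A Y)"
abbreviation "T \<equiv> tensor_product (ring_of_type_algebra :: laurent ring) R_module (weight_module A Y)"

lemma Wm_add: "p \<in> Wm \<Longrightarrow> q \<in> Wm \<Longrightarrow> p + q \<in> Wm"
  unfolding Wm_def using keys_add by fastforce

lemma Wm_diff: "p \<in> Wm \<Longrightarrow> q \<in> Wm \<Longrightarrow> p - q \<in> Wm"
  unfolding Wm_def using keys_diff by fastforce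

lemma Wm_frag_of: "frag_of x \<in> Wm \<longleftrightarrow> x \<in> Y"
  by (simp add: Wm_def)

lemma Wm_embed: "p \<in> Wm \<Longrightarrow> laurent_embed \<delta> l * p \<in> Wm"
proof -
  assume p: "p \<in> Wm"
  have "Poly_Mapping.keys (laurent_embed \<delta> l * p) \<subseteq> {a + b | a b.
      a \<in> Poly_Mapping.keys (laurent_embed \<delta> l) \<and> b \<in> Poly_Mapping.keys p}"
    by (rule keys_mult)
  moreover have "Poly_Mapping.keys (laurent_embed \<delta> l) \<subseteq> range (\<lambda>k. k *s \<delta>)"
    unfolding laurent_embed_frag by (rule order_trans[OF keys_frag_extend]) auto
  ultimately show ?thesis
    using p Y_shift by (fastforce simp: Wm_def add.commute)
qed

lemma carrier_FR: "z \<in> carrier FR \<longleftrightarrow> Poly_Mapping.keys z \<subseteq> R_set \<times> Wm"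
  by (simp add: tensor_free_def R_module_def weight_module_def Wm_def)

lemma group_FR: "group FR" and comm_group_FR: "comm_group FR"
  by (simp_all add: tensor_free_def abelian_free_Abelian_group)

lemma mult_FR [simp]: "x \<otimes>\<^bsub>FR\<^esub> y = x + y" and one_FR [simp]: "\<one>\<^bsub>FR\<^esub> = 0"
  by (simp_all add: tensor_free_def)

lemma inv_FR: "x \<in> carrier FR \<Longrightarrow> inv\<^bsub>FR\<^esub> x = - x"
  by (simp add: tensor_free_def)

lemma FR_diff: "x \<in> carrier FR \<Longrightarrow> y \<in> carrier FR \<Longrightarrow> x - y \<in> carrier FR"
  unfolding carrier_FR using keys_diff by (meson Un_least order_trans)

lemma Rl_eq: "Rl =
     {frag_of (x + x', y) - frag_of (x, y) - frag_of (x', y) | x x' y.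
        x \<in> R_set \<and> x' \<in> R_set \<and> y \<in> Wm} \<union>
     {frag_of (x, y + y') - frag_of (x, y) - frag_of (x, y') | x y y'.
        x \<in> R_set \<and> y \<in> Wm \<and> y' \<in> Wm} \<union>
     {frag_of (Fract l 1 * x, y) - frag_of (x, laurent_embed \<delta> l * y) | l x y.
        x \<in> R_set \<and> y \<in> Wm}"
  by (simp add: tensor_relators_def R_module_def weight_module_def Wm_def ring_of_type_algebra_def)

lemma FR_frag_of: "frag_of (r, p) \<in> carrier FR \<longleftrightarrow> r \<in> R_set \<and> p \<in> Wm"
  by (simp add: carrier_FR)

lemma Rl_FR: "Rl \<subseteq> carrier FR"
  unfolding Rl_eq
  by (auto intro!: FR_diff simp: FR_frag_of R_add R_times R_laurent Wm_add Wm_embed simp del: carrier_FR)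

lemma subgroup_Kn: "subgroup Kn FR"
  unfolding tensor_kernel_def by (rule group.generate_is_subgroup[OF group_FR Rl_FR])

lemma Kn_FR: "z \<in> Kn \<Longrightarrow> z \<in> carrier FR"
  using subgroup.subset[OF subgroup_Kn] by blast

lemma Kn_zero: "0 \<in> Kn"
  using subgroup.one_closed[OF subgroup_Kn] by simp

lemma Kn_add: "x \<in> Kn \<Longrightarrow> y \<in> Kn \<Longrightarrow> x + y \<in> Kn"
  using subgroup.m_closed[OF subgroup_Kn] by simp

lemma Kn_minus: "x \<in> Kn \<Longrightarrow> - x \<in> Kn"
  using subgroup.m_inv_closed[OF subgroup_Kn, of x] by (simp add: inv_FR Kn_FR)

lemma Kn_diff: "x \<in> Kn \<Longrightarrow> y \<in> Kn \<Longrightarrow> x - y \<in> Kn"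
  using Kn_add[OF _ Kn_minus, of x y] by simp

lemma Kn_sum: "(\<And>i. i \<in> S \<Longrightarrow> f i \<in> Kn) \<Longrightarrow> sum f S \<in> Kn"
  by (induction S rule: infinite_finite_induct) (auto simp: Kn_zero Kn_add)

lemma Kn_Rl: "z \<in> Rl \<Longrightarrow> z \<in> Kn"
  unfolding tensor_kernel_def by (rule generate.incl)

lemma Kn_left: "x \<in> R_set \<Longrightarrow> x' \<in> R_set \<Longrightarrow> y \<in> Wm \<Longrightarrow>
    frag_of (x + x', y) - frag_of (x, y) - frag_of (x', y) \<in> Kn"
  by (rule Kn_Rl) (auto simp: Rl_eq)

lemma Kn_right: "x \<in> R_set \<Longrightarrow> y \<in> Wm \<Longrightarrow> y' \<in> Wm \<Longrightarrow>
    frag_of (x, y + y') - frag_of (x, y) - frag_of (x, y') \<in> Kn"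
  by (rule Kn_Rl) (auto simp: Rl_eq)

lemma Kn_smult: "x \<in> R_set \<Longrightarrow> y \<in> Wm \<Longrightarrow>
    frag_of (Fract l 1 * x, y) - frag_of (x, laurent_embed \<delta> l * y) \<in> Kn"
  by (rule Kn_Rl) (auto simp: Rl_eq)

lemma Kn_left_zero: "y \<in> Wm \<Longrightarrow> frag_of (0, y) \<in> Kn"
  using Kn_minus[OF Kn_left[OF R_null R_null, of y]] by simp

lemma Kn_left_diff:
  assumes "x \<in> R_set" "x' \<in> R_set" "y \<in> Wm"
  shows "frag_of (x - x', y) - (frag_of (x, y) - frag_of (x', y)) \<in> Kn"
  using Kn_minus[OF Kn_left[OF R_minus[OF assms(1,2)] assms(2,3)]] by (simp add: algebra_simps)

lemma Kn_right_zero: "x \<in> R_set \<Longrightarrow> frag_of (x, 0) \<in> Kn"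
  using Kn_minus[OF Kn_right[of x 0 0]] by (simp add: Wm_def)

lemma Kn_right_diff:
  assumes "x \<in> R_set" "y \<in> Wm" "y' \<in> Wm"
  shows "frag_of (x, y - y') - (frag_of (x, y) - frag_of (x, y')) \<in> Kn"
  using Kn_minus[OF Kn_right[OF assms(1) Wm_diff[OF assms(2,3)] assms(3)]] by (simp add: algebra_simps)

text \<open>\<open>Psi z\<close> is the function on weights that represents the tensor \<open>z\<close>: its value at \<open>y\<close> is the
  coefficient of \<open>e\<^sup>y\<close> when \<open>z\<close> is expanded over \<open>R\<close> in representatives, including \<open>y\<close>, of the weights
  modulo \<open>\<delta>\<close>.\<close>

definition "eps x y = (if nf x = nf y then exp_delta (qt x - qt y) else 0)"
definition "iota p y = lin_ext (\<lambda>x. eps x y) p"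
definition "Psi z y = lin_ext (\<lambda>(r, p). r * iota p y) z"

lemma eps_shift: "eps x (x + k *s \<delta>) = exp_delta (- k)"
  by (simp add: eps_def qt_add)

lemma eps_shift_right: "eps x (y + k *s \<delta>) = exp_delta (- k) * eps x y"
  by (simp add: eps_def qt_add exp_delta_add[symmetric] algebra_simps)

lemma eps_shift_left: "eps (k *s \<delta> + x) y = exp_delta k * eps x y"
  unfolding add.commute[of "k *s \<delta>"] by (simp add: eps_def qt_add exp_delta_add[symmetric] algebra_simps)

text \<open>Neither \<open>nf\<close> nor \<open>qt\<close> commutes with W, but \<open>eps\<close>
  depends only on the multiple of \<delta> by which its arguments differ, and W fixes
  \<delta>.\<close>

lemma eps_W: "w \<in> W \<Longrightarrow> eps (w x) y = eps x (invf w y)"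
proof -
  assume w: "w \<in> W"
  show ?thesis
  proof (cases "\<exists>k. y = w x + k *s \<delta>")
    case True
    then obtain k where k: "y = w x + k *s \<delta>" ..
    then have "invf w y = x + k *s \<delta>" using W_inv[OF w] by (simp add: W_add W_scale W_inv_apply w)
    then show ?thesis by (simp add: k eps_shift)
  next
    case False
    then have "nf (w x) \<noteq> nf y" using nf_eqD by blast
    moreover have "nf x \<noteq> nf (invf w y)"
    proof
      assume "nf x = nf (invf w y)"
      then obtain k where "invf w y = x + k *s \<delta>" using nf_eqD by blast
      then have "w (invf w y) = w x + k *s \<delta>" using w by (simp add: W_add W_scale)
      then have "y = w x + k *s \<delta>" by (simp only: W_inv_apply(2)[OF w])
      then show False using False by blast
    qed
    ultimately show ?thesis by (simp add: eps_def)
  qed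
qed

lemma R_eps: "eps x y \<in> R_set"
  by (simp add: eps_def R_exp_delta R_null)

lemma iota_embed: "iota (laurent_embed \<delta> l * p) y = Fract l 1 * iota p y"
  using subset_UNIV[of "Poly_Mapping.keys l"]
proof (induction l rule: frag_induction)
  case zero
  then show ?case by (simp add: laurent_embed_frag iota_def Zero_fract_def[symmetric])
next
  case (one k)
  have "iota (frag_of (k *s \<delta>) * p) y = exp_delta k * iota p y"
    using subset_UNIV[of "Poly_Mapping.keys p"]
  proof (induction p rule: frag_induction)
    case (one x)
    then show ?case by (simp add: iota_def mult_single eps_shift_left)
  next
    case (diff a b)
    then show ?case by (simp add: iota_def lin_ext_diff right_diff_distrib)
  qed (simp add: iota_def)
  then show ?case by (simp add: laurent_embed_frag exp_delta_def)
next
  case (diff a b)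
  have "laurent_embed \<delta> (a - b) * p = laurent_embed \<delta> a * p - laurent_embed \<delta> b * p"
    by (simp add: laurent_embed_frag frag_extend_diff left_diff_distrib)
  then have "iota (laurent_embed \<delta> (a - b) * p) y = iota (laurent_embed \<delta> a * p) y - iota (laurent_embed \<delta> b * p) y"
    by (simp add: iota_def lin_ext_diff)
  then show ?case unfolding diff Fract_diff by (simp only: left_diff_distrib)
qed

lemma iota_add: "iota (p + q) y = iota p y + iota q y"
  by (simp add: iota_def lin_ext_add)

lemma Psi_diff: "Psi (a - b) y = Psi a y - Psi b y"
  by (simp add: Psi_def lin_ext_diff)

lemma Psi_add: "Psi (a + b) y = Psi a y + Psi b y"
  by (simp add: Psi_def lin_ext_add)

lemma Psi_frag_of [simp]: "Psi (frag_of (r, p)) y = r * iota p y"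
  by (simp add: Psi_def)

lemma Psi_Kn: "z \<in> Kn \<Longrightarrow> Psi z y = 0"
proof -
  have rl: "Psi z y = 0" if z: "z \<in> Rl" for z
  proof -
    consider (left) r r' p where "z = frag_of (r + r', p) - frag_of (r, p) - frag_of (r', p)"
      | (right) r p p' where "z = frag_of (r, p + p') - frag_of (r, p) - frag_of (r, p')"
      | (smult) l r p where "z = frag_of (Fract l 1 * r, p) - frag_of (r, laurent_embed \<delta> l * p)"
      using z unfolding Rl_eq by blast
    then show ?thesis
    proof cases
      case left
      show ?thesis unfolding left by (simp add: Psi_diff distrib_right)
    next
      case right
      show ?thesis unfolding right by (simp add: Psi_diff iota_add distrib_left)
    next
      case smult
      show ?thesis unfolding smult Psi_diff Psi_frag_of iota_embed by (simp add: mult.left_commute mult.assoc)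
    qed
  qed
  show "z \<in> Kn \<Longrightarrow> Psi z y = 0"
    unfolding tensor_kernel_def
  proof (induction rule: generate.induct)
    case one
    then show ?case by (simp add: Psi_def)
  next
    case (incl z)
    then show ?case by (rule rl)
  next
    case (inv z)
    then have "inv\<^bsub>FR\<^esub> z = 0 - z" using Rl_FR by (simp add: inv_FR subset_iff)
    then show ?case using rl[OF inv] by (simp only: Psi_diff) (simp add: Psi_def)
  next
    case (eng a b)
    then show ?case by (simp add: Psi_add)
  qed
qed

text \<open>The tensor rewritten as an R-combination of the basis weights in L, with coefficients
  read off by \<open>Psi\<close>.\<close>

definition "nform L z = (\<Sum>x\<in>L. frag_of (Psi z x, frag_of x))"

lemma iota_R: "iota p y \<in> R_set"
  unfolding iota_def lin_ext_def by (intro R_sum R_times R_of_int R_eps)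

lemma Psi_R: "z \<in> carrier FR \<Longrightarrow> Psi z y \<in> R_set"
  unfolding Psi_def lin_ext_def carrier_FR
  by (intro R_sum R_times R_of_int) (auto intro!: R_times iota_R)

lemma Kn_swap: "a - b \<in> Kn \<Longrightarrow> b - a \<in> Kn"
  using Kn_minus[of "a - b"] by simp

lemma Kn_trans: "a - b \<in> Kn \<Longrightarrow> b - c \<in> Kn \<Longrightarrow> a - c \<in> Kn"
  using Kn_add[of "a - b" "b - c"] by simp

lemma nform_diff:
  assumes "L \<subseteq> Y" "a \<in> carrier FR" "b \<in> carrier FR" "a - nform L a \<in> Kn" "b - nform L b \<in> Kn"
  shows "(a - b) - nform L (a - b) \<in> Kn"
proof -
  have 1: "(a - b) - (nform L a - nform L b) \<in> Kn"
    using Kn_diff[OF assms(4,5)] by (simp add: algebra_simps)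
  have "nform L (a - b) - (nform L a - nform L b) \<in> Kn"
    unfolding nform_def sum_subtractf[symmetric] Psi_diff
    using assms(1) by (intro Kn_sum Kn_left_diff Psi_R assms(2,3)) (auto simp: Wm_frag_of)
  then show ?thesis using Kn_trans[OF 1] Kn_swap by blast
qed

text \<open>A weight x is its representative m plus k \<delta>, and the power of e^\<delta> moves
  across the tensor sign to the factor in R. The remaining summands of the normal form have
  coefficient zero because distinct members of L are inequivalent modulo \<delta>.\<close>

lemma nform_Kn:
  assumes L: "finite L" "\<And>x. x \<in> L \<Longrightarrow> nf x = x \<and> x \<in> Y"
    and z: "Poly_Mapping.keys z \<subseteq> {(r, p). r \<in> R_set \<and> Poly_Mapping.keys p \<subseteq> {x \<in> Y. nf x \<in> L}}"
  shows "z - nform L z \<in> Kn"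
proof -
  let ?S = "{(r, p). r \<in> R_set \<and> Poly_Mapping.keys p \<subseteq> {x \<in> Y. nf x \<in> L}}"
  have LY: "frag_of x \<in> Wm" if "x \<in> L" for x using L(2)[OF that] by (simp add: Wm_frag_of)
  have SF: "Poly_Mapping.keys a \<subseteq> ?S \<Longrightarrow> a \<in> carrier FR" for a
    unfolding carrier_FR by (rule order_trans) (auto simp: Wm_def)
  have gen: "frag_of (r, p) - nform L (frag_of (r, p)) \<in> Kn"
    if r: "r \<in> R_set" and p: "Poly_Mapping.keys p \<subseteq> {x \<in> Y. nf x \<in> L}" for r p
  proof -
    have "p \<in> Wm \<and> frag_of (r, p) - nform L (frag_of (r, p)) \<in> Kn"
      using p
    proof (induction p rule: frag_induction)
      case zero
      have "nform L (frag_of (r, 0)) \<in> Kn"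
        unfolding nform_def by (intro Kn_sum) (simp add: iota_def Kn_left_zero LY)
      then show ?case using Kn_diff[OF Kn_right_zero[OF r]] by (simp add: Wm_def)
    next
      case (one x)
      define m where "m = nf x"
      define k where "k = qt x"
      have x: "x = k *s \<delta> + m" using nf_qt[of x] by (simp add: m_def k_def add.commute)
      have m: "m \<in> L" "nf m = m" using one by (auto simp: m_def)
      have "frag_of (exp_delta k * r, frag_of m) - frag_of (r, frag_of x) \<in> Kn"
        using Kn_smult[OF r LY[OF m(1)], of "frag_of k"]
        by (simp add: exp_delta_def laurent_embed_frag mult_single x)
      then have 1: "frag_of (r, frag_of x) - frag_of (exp_delta k * r, frag_of m) \<in> Kn"
        by (rule Kn_swap)
      have "nform L (frag_of (r, frag_of x)) = frag_of (r * eps x m, frag_of m)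
        + (\<Sum>y\<in>L - {m}. frag_of (r * eps x y, frag_of y))"
        using L(1) m(1) by (simp add: nform_def iota_def sum.remove)
      also have "r * eps x m = exp_delta k * r"
        using m(2) by (simp add: x eps_shift_left) (simp add: eps_def exp_delta_0)
      finally have 2: "nform L (frag_of (r, frag_of x)) - frag_of (exp_delta k * r, frag_of m)
        = (\<Sum>y\<in>L - {m}. frag_of (r * eps x y, frag_of y))" by simp
      have "(\<Sum>y\<in>L - {m}. frag_of (r * eps x y, frag_of y)) \<in> Kn"
      proof (rule Kn_sum)
        fix y assume y: "y \<in> L - {m}"
        then have "nf y = y" using L(2) by blast
        then have "eps x y = 0" using y by (auto simp: eps_def m_def)
        then show "frag_of (r * eps x y, frag_of y) \<in> Kn" using Kn_left_zero LY y by simp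
      qed
      then have "frag_of (exp_delta k * r, frag_of m) - nform L (frag_of (r, frag_of x)) \<in> Kn"
        unfolding 2[symmetric] by (rule Kn_swap)
      then show ?case using Kn_trans[OF 1] one by (simp add: Wm_frag_of)
    next
      case (diff a b)
      then have ab: "a \<in> Wm" "b \<in> Wm" by auto
      have fr: "frag_of (r, a) \<in> carrier FR" "frag_of (r, b) \<in> carrier FR"
        using ab r by (simp_all add: FR_frag_of)
      have "nform L (frag_of (r, a - b)) = nform L (frag_of (r, a) - frag_of (r, b))"
        unfolding nform_def Psi_diff by (simp add: iota_def lin_ext_diff right_diff_distrib)
      moreover have "(frag_of (r, a) - frag_of (r, b)) - nform L (frag_of (r, a) - frag_of (r, b)) \<in> Kn"
        using diff fr L(2) by (intro nform_diff) auto
      ultimately show ?case using Kn_trans[OF Kn_right_diff[OF r ab]] Wm_diff[OF ab] by simp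
    qed
    then show ?thesis ..
  qed
  have "z \<in> carrier FR \<and> z - nform L z \<in> Kn"
    using z
  proof (induction z rule: frag_induction)
    case zero
    have "nform L 0 \<in> Kn" unfolding nform_def Psi_def by (intro Kn_sum) (simp add: Kn_left_zero LY)
    then show ?case using Kn_minus by (simp add: carrier_FR)
  next
    case (one q)
    then show ?case using gen SF[of "frag_of q"] by (cases q) auto
  next
    case (diff a b)
    then have ab: "a \<in> carrier FR" "b \<in> carrier FR" by auto
    have "(a - b) - nform L (a - b) \<in> Kn" using diff ab L(2) by (intro nform_diff) auto
    then show ?case using FR_diff[OF ab] by blast
  qed
  then show ?thesis ..
qed

definition "reps z = (\<Union>(r, p)\<in>Poly_Mapping.keys z. nf ` Poly_Mapping.keys p)"

lemma finite_reps: "finite (reps z)"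
  unfolding reps_def by (intro finite_UN_I) auto

text \<open>Modulo the kernel a tensor equals its normal form, all of whose coefficients are values
  of \<open>Psi\<close>. So \<open>Psi\<close> is injective on the tensor product, which is to say
  that the chosen weights form a basis over R.\<close>

lemma Kn_iff: "z \<in> Kn \<longleftrightarrow> z \<in> carrier FR \<and> (\<forall>y. Psi z y = 0)"
proof
  assume z: "z \<in> carrier FR \<and> (\<forall>y. Psi z y = 0)"
  have Y: "x \<in> Y" if "x \<in> reps z" for x
    using that z by (fastforce simp: reps_def carrier_FR Wm_def intro: Y_nf)
  have "z - nform (reps z) z \<in> Kn"
  proof (rule nform_Kn[OF finite_reps])
    show "nf x = x \<and> x \<in> Y" if "x \<in> reps z" for x
      using Y[OF that] that by (auto simp: reps_def)
    show "Poly_Mapping.keys z \<subseteq> {(r, p). r \<in> R_set \<and> Poly_Mapping.keys p \<subseteq> {x \<in> Y. nf x \<in> reps z}}"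
      using z by (fastforce simp: reps_def carrier_FR Wm_def)
  qed
  moreover have "nform (reps z) z \<in> Kn"
    unfolding nform_def using z Y by (intro Kn_sum) (simp add: Kn_left_zero Wm_frag_of)
  ultimately show "z \<in> Kn" using Kn_add by fastforce
qed (simp add: Kn_FR Psi_Kn)

text \<open>The image of \<open>Psi\<close>, by \<open>Psi_good\<close> and
  \<open>good_Psi\<close>.\<close>

definition "good f \<longleftrightarrow> (\<forall>x n. f (x + n *s \<delta>) = exp_delta (- n) * f x) \<and> (\<forall>x. f x \<in> R_set) \<and>
  finite (nf ` {x. f x \<noteq> 0}) \<and> (\<forall>x. f x \<noteq> 0 \<longrightarrow> x \<in> Y)"

lemma Psi_good:
  assumes z: "z \<in> carrier FR"
  shows "good (Psi z)"
  unfolding good_def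
proof (intro conjI allI impI)
  show "Psi z (x + n *s \<delta>) = exp_delta (- n) * Psi z x" for x n
  proof -
    have "iota p (x + n *s \<delta>) = exp_delta (- n) * iota p x" for p
      by (simp add: iota_def lin_ext_def eps_shift_right sum_distrib_left mult.left_commute)
    then show ?thesis
      by (simp add: Psi_def lin_ext_def sum_distrib_left case_prod_unfold mult_ac)
  qed
  show "Psi z x \<in> R_set" for x by (rule Psi_R[OF z])
  have supp: "\<exists>r p v. (r, p) \<in> Poly_Mapping.keys z \<and> v \<in> Poly_Mapping.keys p \<and> nf v = nf x" if nz: "Psi z x \<noteq> 0" for x
  proof -
    obtain r p where rp: "(r, p) \<in> Poly_Mapping.keys z" "iota p x \<noteq> 0"
      using lin_ext_nonzero[OF nz[unfolded Psi_def]] by auto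
    obtain v where "v \<in> Poly_Mapping.keys p" "eps v x \<noteq> 0"
      using lin_ext_nonzero[OF rp(2)[unfolded iota_def]] by auto
    then show ?thesis using rp by (auto simp: eps_def split: if_splits)
  qed
  have "nf ` {x. Psi z x \<noteq> 0} \<subseteq> reps z"
  proof
    fix u assume "u \<in> nf ` {x. Psi z x \<noteq> 0}"
    then obtain x where x: "u = nf x" "Psi z x \<noteq> 0" by blast
    obtain r p v where rpv: "(r, p) \<in> Poly_Mapping.keys z" "v \<in> Poly_Mapping.keys p" "nf v = nf x"
      using supp[OF x(2)] by blast
    show "u \<in> reps z"
      unfolding reps_def x(1) rpv(3)[symmetric] by (rule UN_I[OF rpv(1)]) (simp add: rpv(2))
  qed
  then show "finite (nf ` {x. Psi z x \<noteq> 0})" by (rule finite_subset) (rule finite_reps)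
  show "x \<in> Y" if nz: "Psi z x \<noteq> 0" for x
  proof -
    obtain r p v where rpv: "(r, p) \<in> Poly_Mapping.keys z" "v \<in> Poly_Mapping.keys p" "nf v = nf x"
      using supp[OF nz] by blast
    then have "v \<in> Y" using z by (auto simp: carrier_FR Wm_def)
    then show ?thesis using nf_eqD[OF rpv(3)] Y_shift by metis
  qed
qed

lemma good_Psi:
  assumes "good f"
  obtains z where "z \<in> carrier FR" "Psi z = f"
proof -
  define L where "L = nf ` {x. f x \<noteq> 0}"
  have L: "finite L" using assms by (simp add: L_def good_def)
  have LY: "x \<in> Y" if "x \<in> L" for x using that assms by (auto simp: L_def good_def intro: Y_nf)
  have shift: "f (x + n *s \<delta>) = exp_delta (- n) * f x" for x n using assms by (simp add: good_def)
  define z where "z = (\<Sum>x\<in>L. frag_of (f x, frag_of x))"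
  have "z \<in> carrier FR"
    unfolding carrier_FR z_def
    by (rule order_trans[OF keys_sum]) (use assms LY in \<open>auto simp: good_def Wm_frag_of\<close>)
  moreover have "Psi z y = f y" for y
  proof -
    have "Psi z y = (\<Sum>x\<in>L. f x * eps x y)"
      by (simp add: z_def Psi_def lin_ext_sum iota_def)
    also have "\<dots> = (\<Sum>x\<in>L. if nf y = x then f y else 0)"
    proof (rule sum.cong)
      fix x assume "x \<in> L"
      then have nfx: "nf x = x" by (auto simp: L_def)
      show "f x * eps x y = (if nf y = x then f y else 0)"
      proof (cases "nf y = x")
        case True
        then have y: "y = x + qt y *s \<delta>" using nf_qt[of y] by simp
        have "eps x y = exp_delta (- qt y)" using eps_shift[of x "qt y"] y by simp
        moreover have "f y = exp_delta (- qt y) * f x" using shift[of x "qt y"] y by simp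
        ultimately show ?thesis using True by simp
      qed (simp add: eps_def nfx eq_commute)
    qed simp
    also have "\<dots> = f y"
    proof -
      have "f y = 0" if "nf y \<notin> L" using that by (auto simp: L_def)
      then show ?thesis using L by simp
    qed
    finally show ?thesis .
  qed
  ultimately show thesis by (intro that[of z]) auto
qed

end

section \<open>The group of cocycles, and cohomology in terms of functions\<close>

lemma comm_group_cocycles1:
  fixes G (structure) and B (structure)
  assumes "group G" "comm_group B" and act: "\<And>g. g \<in> carrier G \<Longrightarrow> act g \<in> hom B B"
  shows "comm_group (cocycles1 G B act)"
proof -
  interpret G: group G by fact
  interpret B: comm_group B by fact
  let ?C = "cocycles1 G B act"
  have closed: "f g \<in> carrier B" if "f \<in> carrier ?C" "g \<in> carrier G" for f g
    using that by (auto simp: cocycles1_def)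
  have ext: "f \<in> extensional (carrier G)" if "f \<in> carrier ?C" for f
    using that by (simp add: cocycles1_def PiE_def)
  have coc: "f (g \<otimes>\<^bsub>G\<^esub> k) = f g \<otimes>\<^bsub>B\<^esub> act g (f k)"
    if "f \<in> carrier ?C" "g \<in> carrier G" "k \<in> carrier G" for f g k
    using that by (auto simp: cocycles1_def)
  have act_closed: "act g x \<in> carrier B" if "g \<in> carrier G" "x \<in> carrier B" for g x
    using act[OF that(1)] that(2) by (rule hom_in_carrier)
  have act_mult: "act g (x \<otimes>\<^bsub>B\<^esub> y) = act g x \<otimes>\<^bsub>B\<^esub> act g y"
    if "g \<in> carrier G" "x \<in> carrier B" "y \<in> carrier B" for g x y
    using hom_mult[OF act[OF that(1)] that(2,3)] .
  have act_hom: "group_hom B B (act g)" if "g \<in> carrier G" for g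
    using act[OF that] by (simp add: group_hom_def group_hom_axioms_def B.is_group)
  have inC: "f \<in> carrier ?C" if "f \<in> carrier G \<rightarrow>\<^sub>E carrier B"
    "\<And>g k. g \<in> carrier G \<Longrightarrow> k \<in> carrier G \<Longrightarrow> f (g \<otimes>\<^bsub>G\<^esub> k) = f g \<otimes>\<^bsub>B\<^esub> act g (f k)" for f
    using that by (simp add: cocycles1_def)
  have mult: "f \<otimes>\<^bsub>?C\<^esub> f' = (\<lambda>g\<in>carrier G. f g \<otimes>\<^bsub>B\<^esub> f' g)" for f f'
    by (simp add: cocycles1_def)
  have one: "\<one>\<^bsub>?C\<^esub> = (\<lambda>g\<in>carrier G. \<one>\<^bsub>B\<^esub>)"
    by (simp add: cocycles1_def)
  show ?thesis
  proof (rule comm_groupI)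
    show "f \<otimes>\<^bsub>?C\<^esub> f' \<in> carrier ?C" if "f \<in> carrier ?C" "f' \<in> carrier ?C" for f f'
      unfolding mult
    proof (rule inC)
      fix g k assume gk: "g \<in> carrier G" "k \<in> carrier G"
      note c = closed[OF that(1) gk(1)] closed[OF that(1) gk(2)] closed[OF that(2) gk(1)] closed[OF that(2) gk(2)]
      have "f g \<otimes>\<^bsub>B\<^esub> act g (f k) \<otimes>\<^bsub>B\<^esub> (f' g \<otimes>\<^bsub>B\<^esub> act g (f' k))
        = f g \<otimes>\<^bsub>B\<^esub> f' g \<otimes>\<^bsub>B\<^esub> (act g (f k) \<otimes>\<^bsub>B\<^esub> act g (f' k))"
        using c gk by (simp add: B.m_ac act_closed)
      then show "(\<lambda>g\<in>carrier G. f g \<otimes>\<^bsub>B\<^esub> f' g) (g \<otimes>\<^bsub>G\<^esub> k)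
        = (\<lambda>g\<in>carrier G. f g \<otimes>\<^bsub>B\<^esub> f' g) g \<otimes>\<^bsub>B\<^esub> act g ((\<lambda>g\<in>carrier G. f g \<otimes>\<^bsub>B\<^esub> f' g) k)"
        using gk c by (simp add: coc[OF that(1) gk] coc[OF that(2) gk] act_mult)
    qed (use closed that in auto)
    show "\<one>\<^bsub>?C\<^esub> \<in> carrier ?C"
      unfolding one by (rule inC) (auto simp: group_hom.hom_one[OF act_hom])
    show "f \<otimes>\<^bsub>?C\<^esub> f' \<otimes>\<^bsub>?C\<^esub> f'' = f \<otimes>\<^bsub>?C\<^esub> (f' \<otimes>\<^bsub>?C\<^esub> f'')"
      if "f \<in> carrier ?C" "f' \<in> carrier ?C" "f'' \<in> carrier ?C" for f f' f''
      unfolding mult using closed that by (intro restrict_ext) (simp add: B.m_assoc)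
    show "f \<otimes>\<^bsub>?C\<^esub> f' = f' \<otimes>\<^bsub>?C\<^esub> f" if "f \<in> carrier ?C" "f' \<in> carrier ?C" for f f'
      unfolding mult using closed that by (intro restrict_ext) (simp add: B.m_comm)
    show "\<one>\<^bsub>?C\<^esub> \<otimes>\<^bsub>?C\<^esub> f = f" if "f \<in> carrier ?C" for f
      unfolding mult one by (rule extensionalityI[OF _ ext[OF that]]) (use closed[OF that] in auto)
    show "\<exists>f'\<in>carrier ?C. f' \<otimes>\<^bsub>?C\<^esub> f = \<one>\<^bsub>?C\<^esub>" if "f \<in> carrier ?C" for f
    proof (rule bexI[of _ "\<lambda>g\<in>carrier G. inv\<^bsub>B\<^esub> f g"])
      show "(\<lambda>g\<in>carrier G. inv\<^bsub>B\<^esub> f g) \<otimes>\<^bsub>?C\<^esub> f = \<one>\<^bsub>?C\<^esub>"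
        unfolding mult one using closed[OF that] by (intro restrict_ext) simp
      show "(\<lambda>g\<in>carrier G. inv\<^bsub>B\<^esub> f g) \<in> carrier ?C"
      proof (rule inC)
        fix g k assume gk: "g \<in> carrier G" "k \<in> carrier G"
        note c = closed[OF that gk(1)] closed[OF that gk(2)]
        show "(\<lambda>g\<in>carrier G. inv\<^bsub>B\<^esub> f g) (g \<otimes>\<^bsub>G\<^esub> k)
          = (\<lambda>g\<in>carrier G. inv\<^bsub>B\<^esub> f g) g \<otimes>\<^bsub>B\<^esub> act g ((\<lambda>g\<in>carrier G. inv\<^bsub>B\<^esub> f g) k)"
          using gk c by (simp add: coc[OF that gk] B.inv_mult act_closed group_hom.hom_inv[OF act_hom])
      qed (use closed[OF that] in auto)
    qed
  qed
qed

lemma trivial_group_Mod_self: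
  fixes G (structure)
  assumes "comm_group G"
  shows "trivial_group (G Mod carrier G)"
proof -
  interpret comm_group G by fact
  have "group (G Mod carrier G)"
    by (intro normal.factorgroup_is_group subgroup_imp_normal subgroup_self)
  moreover have "carrier (G Mod carrier G) = {carrier G}"
  proof -
    have "carrier G #> x = carrier G" if "x \<in> carrier G" for x
      by (rule coset_join2[OF that subgroup_self that])
    then have "(\<Union>x\<in>carrier G. {carrier G #> x}) = (\<Union>x\<in>carrier G. {carrier G})"
      by (intro SUP_cong) simp_all
    then show ?thesis using one_closed by (auto simp: FactGroup_def RCOSETS_def)
  qed
  ultimately show ?thesis by (simp add: trivial_group_def FactGroup_def)
qed

context weight_tensor begin

text \<open>For good f this fibre of \<open>Psi\<close> is a coset of the tensor kernel, so good
  functions name the elements of the tensor product.\<close>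

definition "cs f = {z \<in> carrier FR. Psi z = f}"
abbreviation "act w \<equiv> tensor_map (ring_of_type_algebra :: laurent ring) R_module (weight_module A Y) (weyl_act w)"

lemma normal_Kn: "Kn \<lhd> FR"
  by (rule comm_group.subgroup_imp_normal[OF comm_group_FR subgroup_Kn])

lemma coset_eq:
  assumes z: "z \<in> carrier FR"
  shows "Kn #>\<^bsub>FR\<^esub> z = cs (Psi z)"
proof
  show "Kn #>\<^bsub>FR\<^esub> z \<subseteq> cs (Psi z)"
  proof
    fix u assume "u \<in> Kn #>\<^bsub>FR\<^esub> z"
    then obtain k where k: "k \<in> Kn" "u = k + z" by (auto simp: r_coset_def)
    have "u \<in> carrier FR" using group.is_monoid[OF group_FR, THEN monoid.m_closed, OF Kn_FR[OF k(1)] z] k(2) by simp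
    moreover have "Psi u = Psi z" by (rule ext) (simp add: k(2) Psi_add Psi_Kn[OF k(1)])
    ultimately show "u \<in> cs (Psi z)" by (simp add: cs_def)
  qed
  show "cs (Psi z) \<subseteq> Kn #>\<^bsub>FR\<^esub> z"
  proof
    fix u assume u: "u \<in> cs (Psi z)"
    then have "u - z \<in> Kn" using z by (simp add: Kn_iff cs_def FR_diff Psi_diff)
    then show "u \<in> Kn #>\<^bsub>FR\<^esub> z" unfolding r_coset_def by (auto intro!: bexI[of _ "u - z"])
  qed
qed

lemma coset_cs: "z \<in> carrier FR \<Longrightarrow> Psi z = f \<Longrightarrow> Kn #>\<^bsub>FR\<^esub> z = cs f"
  using coset_eq by blast

lemma carrier_T: "carrier T = {cs f | f. good f}"
proof -
  have "carrier T = {Kn #>\<^bsub>FR\<^esub> z | z. z \<in> carrier FR}"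
    by (auto simp: tensor_product_def FactGroup_def RCOSETS_def)
  also have "\<dots> = {cs f | f. good f}"
    using coset_eq Psi_good good_Psi by (metis (no_types, lifting))
  finally show ?thesis .
qed

lemma cs_inj: "good f \<Longrightarrow> cs f = cs g \<Longrightarrow> f = g"
  by (rule good_Psi[of f]) (auto simp: cs_def)

lemma comm_group_T: "comm_group T"
  unfolding tensor_product_def by (rule comm_group.abelian_FactGroup[OF comm_group_FR subgroup_Kn])

lemma FR_add: "x \<in> carrier FR \<Longrightarrow> y \<in> carrier FR \<Longrightarrow> x + y \<in> carrier FR"
  using monoid.m_closed[OF group.is_monoid[OF group_FR]] by simp

lemma cs_mult:
  assumes "good f" "good g"
  shows cs_mult_eq: "cs f \<otimes>\<^bsub>T\<^esub> cs g = cs (\<lambda>x. f x + g x)" and good_add: "good (\<lambda>x. f x + g x)"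
proof -
  obtain y where y: "y \<in> carrier FR" "Psi y = f" using assms(1) by (rule good_Psi)
  obtain z where z: "z \<in> carrier FR" "Psi z = g" using assms(2) by (rule good_Psi)
  have sum: "y + z \<in> carrier FR" "Psi (y + z) = (\<lambda>x. f x + g x)"
    using FR_add[OF y(1) z(1)] y(2) z(2) by (auto simp: Psi_add)
  have "cs f \<otimes>\<^bsub>T\<^esub> cs g = (Kn #>\<^bsub>FR\<^esub> y) <#>\<^bsub>FR\<^esub> (Kn #>\<^bsub>FR\<^esub> z)"
    by (simp add: coset_cs y z) (simp add: tensor_product_def FactGroup_def)
  also have "\<dots> = Kn #>\<^bsub>FR\<^esub> (y + z)" using normal.rcos_sum[OF normal_Kn y(1) z(1)] by simp
  finally show "cs f \<otimes>\<^bsub>T\<^esub> cs g = cs (\<lambda>x. f x + g x)" by (simp only: coset_cs[OF sum])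
  show "good (\<lambda>x. f x + g x)" using Psi_good[OF sum(1)] by (simp only: sum(2))
qed

lemma cs_one: "\<one>\<^bsub>T\<^esub> = cs (\<lambda>_. 0)"
proof -
  have "\<one>\<^bsub>T\<^esub> = Kn" by (simp add: tensor_product_def FactGroup_def)
  moreover have "z \<in> Kn \<longleftrightarrow> z \<in> cs (\<lambda>_. 0)" for z
    unfolding Kn_iff cs_def by (simp add: fun_eq_iff)
  ultimately show ?thesis by blast
qed

lemma cs_inv:
  assumes "good f"
  shows cs_inv_eq: "inv\<^bsub>T\<^esub> cs f = cs (\<lambda>x. - f x)" and good_minus: "good (\<lambda>x. - f x)"
proof -
  interpret T: comm_group T by (rule comm_group_T)
  obtain y where y: "y \<in> carrier FR" "Psi y = f" using assms by (rule good_Psi)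
  have "- y \<in> carrier FR" using y(1) by (simp add: carrier_FR)
  moreover have "Psi (- y) = (\<lambda>x. - f x)"
    using y(2) by (auto simp: Psi_def lin_ext_minus)
  ultimately show good: "good (\<lambda>x. - f x)" using Psi_good by metis
  show "inv\<^bsub>T\<^esub> cs f = cs (\<lambda>x. - f x)"
    by (rule T.inv_equality)
      (use assms good in \<open>auto simp: carrier_T cs_mult_eq cs_one\<close>)
qed

lemma act_cs:
  assumes w: "w \<in> W" and f: "good f"
  shows act_cs_eq: "act w (cs f) = cs (\<lambda>x. f (invf w x))" and good_W: "good (\<lambda>x. f (invf w x))"
proof -
  define e where "e = frag_extend (\<lambda>(r, p). frag_of (r :: laurent fract, weyl_act w p))"
  have e: "e z \<in> carrier FR \<and> Psi (e z) = (\<lambda>x. Psi z (invf w x))" if z: "z \<in> carrier FR" for z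
  proof
    have "weyl_act w p \<in> Wm" if "p \<in> Wm" for p
      using that Y_W[OF _ w] keys_frag_extend[of "\<lambda>x. frag_of (w x)" p]
      by (fastforce simp: Wm_def weyl_act_frag)
    then show "e z \<in> carrier FR"
      using z keys_frag_extend[of "\<lambda>(r, p). frag_of (r, weyl_act w p)" z]
      unfolding carrier_FR e_def by fastforce
    have "iota (weyl_act w p) x = iota p (invf w x)" for p x
      by (simp add: iota_def weyl_act_frag lin_ext_frag_extend eps_W[OF w])
    then show "Psi (e z) = (\<lambda>x. Psi z (invf w x))"
      by (simp add: fun_eq_iff Psi_def e_def lin_ext_frag_extend case_prod_unfold)
  qed
  obtain z0 where z0: "z0 \<in> carrier FR" "Psi z0 = f" using f by (rule good_Psi)
  have "act w (cs f) = (\<Union>z\<in>cs f. Kn #>\<^bsub>FR\<^esub> e z)"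
    by (simp add: tensor_map_def e_def)
  also have "\<dots> = (\<Union>z\<in>cs f. cs (\<lambda>x. f (invf w x)))"
  proof (rule SUP_cong)
    fix z assume "z \<in> cs f"
    then have "z \<in> carrier FR" "Psi z = f" by (auto simp: cs_def)
    then show "Kn #>\<^bsub>FR\<^esub> e z = cs (\<lambda>x. f (invf w x))" using e[of z] by (intro coset_cs) auto
  qed simp
  \<comment> \<open>All members of the union agree; z0 witnesses that the union is not
    empty.\<close>
  also have "\<dots> = cs (\<lambda>x. f (invf w x))" using z0 by (auto simp: cs_def)
  finally show "act w (cs f) = cs (\<lambda>x. f (invf w x))" .
  show "good (\<lambda>x. f (invf w x))" using e[OF z0(1)] Psi_good[of "e z0"] z0(2) by metis
qed

lemma act_hom:
  assumes w: "w \<in> W"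
  shows "act w \<in> hom T T"
proof (rule homI)
  fix c c' assume "c \<in> carrier T" "c' \<in> carrier T"
  then obtain f f' where f: "good f" "c = cs f" "good f'" "c' = cs f'" by (auto simp: carrier_T)
  show "act w (c \<otimes>\<^bsub>T\<^esub> c') = act w c \<otimes>\<^bsub>T\<^esub> act w c'"
    using w f by (simp only: cs_mult_eq act_cs_eq good_add good_W)
next
  fix c assume "c \<in> carrier T"
  then obtain f where "good f" "c = cs f" by (auto simp: carrier_T)
  then show "act w c \<in> carrier T" using w by (auto simp: carrier_T act_cs_eq intro: good_W)
qed

text \<open>The quotient is trivial once coboundaries and cocycles are the same set. One inclusion
  is a computation with functions; for the other, functions representing a cocycle of cosets satisfy
  the hypotheses of \<open>twisted_cocycle\<close>, whose primitive is again good.\<close>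

theorem cohomology_trivial:
  assumes lev: "CARD('i) > 2 \<or> (\<forall>x\<in>Y. \<bar>level x\<bar> < level rho)"
  shows "trivial_group (weyl_cohomology1 A Y)"
proof -
  let ?G = "weyl_group A"
  let ?C = "cocycles1 ?G T act"
  have comm: "comm_group ?C"
    by (intro comm_group_cocycles1 group_weyl_group comm_group_T) (simp add: carrier_weyl_group act_hom)
  have mult: "v \<otimes>\<^bsub>?G\<^esub> w = v \<circ> w" if "v \<in> W" "w \<in> W" for v w
    using that by (intro weyl_group_mult W_bij)
  have "coboundaries1 ?G T act \<subseteq> carrier ?C"
  proof
    fix f assume "f \<in> coboundaries1 ?G T act"
    then obtain b where b: "good b" and f: "f = (\<lambda>w\<in>W. act w (cs b) \<otimes>\<^bsub>T\<^esub> inv\<^bsub>T\<^esub> cs b)"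
      by (auto simp: coboundaries1_def carrier_T carrier_weyl_group)
    define g where "g = (\<lambda>w x. b (invf w x) + - b x)"
    have g: "good (g w)" if "w \<in> W" for w
      unfolding g_def by (intro good_add good_W good_minus b that)
    have fg: "f w = cs (g w)" if "w \<in> W" for w
      using that by (simp add: f g_def act_cs_eq cs_inv_eq cs_mult_eq good_W good_minus b)
    have "f (v \<otimes>\<^bsub>?G\<^esub> w) = f v \<otimes>\<^bsub>T\<^esub> act v (f w)" if vw: "v \<in> W" "w \<in> W" for v w
    proof -
      have "invf (v \<circ> w) x = invf w (invf v x)" for x
        using o_inv_distrib[OF W_bij[OF vw(1)] W_bij[OF vw(2)]] by (simp only: comp_apply)
      then have "g (v \<circ> w) = (\<lambda>x. g v x + g w (invf v x))" by (simp only: g_def) simp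
      then show ?thesis
        by (simp only: mult[OF vw] fg vw W_comp act_cs_eq g cs_mult_eq good_W)
    qed
    moreover have "f \<in> W \<rightarrow>\<^sub>E carrier T"
    proof (rule PiE_I)
      show "f w \<in> carrier T" if "w \<in> W" for w using fg[OF that] g[OF that] by (auto simp: carrier_T)
      show "f w = undefined" if "w \<notin> W" for w using that by (simp add: f)
    qed
    ultimately show "f \<in> carrier ?C" by (simp add: cocycles1_def carrier_weyl_group)
  qed
  moreover have "carrier ?C \<subseteq> coboundaries1 ?G T act"
  proof
    fix f assume "f \<in> carrier ?C"
    then have f: "f \<in> W \<rightarrow>\<^sub>E carrier T"
      and coc: "\<And>v w. v \<in> W \<Longrightarrow> w \<in> W \<Longrightarrow> f (v \<circ> w) = f v \<otimes>\<^bsub>T\<^esub> act v (f w)"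
      by (auto simp: cocycles1_def carrier_weyl_group mult[symmetric] simp del: comp_apply)
    \<comment> \<open>By \<open>cs_inj\<close> the representing function is unique, so the cocycle
      identity between cosets becomes an identity between functions.\<close>
    define F where "F = (\<lambda>w. SOME u. good u \<and> f w = cs u)"
    have F: "good (F w)" "f w = cs (F w)" if w: "w \<in> W" for w
    proof -
      have "f w \<in> carrier T" using f w by (rule PiE_mem)
      then have "\<exists>u. good u \<and> f w = cs u" by (auto simp: carrier_T)
      then have "good (F w) \<and> f w = cs (F w)" unfolding F_def by (rule someI_ex)
      then show "good (F w)" "f w = cs (F w)" by auto
    qed
    have "cocycle F"
      unfolding cocycle_def
    proof (intro ballI allI)
      fix v w x assume vw: "v \<in> W" "w \<in> W"
      have "cs (F (v \<circ> w)) = cs (F v) \<otimes>\<^bsub>T\<^esub> act v (cs (F w))"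
        using coc[OF vw] by (simp only: F(2)[OF vw(1)] F(2)[OF vw(2)] F(2)[OF W_comp[OF vw]])
      also have "\<dots> = cs (\<lambda>x. F v x + F w (invf v x))"
        using F(1) vw by (simp only: act_cs_eq cs_mult_eq good_W)
      finally have "F (v \<circ> w) = (\<lambda>x. F v x + F w (invf v x))"
        by (rule cs_inj[OF F(1)[OF W_comp[OF vw]]])
      then show "F (v \<circ> w) x = F v x + F w (invf v x)" by (rule fun_cong)
    qed
    then interpret tc: twisted_cocycle A exp_delta R_set Y F
    proof unfold_locales
      show "F w (x + n *s \<delta>) = exp_delta (- n) * F w x" "F w x \<in> R_set" if "w \<in> W" for w x n
        using F(1)[OF that] by (simp_all add: good_def)
      show "x \<in> Y" if "w \<in> W" "F w x \<noteq> 0" for w x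
        using F(1)[OF that(1)] that(2) by (simp add: good_def)
      show "finite (nf ` {x. F (s i) x \<noteq> 0})" for i
        using F(1)[OF W_reflection] by (simp add: good_def)
    qed (assumption | rule exp_delta_add exp_delta_eq_1_iff R_null R_minus R_times R_exp_delta
        R_inverse_exp_delta fract_two_torsion_free Y_stable lev)+
    obtain b where b: "tc.primitive_on Y b" "\<And>w x. w \<in> W \<Longrightarrow> F w x = b (invf w x) - b x"
      using tc.primitive_exists by blast
    have good: "good b" using b(1) by (simp add: good_def tc.primitive_on_def)
    have "f w = act w (cs b) \<otimes>\<^bsub>T\<^esub> inv\<^bsub>T\<^esub> cs b" if "w \<in> W" for w
    proof -
      have "F w = (\<lambda>x. b (invf w x) + - b x)" by (rule ext) (simp add: b(2) that)
      then show ?thesis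
        using that good by (simp only: F(2) act_cs_eq cs_inv_eq cs_mult_eq good_W good_minus)
    qed
    then have "f = (\<lambda>w\<in>W. act w (cs b) \<otimes>\<^bsub>T\<^esub> inv\<^bsub>T\<^esub> cs b)"
      using f by (intro extensionalityI[of f W]) (auto simp: PiE_def)
    then show "f \<in> coboundaries1 ?G T act"
      unfolding coboundaries1_def carrier_weyl_group carrier_T using good by blast
  qed
  ultimately have "coboundaries1 ?G T act = carrier ?C" by blast
  then show ?thesis
    using trivial_group_Mod_self[OF comm] by (simp add: weyl_cohomology1_def cohomology1_def)
qed

end

theorem theorem5p2:
  fixes A :: "int ^ 'i ^ 'i"
  assumes "affine_cartan_matrix A"
  shows "(CARD('i) > 2 \<longrightarrow> trivial_group (weyl_cohomology1 A UNIV)) \<and>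
    trivial_group (weyl_cohomology1 A
      {x. \<bar>central_element A x\<bar> < central_element A rho})"
proof (intro conjI impI)
  interpret affine_cartan A by unfold_locales (rule assms)
  show "trivial_group (weyl_cohomology1 A UNIV)" if "CARD('i) > 2"
  proof -
    interpret weight_tensor A UNIV by unfold_locales simp
    show ?thesis by (rule cohomology_trivial) (use that in simp)
  qed
  let ?Y = "{x. \<bar>central_element A x\<bar> < central_element A rho}"
  have "level \<delta> = 0" by (simp add: level_eq)
  then interpret weight_tensor A ?Y
    by unfold_locales (simp add: level_linear W_level)
  show "trivial_group (weyl_cohomology1 A ?Y)" by (rule cohomology_trivial) simp
qed

end
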